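(* Let $T>0$, $\gamma\in(1/2,1)$, $\kappa\in(0,1)$ with $\gamma(\kappa+1)<1$, and let $x\in\mathcal{C}^\gamma([0,T];\mathbb{R})$. Let $\sigma:\mathbb{R}^m\to\mathbb{R}^m$ satisfy $\sigma(0)=0$ and, for some constant $C$, $|\sigma(\xi_2)-\sigma(\xi_1)|\le C\,\big||\xi_2|^\kappa-|\xi_1|^\kappa\big|$ for all $\xi_1,\xi_2\in\mathbb{R}^m$. Let $\eta$ be such that $\frac{1-\gamma(1+\kappa)}{\gamma}<\eta<1-\kappa$. Then: (i) If $y\in\mathcal{C}^\gamma_\eta([0,T];\mathbb{R}^m)$, then for any $t\in[0,T]$ the integral $[\Lambda(y)]_t:=\int_0^t\sigma(y_s)\,dx_s$ is well defined in the fractional sense described in the context. (ii) If $y$ satisfies the stronger condition $y\in\mathcal{C}^\gamma_{\eta/(\gamma(\kappa+\eta))}([0,T];\mathbb{R}^m)$ (note that $\gamma(\kappa+\eta)<\gamma<1$), then $\Lambda(y)\in\mathcal{C}^\gamma([0,T];\mathbb{R}^m)$ and $$\|\Lambda(y)\|_\gamma\le c\,\|x\|_\gamma\left(\|\sigma(y)\|_\infty+\mathcal{N}_{\kappa,\sigma}\,\|y\|_\gamma^{\kappa+\eta}\left(\int_0^T|y_s|^{-\frac{\eta}{\gamma(\kappa+\eta)}}\,ds\right)^{\gamma(\kappa+\eta)}\right),$$ where $c$ is a constant depending only on the parameters of the model (such as $\gamma,\kappa,\eta,T$).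
   Context: Notation: $\|f\|_\gamma=\sup_{s<t}|f_t-f_s|/|t-s|^\gamma$ on $[0,T]$. For $\gamma\in(0,1)$ and $\eta>0$, $\mathcal{C}^\gamma_\eta([0,T];\mathbb{R}^m)=\{y\in\mathcal{C}^\gamma([0,T];\mathbb{R}^m): |y|^{-1}\in L^\eta([0,T];\mathbb{R})\}$, i.e. $\int_0^T|y_s|^{-\eta}ds<\infty$. Also $\mathcal{N}_{\kappa,\sigma}=\sup\big\{\frac{|\sigma(\xi_2)-\sigma(\xi_1)|}{||\xi_2|^\kappa-|\xi_1|^\kappa|}:\xi_1,\xi_2\in\mathbb{R}^m,\ |\xi_1|\ne|\xi_2|\big\}$. Fractional integral. For $0\le a<b\le T$, $\alpha\in(0,1)$: $I_{a+}^\alpha f_t=\frac1{\Gamma(\alpha)}\int_a^t(t-r)^{\alpha-1}f_r\,dr$, $I_{b-}^\alpha f_t=\frac1{\Gamma(\alpha)}\int_t^b(r-t)^{\alpha-1}f_r\,dr$; $I_{a+}^\alpha(L^p)$, $I_{b-}^\alpha(L^p)$ denote the images of $L^p([a,b])$. Their inverses are the fractional derivatives $D_{a+}^\alpha f_t=\frac1{\Gamma(1-\alpha)}\Big(\frac{f_t}{(t-a)^\alpha}+\alpha\int_a^t\frac{f_t-f_r}{(t-r)^{1+\alpha}}dr\Big)$ and $D_{b-}^\alpha f_t=\frac1{\Gamma(1-\alpha)}\Big(\frac{f_t}{(b-t)^\alpha}+\alpha\int_t^b\frac{f_t-f_r}{(r-t)^{1+\alpha}}dr\Big)$ (in general the inner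 integrals are $L^p$-limits of the integrals over $[a,t-\varepsilon]$, resp. $[t+\varepsilon,b]$, as $\varepsilon\downarrow0$, with $f$ extended by $0$ outside $[a,b]$). Let $g^{b-}_r=g_r-g_{b-}$. If for some $\alpha\in(0,1)$ one has $f\in I_{a+}^\alpha(L^1)$, $g^{b-}\in I_{b-}^{1-\alpha}(L^1)$ and $(D_{a+}^\alpha f)\,D_{b-}^{1-\alpha}g^{b-}\in L^1([a,b])$, then $f$ is said to be integrable with respect to $g$ and $\int_a^bf_r\,dg_r:=-\int_a^b(D_{a+}^\alpha f_r)\,D_{b-}^{1-\alpha}g^{b-}_r\,dr$. For vector-valued $f$ the definition is componentwise; the integral over a degenerate interval is $0$. *)

theory Defs
  imports "HOL-Analysis.Analysis"
begin

definition holder_quotients :: "real \<Rightarrow> real \<Rightarrow> (real \<Rightarrow> 'a::real_normed_vector) \<Rightarrow> real set" where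
  "holder_quotients \<gamma> T f = {norm (f t - f s) / \<bar>t - s\<bar> powr \<gamma> | s t. 0 \<le> s \<and> s < t \<and> t \<le> T}"

definition holder_seminorm :: "real \<Rightarrow> real \<Rightarrow> (real \<Rightarrow> 'a::real_normed_vector) \<Rightarrow> real" where
  "holder_seminorm \<gamma> T f = Sup (holder_quotients \<gamma> T f)"

text \<open>Paths are total functions on the reals; only their values on \<open>[0, T]\<close> matter.\<close>

definition holder_space :: "real \<Rightarrow> real \<Rightarrow> (real \<Rightarrow> 'a::real_normed_vector) set" where
  "holder_space \<gamma> T = {f. bdd_above (holder_quotients \<gamma> T f)}"

text \<open>The integral of \<open>|y|\<close> to the power \<open>-\<eta>\<close> over \<open>[0, T]\<close>. It is taken in the extended
  nonnegative reals, where the inverse of \<open>0\<close> is \<open>\<infinity>\<close>: the zeros of \<open>y\<close> count with the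
  value \<open>\<infinity>\<close>, whereas the real number \<open>0 powr (- \<eta>)\<close> would be \<open>0\<close>.\<close>

definition neg_moment :: "real \<Rightarrow> real \<Rightarrow> (real \<Rightarrow> 'a::real_normed_vector) \<Rightarrow> ennreal" where
  "neg_moment \<eta> T y = (\<integral>\<^sup>+ s\<in>{0..T}. inverse (ennreal (norm (y s) powr \<eta>)) \<partial>lebesgue)"

definition holder_space_neg :: "real \<Rightarrow> real \<Rightarrow> real \<Rightarrow> (real \<Rightarrow> 'a::real_normed_vector) set" where
  "holder_space_neg \<gamma> \<eta> T = {y \<in> holder_space \<gamma> T. neg_moment \<eta> T y < \<infinity>}"

definition power_modulus :: "real \<Rightarrow> ('a::real_normed_vector \<Rightarrow> 'b::real_normed_vector) \<Rightarrow> real" where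
  "power_modulus \<kappa> \<sigma> =
     Sup {norm (\<sigma> \<xi>2 - \<sigma> \<xi>1) / \<bar>norm \<xi>2 powr \<kappa> - norm \<xi>1 powr \<kappa>\<bar> | \<xi>1 \<xi>2. norm \<xi>1 \<noteq> norm \<xi>2}"

definition frac_int_left :: "real \<Rightarrow> real \<Rightarrow> (real \<Rightarrow> real) \<Rightarrow> real \<Rightarrow> real" where
  "frac_int_left \<alpha> a f t =
     1 / Gamma \<alpha> * (LINT r:{a..t}|lebesgue. (t - r) powr (\<alpha> - 1) * f r)"

definition frac_int_right :: "real \<Rightarrow> real \<Rightarrow> (real \<Rightarrow> real) \<Rightarrow> real \<Rightarrow> real" where
  "frac_int_right \<alpha> b f t =
     1 / Gamma \<alpha> * (LINT r:{t..b}|lebesgue. (r - t) powr (\<alpha> - 1) * f r)"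

text \<open>The images of \<open>L\<^sup>1([a, b])\<close>; membership is, as usual, up to equality almost everywhere.\<close>

definition frac_image_left :: "real \<Rightarrow> real \<Rightarrow> real \<Rightarrow> (real \<Rightarrow> real) set" where
  "frac_image_left \<alpha> a b =
     {f. \<exists>\<phi>. set_integrable lebesgue {a..b} \<phi> \<and>
            (AE t in lebesgue. t \<in> {a..b} \<longrightarrow> f t = frac_int_left \<alpha> a \<phi> t)}"

definition frac_image_right :: "real \<Rightarrow> real \<Rightarrow> real \<Rightarrow> (real \<Rightarrow> real) set" where
  "frac_image_right \<alpha> a b =
     {f. \<exists>\<phi>. set_integrable lebesgue {a..b} \<phi> \<and>
            (AE t in lebesgue. t \<in> {a..b} \<longrightarrow> f t = frac_int_right \<alpha> b \<phi> t)}"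

text \<open>The truncated inner integrals of the fractional derivatives. The integral bounds are oriented
  and \<open>f\<close> is extended by \<open>0\<close> outside \<open>[a, b]\<close>; this is relevant for \<open>t - \<epsilon> < a\<close>, resp.
  \<open>t + \<epsilon> > b\<close>.\<close>

definition trunc_left :: "real \<Rightarrow> real \<Rightarrow> real \<Rightarrow> (real \<Rightarrow> real) \<Rightarrow> real \<Rightarrow> real \<Rightarrow> real" where
  "trunc_left \<alpha> a b f \<epsilon> t =
     (LINT r=a..t - \<epsilon>|lebesgue. ((f t - indicator {a..b} r * f r) / (t - r) powr (1 + \<alpha>)))"

definition trunc_right :: "real \<Rightarrow> real \<Rightarrow> real \<Rightarrow> (real \<Rightarrow> real) \<Rightarrow> real \<Rightarrow> real \<Rightarrow> real" where
  "trunc_right \<alpha> a b f \<epsilon> t =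
     (LINT r=t + \<epsilon>..b|lebesgue. ((f t - indicator {a..b} r * f r) / (r - t) powr (1 + \<alpha>)))"

text \<open>\<open>J\<close> is the limit of \<open>F \<epsilon>\<close> in \<open>L\<^sup>1([a, b])\<close> as \<open>\<epsilon>\<close> decreases to \<open>0\<close>. Only the differences
  have to be small in \<open>L\<^sup>1\<close>: the terms \<open>f t / (t - a) powr \<alpha>\<close> and the inner integral of a
  fractional derivative need not be integrable separately.\<close>

definition L1_limit :: "real \<Rightarrow> real \<Rightarrow> (real \<Rightarrow> real \<Rightarrow> real) \<Rightarrow> (real \<Rightarrow> real) \<Rightarrow> bool" where
  "L1_limit a b F J \<longleftrightarrow>
     set_borel_measurable lebesgue {a..b} J \<and>
     ((\<lambda>\<epsilon>. \<integral>\<^sup>+ t\<in>{a..b}. ennreal \<bar>F \<epsilon> t - J t\<bar> \<partial>lebesgue) \<longlongrightarrow> 0) (at_right 0)"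

text \<open>The limit is unique up to null sets, so the following functions are determined
  almost everywhere on \<open>[a, b]\<close>.\<close>

definition frac_deriv_left :: "real \<Rightarrow> real \<Rightarrow> real \<Rightarrow> (real \<Rightarrow> real) \<Rightarrow> real \<Rightarrow> real" where
  "frac_deriv_left \<alpha> a b f t =
     1 / Gamma (1 - \<alpha>) *
       (f t / (t - a) powr \<alpha> + \<alpha> * (SOME J. L1_limit a b (trunc_left \<alpha> a b f) J) t)"

definition frac_deriv_right :: "real \<Rightarrow> real \<Rightarrow> real \<Rightarrow> (real \<Rightarrow> real) \<Rightarrow> real \<Rightarrow> real" where
  "frac_deriv_right \<alpha> a b f t =
     1 / Gamma (1 - \<alpha>) *
       (f t / (b - t) powr \<alpha> + \<alpha> * (SOME J. L1_limit a b (trunc_right \<alpha> a b f) J) t)"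

definition left_centred :: "real \<Rightarrow> (real \<Rightarrow> real) \<Rightarrow> real \<Rightarrow> real" where
  "left_centred b g r = g r - Lim (at_left b) g"

definition frac_integrable_exp ::
    "real \<Rightarrow> real \<Rightarrow> real \<Rightarrow> (real \<Rightarrow> real) \<Rightarrow> (real \<Rightarrow> real) \<Rightarrow> bool" where
  "frac_integrable_exp \<alpha> a b f g \<longleftrightarrow>
     0 < \<alpha> \<and> \<alpha> < 1 \<and>
     f \<in> frac_image_left \<alpha> a b \<and>
     left_centred b g \<in> frac_image_right (1 - \<alpha>) a b \<and>
     set_integrable lebesgue {a..b}
       (\<lambda>r. frac_deriv_left \<alpha> a b f r * frac_deriv_right (1 - \<alpha>) a b (left_centred b g) r)"

text \<open>\<open>f\<close> is integrable with respect to \<open>g\<close> on \<open>[a, b]\<close>, for \<open>a \<le> b\<close>.\<close>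

definition frac_integrable :: "real \<Rightarrow> real \<Rightarrow> (real \<Rightarrow> real) \<Rightarrow> (real \<Rightarrow> real) \<Rightarrow> bool" where
  "frac_integrable a b f g \<longleftrightarrow> a = b \<or> (\<exists>\<alpha>. frac_integrable_exp \<alpha> a b f g)"

text \<open>The notation of the integral does not mention the exponent; some admissible one is used.\<close>

definition frac_integral :: "real \<Rightarrow> real \<Rightarrow> (real \<Rightarrow> real) \<Rightarrow> (real \<Rightarrow> real) \<Rightarrow> real" where
  "frac_integral a b f g =
     (if a = b then 0
      else let \<alpha> = (SOME \<alpha>. frac_integrable_exp \<alpha> a b f g) in
        - (LINT r:{a..b}|lebesgue.
             frac_deriv_left \<alpha> a b f r * frac_deriv_right (1 - \<alpha>) a b (left_centred b g) r))"

definition frac_integrable_vec ::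
    "real \<Rightarrow> real \<Rightarrow> (real \<Rightarrow> real ^ 'm) \<Rightarrow> (real \<Rightarrow> real) \<Rightarrow> bool" where
  "frac_integrable_vec a b f g \<longleftrightarrow> (\<forall>i. frac_integrable a b (\<lambda>r. f r $ i) g)"

definition frac_integral_vec ::
    "real \<Rightarrow> real \<Rightarrow> (real \<Rightarrow> real ^ 'm) \<Rightarrow> (real \<Rightarrow> real) \<Rightarrow> real ^ 'm" where
  "frac_integral_vec a b f g = (\<chi> i. frac_integral a b (\<lambda>r. f r $ i) g)"

definition Lambda_map ::
    "(real ^ 'm \<Rightarrow> real ^ 'm) \<Rightarrow> (real \<Rightarrow> real) \<Rightarrow> (real \<Rightarrow> real ^ 'm) \<Rightarrow> real \<Rightarrow> real ^ 'm" where
  "Lambda_map \<sigma> x y t = frac_integral_vec 0 t (\<lambda>s. \<sigma> (y s)) x"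

definition power_type_coeff :: "real \<Rightarrow> ('a::real_normed_vector \<Rightarrow> 'b::real_normed_vector) \<Rightarrow> bool" where
  "power_type_coeff \<kappa> \<sigma> \<longleftrightarrow>
     \<sigma> 0 = 0 \<and>
     (\<exists>C. \<forall>\<xi>1 \<xi>2. norm (\<sigma> \<xi>2 - \<sigma> \<xi>1) \<le> C * \<bar>norm \<xi>2 powr \<kappa> - norm \<xi>1 powr \<kappa>\<bar>)"

end

theory Submission
  imports Defs
begin

text \<open>Let \<open>f\<close> be a component of the path \<open>s \<mapsto> \<sigma> (y s)\<close>, let \<open>Y\<close> be the Hoelder seminorm of \<open>y\<close>, \<open>N\<close> the
  power modulus of \<open>\<sigma>\<close>, and \<open>p = \<gamma> * (\<kappa> + \<eta>)\<close>. Since \<open>\<bar>u powr \<kappa> - v powr \<kappa>\<bar> \<le> \<bar>u - v\<bar> powr (\<kappa> + \<eta>) *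
  u powr (- \<eta>)\<close> for \<open>u > 0\<close> and \<open>v \<ge> 0\<close> (\<open>powr_diff_le\<close>), the increment \<open>\<bar>f t - f r\<bar>\<close> is at most
  \<open>N * Y powr (\<kappa> + \<eta>) * \<bar>t - r\<bar> powr p * norm (y t) powr (- \<eta>)\<close>: up to an integrable factor in \<open>t\<close>,
  the path \<open>f\<close> is Hoelder of order \<open>p\<close>. The lower bound on \<open>\<eta>\<close> says precisely that \<open>p > 1 - \<gamma>\<close>, which
  leaves room for an exponent \<open>\<beta>\<close> with \<open>1 - \<gamma> < \<beta> < p\<close>. Then the energy
  \<open>\<integral>\<integral> \<bar>f t - f (t - h)\<bar> * h powr (- 1 - \<beta>) dh dt\<close> is finite, so that \<open>f\<close> is the fractional integral of
  order \<open>\<beta>\<close> of an integrable function (\<open>rl_int_marchaud\<close>), whereas \<open>x\<close>, being Hoelder of order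
  \<open>\<gamma> > 1 - \<beta>\<close>, is up to a constant the right-sided fractional integral of order \<open>1 - \<beta>\<close> of a bounded
  function (\<open>holder_rl_int_right\<close>). The product of the two densities is integrable; this is the first
  claim.

  On an interval of length \<open>L\<close> the first density has an \<open>L\<^sup>1\<close> norm of order \<open>L powr (1 - \<beta>)\<close> times the
  bracket in the second claim, because \<open>norm (y t) powr (- \<eta>)\<close> has an integral of order
  \<open>L powr (1 - p)\<close> (\<open>nn_integral_powr_le\<close>), and the second density is of order
  \<open>L powr (\<gamma> - (1 - \<beta>))\<close> times the seminorm of \<open>x\<close>. The powers of \<open>L\<close> multiply to \<open>L powr \<gamma>\<close>.

  To turn this into a Hoelder estimate one needs that the integral is additive over adjacent
  intervals and that it is the same for all admissible exponents; the definition picks an arbitrary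
  one on each interval. Both follow from a formula that does not mention the exponent: on \<open>[a, b]\<close> the
  integral is the limit of \<open>\<integral> f r * (x (min (r + \<epsilon>) b) - x r) / \<epsilon> dr\<close> as \<open>\<epsilon>\<close> decreases to \<open>0\<close>. If the
  second density is bounded, this is the theorem of Fubini together with the fact that the kernels
  of orders \<open>\<alpha>\<close> and \<open>1 - \<alpha>\<close> convolve to the Heaviside function (\<open>rl_int_difference_quotient\<close>). It is
  bounded for \<open>\<alpha> > 1 - \<gamma>\<close>. An exponent \<open>\<alpha> \<le> 1 - \<gamma>\<close> may be admissible as well; then the second density
  is merely integrable, and only the product of the two densities is known to be integrable. Such an
  exponent is compared with \<open>\<beta>\<close> by moving \<open>\<beta> - \<alpha>\<close> derivatives from one factor to the other. This
  integration by parts is not absolutely convergent. As in an argument of Brezis and Browder it is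
  carried out for truncations of the first density, which are bounded and whose energy is controlled
  because truncation is a contraction (\<open>integration_by_parts_integrable_product\<close>).

  The fractional derivatives of the definition are limits in \<open>L\<^sup>1\<close>. A function on \<open>[a, b]\<close> is extended
  by \<open>0\<close> to the line; the boundary term \<open>f t / (t - a) powr \<alpha>\<close> then becomes the part \<open>h > t - a\<close> of the
  Marchaud integral over all \<open>h > 0\<close>. The truncated Marchaud derivative of the fractional integral of an
  integrable \<open>\<phi>\<close> is the convolution of \<open>\<phi>\<close> with an approximate identity and hence tends to \<open>\<phi>\<close>
  (\<open>marchaud_trunc_rl_int_tendsto\<close>). Right-sided operators are reflections of left-sided ones.\<close>

section \<open>Integrals over the line\<close>

lemma dominated_convergence_within:
  fixes s :: "real \<Rightarrow> 'a \<Rightarrow> real"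
  assumes "f \<in> borel_measurable M" "\<And>h. h \<in> S \<Longrightarrow> s h \<in> borel_measurable M" "integrable M w"
    and lim: "AE x in M. ((\<lambda>h. s h x) \<longlongrightarrow> f x) (at p within S)"
    and bound: "\<And>h. h \<in> S \<Longrightarrow> AE x in M. \<bar>s h x\<bar> \<le> w x"
  shows "((\<lambda>h. integral\<^sup>L M (s h)) \<longlongrightarrow> integral\<^sup>L M f) (at p within S)"
  unfolding tendsto_at_iff_sequentially o_def
proof safe
  fix X :: "nat \<Rightarrow> real" assume X: "\<forall>i. X i \<in> S - {p}" "X \<longlonglongrightarrow> p"
  show "(\<lambda>n. integral\<^sup>L M (s (X n))) \<longlonglongrightarrow> integral\<^sup>L M f"
  proof (rule integral_dominated_convergence[where w=w])
    show "AE x in M. (\<lambda>i. s (X i) x) \<longlonglongrightarrow> f x"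
      using lim by eventually_elim (use X in \<open>auto simp: tendsto_at_iff_sequentially o_def\<close>)
  qed (use assms X in auto)
qed

lemma integral_mult_bounded:
  fixes f g :: "'a \<Rightarrow> real"
  assumes f: "integrable M f" and g: "g \<in> borel_measurable M" and B: "AE t in M. \<bar>g t\<bar> \<le> B"
  shows "integrable M (\<lambda>t. f t * g t)"
    and "\<bar>LINT t|M. f t * g t\<bar> \<le> B * (LINT t|M. \<bar>f t\<bar>)"
proof -
  have le: "AE t in M. \<bar>f t * g t\<bar> \<le> B * \<bar>f t\<bar>"
    using B by eventually_elim (auto simp: abs_mult mult.commute[of B] intro!: mult_left_mono)
  have Bf: "integrable M (\<lambda>t. B * \<bar>f t\<bar>)" using f by simp
  show i: "integrable M (\<lambda>t. f t * g t)"
  proof (rule Bochner_Integration.integrable_bound[OF Bf])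
    show "(\<lambda>t. f t * g t) \<in> borel_measurable M" using borel_measurable_integrable[OF f] g by simp
    show "AE t in M. norm (f t * g t) \<le> norm (B * \<bar>f t\<bar>)" using le by eventually_elim (auto intro: order_trans[OF _ abs_ge_self])
  qed
  have "\<bar>LINT t|M. f t * g t\<bar> \<le> (LINT t|M. \<bar>f t * g t\<bar>)" by (rule integral_abs_bound)
  also have "\<dots> \<le> (LINT t|M. B * \<bar>f t\<bar>)" by (rule integral_mono_AE[OF integrable_abs[OF i] Bf le])
  finally show "\<bar>LINT t|M. f t * g t\<bar> \<le> B * (LINT t|M. \<bar>f t\<bar>)" by simp
qed

lemma nn_integral_translate:
  fixes f :: "real \<Rightarrow> ennreal" assumes "f \<in> borel_measurable borel"
  shows "(\<integral>\<^sup>+x. f (x - h) \<partial>lborel) = (\<integral>\<^sup>+x. f x \<partial>lborel)"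
  using nn_integral_real_affine[OF assms, of 1 "-h"] by simp

lemma nn_integral_reflect:
  fixes f :: "real \<Rightarrow> ennreal" assumes "f \<in> borel_measurable borel"
  shows "(\<integral>\<^sup>+x. f (h - x) \<partial>lborel) = (\<integral>\<^sup>+x. f x \<partial>lborel)"
  using nn_integral_real_affine[OF assms, of "-1" "h"] by simp

lemma integrable_translate:
  fixes f :: "real \<Rightarrow> real"
  shows "integrable lborel (\<lambda>x. f (x - h)) \<longleftrightarrow> integrable lborel f"
  using lborel_integrable_real_affine_iff[of 1 f "-h"] by simp

lemma integral_translate:
  fixes f :: "real \<Rightarrow> real"
  shows "(LINT x|lborel. f (x - h)) = (LINT x|lborel. f x)"
  using lborel_integral_real_affine[of 1 f "-h"] by simp

lemma integrable_reflect_at: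
  fixes f :: "real \<Rightarrow> real"
  shows "integrable lborel (\<lambda>x. f (h - x)) \<longleftrightarrow> integrable lborel f"
  using lborel_integrable_real_affine_iff[of "-1" f "h"] by simp

lemma integral_reflect_at:
  fixes f :: "real \<Rightarrow> real"
  shows "(LINT x|lborel. f (h - x)) = (LINT x|lborel. f x)"
  using lborel_integral_real_affine[of "-1" f "h"] by simp

definition translation_modulus :: "(real \<Rightarrow> real) \<Rightarrow> real \<Rightarrow> real" where
  "translation_modulus f h = (LINT t|lborel. \<bar>f (t - h) - f t\<bar>)"

lemma integrable_translation_diff:
  fixes f :: "real \<Rightarrow> real"
  assumes "integrable lborel f"
  shows "integrable lborel (\<lambda>t. \<bar>f (t - h) - f t\<bar>)"
  using assms integrable_translate[of f h] by auto

lemma translation_modulus_nonneg: "0 \<le> translation_modulus f h"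
  unfolding translation_modulus_def by simp

lemma translation_modulus_le:
  assumes "integrable lborel f"
  shows "translation_modulus f h \<le> 2 * (LINT t|lborel. \<bar>f t\<bar>)"
proof -
  have "translation_modulus f h \<le> (LINT t|lborel. \<bar>f (t - h)\<bar> + \<bar>f t\<bar>)"
    unfolding translation_modulus_def
    using assms integrable_translate[of f h] by (intro integral_mono) auto
  also have "\<dots> = 2 * (LINT t|lborel. \<bar>f t\<bar>)"
    using assms integrable_translate[of f h] integral_translate[of "\<lambda>t. \<bar>f t\<bar>" h] by simp
  finally show ?thesis .
qed

lemma translation_modulus_triangle:
  assumes "integrable lborel f" "integrable lborel g"
  shows "translation_modulus f h
    \<le> translation_modulus g h + 2 * (LINT t|lborel. \<bar>f t - g t\<bar>)"
proof -
  have i: "integrable lborel (\<lambda>t. f t - g t)" using assms by auto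
  have "translation_modulus f h
    \<le> (LINT t|lborel. \<bar>g (t - h) - g t\<bar> + \<bar>(f (t - h) - g (t - h)) - (f t - g t)\<bar>)"
    unfolding translation_modulus_def
    using assms integrable_translation_diff[OF i] integrable_translation_diff
    by (intro integral_mono) auto
  also have "\<dots> = translation_modulus g h + translation_modulus (\<lambda>t. f t - g t) h"
    unfolding translation_modulus_def
    using integrable_translation_diff[OF i] integrable_translation_diff[OF assms(2)]
    by (subst Bochner_Integration.integral_add) auto
  finally show ?thesis using translation_modulus_le[OF i, of h] by linarith
qed

text \<open>A set of finite measure lies between a compact \<open>K\<close> and an open \<open>U\<close> that differ by little.
  A shift by less than the distance of \<open>K\<close> from the complement of \<open>U\<close> changes the indicator
  only at points that are in \<open>U - K\<close> before or after the shift.\<close>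

lemma translation_modulus_indicator_tendsto:
  fixes A :: "real set"
  assumes A: "A \<in> sets borel" "emeasure lborel A < \<infinity>"
  shows "(translation_modulus (indicator A) \<longlongrightarrow> 0) (at 0)"
proof (rule tendstoI)
  fix e :: real assume e: "0 < e"
  obtain U where U: "open U" "A \<subseteq> U" "emeasure lborel (U - A) < ennreal (e/4)"
    using outer_regular_lborel[OF A(1), of "e/4"] e by auto
  let ?M = "density lborel (indicator A)"
  have M: "emeasure ?M B = emeasure lborel (A \<inter> B)" if "B \<in> sets borel" for B
    using that A by (simp add: emeasure_density flip: indicator_inter_arith)
  have fin: "emeasure ?M (space ?M) \<noteq> \<infinity>" using A by (simp add: M)
  have "emeasure ?M A = (SUP K \<in> {K. K \<subseteq> A \<and> compact K}. emeasure ?M K)"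
    by (rule inner_regular[OF _ fin A(1)]) simp
  then have sup: "emeasure lborel A = (SUP K \<in> {K. K \<subseteq> A \<and> compact K}. emeasure ?M K)"
    using M[OF A(1)] by simp
  obtain K where K: "K \<subseteq> A" "compact K" "measure lborel A < measure lborel K + e/4"
  proof -
    have "\<exists>K\<in>{K. K \<subseteq> A \<and> compact K}. measure lborel A < measure lborel K + e/4"
    proof (cases "measure lborel A = 0")
      case True then show ?thesis using e by (auto intro!: bexI[of _ "{}"])
    next
      case False
      have "ennreal (measure lborel A - e/4) < emeasure lborel A"
        using False e A(2) by (subst emeasure_eq_ennreal_measure)
          (auto intro!: ennreal_lessI simp: zero_less_measure_iff)
      then obtain K where K: "K \<subseteq> A" "compact K" "ennreal (measure lborel A - e/4) < emeasure ?M K"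
        unfolding sup less_SUP_iff by auto
      have "emeasure ?M K = emeasure lborel K"
        using M[of K] K by (simp add: Int_absorb1 borel_compact)
      also have "\<dots> = ennreal (measure lborel K)"
        using K A(2) emeasure_mono[OF K(1), of lborel] A(1)
        by (intro emeasure_eq_ennreal_measure) (auto simp: top_unique)
      finally have "measure lborel A - e/4 < measure lborel K"
        using K(3) by (metis ennreal_leI linorder_not_less)
      then show ?thesis using K by (intro bexI[of _ K]) auto
    qed
    then show ?thesis using that by auto
  qed
  have Kb: "K \<in> sets borel" "U \<in> sets borel" using K U by (auto simp: borel_compact)
  have finK: "emeasure lborel K \<noteq> \<infinity>" using K A emeasure_mono[OF K(1), of lborel]
    by (auto simp: top_unique)
  have AK: "emeasure lborel (A - K) < ennreal (e/4)"
  proof -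
    have "measure lborel (A - K) = measure lborel A - measure lborel K"
      using K Kb A finK by (intro measure_Diff) auto
    moreover have "emeasure lborel (A - K) \<noteq> \<infinity>"
      using A Kb emeasure_mono[of "A - K" A lborel] by (auto simp: top_unique)
    ultimately show ?thesis using K(3) e
      by (subst emeasure_eq_ennreal_measure) (auto intro!: ennreal_lessI)
  qed
  define N where "N = U - K"
  have N: "N \<in> sets borel" "emeasure lborel N < ennreal (e/2)"
  proof -
    have "emeasure lborel N \<le> emeasure lborel (U - A) + emeasure lborel (A - K)"
      unfolding N_def using U Kb A by (intro order_trans[OF emeasure_mono emeasure_subadditive]) auto
    also have "\<dots> < ennreal (e/4) + ennreal (e/4)" using U(3) AK by (rule add_strict_mono)
    also have "\<dots> = ennreal (e/2)" using e by (simp flip: ennreal_plus)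
    finally show "emeasure lborel N < ennreal (e/2)" .
  qed (use Kb N_def in auto)
  then have iN: "integrable lborel (indicator N :: real \<Rightarrow> real)"
    by (auto simp: less_top intro!: integrable_real_indicator intro: order.strict_trans)
  have mN: "measure lborel N < e/2"
    using N e by (metis enn2real_less_iff measure_def ennreal_less_top order.strict_trans
       half_gt_zero less_eq_real_def)
  obtain d where d: "d > 0" "\<And>x y. x \<in> K \<Longrightarrow> y \<in> -U \<Longrightarrow> d \<le> dist x y"
  proof -
    have "K \<inter> - U = {}" using K U by blast
    then show ?thesis using separate_compact_closed[of K "-U"] K U that by (auto simp: closed_Compl)
  qed
  have iA: "integrable lborel (indicator A :: real \<Rightarrow> real)"
    using A by (intro integrable_real_indicator) auto
  have "translation_modulus (indicator A) h < e" if h: "\<bar>h\<bar> < d" for h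
  proof -
    have "translation_modulus (indicator A) h \<le> (LINT t|lborel. indicator N t + indicator N (t - h))"
      unfolding translation_modulus_def
    proof (intro integral_mono)
      fix t
      have in_U: "t - h \<in> U" if "t \<in> K" using d(2)[of t "t-h"] that h by (force simp: dist_real_def)
      have in_U': "t \<in> U" if "t - h \<in> K" using d(2)[of "t-h" t] that h by (force simp: dist_real_def)
      show "\<bar>indicator A (t - h) - indicator A t\<bar> \<le> indicator N t + (indicator N (t - h) :: real)"
        using in_U in_U' U(2) K(1) by (auto simp: N_def split: split_indicator)
    qed (use iN integrable_translate[of "indicator N" h] integrable_translation_diff[OF iA] in auto)
    also have "\<dots> = 2 * measure lborel N"
      using iN integrable_translate[of "indicator N" h] integral_translate[of "indicator N" h] by simp
    finally show ?thesis using mN by simp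
  qed
  then show "\<forall>\<^sub>F h in at 0. dist (translation_modulus (indicator A) h) 0 < e"
    unfolding eventually_at using d(1) translation_modulus_nonneg
    by (intro exI[of _ d]) (auto simp: dist_real_def)
qed

lemma translation_modulus_tendsto:
  assumes "integrable lborel f"
  shows "(translation_modulus f \<longlongrightarrow> 0) (at 0)"
  using assms
proof (induction rule: integrable_induct)
  case (base A c)
  have "translation_modulus (\<lambda>x. indicator A x *\<^sub>R c) h = \<bar>c\<bar> * translation_modulus (indicator A) h" for h
  proof -
    have "\<bar>indicator A (t - h) *\<^sub>R c - indicator A t *\<^sub>R c\<bar> = \<bar>c\<bar> * \<bar>indicator A (t - h) - indicator A t\<bar>" for t
      by (auto split: split_indicator)
    then show ?thesis unfolding translation_modulus_def by simp
  qed
  then show ?case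
    using tendsto_mult_left[OF translation_modulus_indicator_tendsto[of A], of "\<bar>c\<bar>"] base by simp
next
  case (add f g)
  have le: "translation_modulus (\<lambda>x. f x + g x) h \<le> translation_modulus f h + translation_modulus g h" for h
  proof -
    have "translation_modulus (\<lambda>x. f x + g x) h
       \<le> (LINT t|lborel. \<bar>f (t - h) - f t\<bar> + \<bar>g (t - h) - g t\<bar>)"
      unfolding translation_modulus_def
      using integrable_translation_diff[of "\<lambda>x. f x + g x" h] add integrable_translation_diff
      by (intro integral_mono) auto
    also have "\<dots> = translation_modulus f h + translation_modulus g h"
      unfolding translation_modulus_def using add integrable_translation_diff
      by (subst Bochner_Integration.integral_add) auto
    finally show ?thesis .
  qed
  have "((\<lambda>h. translation_modulus f h + translation_modulus g h) \<longlongrightarrow> 0) (at 0)"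
    using tendsto_add[OF add(3) add(4)] by simp
  then show ?case
    using le by (intro Lim_null_comparison[where f="translation_modulus (\<lambda>x. f x + g x)"] always_eventually)
       (auto simp: translation_modulus_nonneg)
next
  case (lim f s)
  have "(\<lambda>i. LINT t|lborel. \<bar>f t - s i t\<bar>) \<longlonglongrightarrow> (LINT t::real|lborel. (0::real))"
  proof (rule integral_dominated_convergence[where w="\<lambda>t. 3 * \<bar>f t\<bar>"])
    show "AE t in lborel. (\<lambda>i. \<bar>f t - s i t\<bar>) \<longlonglongrightarrow> 0"
    proof (rule AE_I2)
      fix t
      have "(\<lambda>i. s i t) \<longlonglongrightarrow> f t" using lim(2)[of t] by simp
      then show "(\<lambda>i. \<bar>f t - s i t\<bar>) \<longlonglongrightarrow> 0"
        using tendsto_rabs[OF tendsto_diff[OF tendsto_const, of "\<lambda>i. s i t" "f t" _ "f t"]] by simp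
    qed
    show "AE t in lborel. norm \<bar>f t - s i t\<bar> \<le> 3 * \<bar>f t\<bar>" for i
    proof (rule AE_I2)
      fix t show "norm \<bar>f t - s i t\<bar> \<le> 3 * \<bar>f t\<bar>" using lim(3)[of t i] by simp
    qed
  qed (use lim in auto)
  then have lim0: "(\<lambda>i. LINT t|lborel. \<bar>f t - s i t\<bar>) \<longlonglongrightarrow> 0" by simp
  show ?case
  proof (rule tendstoI)
    fix e :: real assume e: "0 < e"
    from order_tendstoD(2)[OF lim0, of "e/4"] e obtain i where i: "(LINT t|lborel. \<bar>f t - s i t\<bar>) < e/4"
      by (auto simp: eventually_sequentially)
    have "\<forall>\<^sub>F h in at 0. translation_modulus (s i) h < e/2"
      using order_tendstoD(2)[OF lim(5)[of i], of "e/2"] e by simp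
    then show "\<forall>\<^sub>F h in at 0. dist (translation_modulus f h) 0 < e"
    proof eventually_elim
      case (elim h)
      with translation_modulus_triangle[OF lim(4) lim(1)[of i], of h] i translation_modulus_nonneg[of f h]
      show ?case by (simp add: dist_real_def)
    qed
  qed
qed

text \<open>By Minkowski's inequality the distance is at most the integral of \<open>\<bar>K s\<bar>\<close> times the
  translation modulus at \<open>\<epsilon> * s\<close>, which is dominated by a multiple of \<open>\<bar>K\<bar>\<close> and tends to \<open>0\<close>
  pointwise.\<close>

lemma approximate_identity:
  fixes K f :: "real \<Rightarrow> real"
  assumes K: "integrable lborel K" and f: "integrable lborel f"
  shows "((\<lambda>\<epsilon>. \<integral>\<^sup>+t. ennreal \<bar>(LINT s|lborel. K s * f (t - \<epsilon> * s)) - (LINT s|lborel. K s) * f t\<bar> \<partial>lborel)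
    \<longlongrightarrow> 0) (at_right 0)"
proof -
  have [measurable]: "K \<in> borel_measurable borel" "f \<in> borel_measurable borel"
    using K f by (auto dest: borel_measurable_integrable)
  define B where "B = 2 * (LINT t|lborel. \<bar>f t\<bar>)"
  have "0 \<le> B" by (simp add: B_def)
  have [measurable]: "translation_modulus f \<in> borel_measurable borel"
    unfolding translation_modulus_def by measurable
  have int: "integrable lborel (\<lambda>s. \<bar>K s\<bar> * translation_modulus f (\<epsilon> * s))" for \<epsilon>
  proof (rule Bochner_Integration.integrable_bound[where f="\<lambda>s. \<bar>K s\<bar> * B"])
    have "\<bar>K s\<bar> * translation_modulus f (\<epsilon> * s) \<le> \<bar>K s\<bar> * B" for s
      unfolding B_def by (intro mult_left_mono translation_modulus_le f) auto
    then show "AE s in lborel. norm (\<bar>K s\<bar> * translation_modulus f (\<epsilon> * s)) \<le> norm (\<bar>K s\<bar> * B)"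
      by (auto simp: abs_mult translation_modulus_nonneg \<open>0 \<le> B\<close>)
  qed (use K in auto)
  have "((\<lambda>\<epsilon>. LINT s|lborel. \<bar>K s\<bar> * translation_modulus f (\<epsilon> * s)) \<longlongrightarrow> (LINT s::real|lborel. 0::real)) (at_right 0)"
  proof (rule dominated_convergence_within[where w="\<lambda>s. \<bar>K s\<bar> * B"])
    show "AE s in lborel. ((\<lambda>\<epsilon>. \<bar>K s\<bar> * translation_modulus f (\<epsilon> * s)) \<longlongrightarrow> 0) (at_right 0)"
    proof (rule AE_I2)
      fix s :: real
      have "((\<lambda>\<epsilon>. translation_modulus f (\<epsilon> * s)) \<longlongrightarrow> 0) (at_right 0)"
      proof (cases "s = 0")
        case True then show ?thesis by (simp add: translation_modulus_def)
      next
        case False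
        have "filterlim (\<lambda>\<epsilon>. \<epsilon> * s) (at 0) (at_right 0)"
          using False unfolding filterlim_at
          by (auto intro!: tendsto_eq_intros simp: eventually_at_filter)
        then show ?thesis using translation_modulus_tendsto[OF f] by (rule filterlim_compose[rotated])
      qed
      then show "((\<lambda>\<epsilon>. \<bar>K s\<bar> * translation_modulus f (\<epsilon> * s)) \<longlongrightarrow> 0) (at_right 0)"
        using tendsto_mult_right_zero by blast
    qed
    show "AE s in lborel. \<bar>\<bar>K s\<bar> * translation_modulus f (h * s)\<bar> \<le> \<bar>K s\<bar> * B" for h
      by (auto simp: abs_mult B_def translation_modulus_nonneg
          intro!: mult_left_mono translation_modulus_le[OF f])
  qed (use K in auto)
  then have lim: "((\<lambda>\<epsilon>. ennreal (LINT s|lborel. \<bar>K s\<bar> * translation_modulus f (\<epsilon> * s))) \<longlongrightarrow> 0) (at_right 0)"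
    using tendsto_ennrealI by fastforce
  have le: "(\<integral>\<^sup>+t. ennreal \<bar>(LINT s|lborel. K s * f (t - \<epsilon> * s)) - (LINT s|lborel. K s) * f t\<bar> \<partial>lborel)
     \<le> ennreal (LINT s|lborel. \<bar>K s\<bar> * translation_modulus f (\<epsilon> * s))" for \<epsilon>
  proof -
    have swap: "(\<integral>\<^sup>+t. \<integral>\<^sup>+s. ennreal (\<bar>K s\<bar> * g t s) \<partial>lborel \<partial>lborel)
        = (\<integral>\<^sup>+s. ennreal \<bar>K s\<bar> * (\<integral>\<^sup>+t. ennreal (g t s) \<partial>lborel) \<partial>lborel)"
      if [measurable]: "case_prod g \<in> borel_measurable (borel \<Otimes>\<^sub>M borel)" and "\<And>t s. g t s \<ge> 0"
      for g :: "real \<Rightarrow> real \<Rightarrow> real"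
      using that(2) by (subst lborel_pair.Fubini') (auto simp: ennreal_mult' nn_integral_cmult)
    have "(\<integral>\<^sup>+t. \<integral>\<^sup>+s. ennreal (\<bar>K s\<bar> * \<bar>f (t - \<epsilon> * s)\<bar>) \<partial>lborel \<partial>lborel)
      = (\<integral>\<^sup>+s. ennreal \<bar>K s\<bar> * (\<integral>\<^sup>+t. ennreal \<bar>f t\<bar> \<partial>lborel) \<partial>lborel)"
      by (subst swap) (auto simp: nn_integral_translate[of "\<lambda>t. ennreal \<bar>f t\<bar>"])
    also have "\<dots> < \<infinity>"
      using K f by (simp add: nn_integral_multc integrable_iff_bounded ennreal_mult_less_top)
    finally have "AE t in lborel. (\<integral>\<^sup>+s. ennreal (\<bar>K s\<bar> * \<bar>f (t - \<epsilon> * s)\<bar>) \<partial>lborel) \<noteq> \<infinity>"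
      by (intro nn_integral_PInf_AE) auto
    then have ae: "AE t in lborel. integrable lborel (\<lambda>s. K s * f (t - \<epsilon> * s))"
      by eventually_elim (auto simp: integrable_iff_bounded abs_mult less_top)
    have "(\<integral>\<^sup>+t. ennreal \<bar>(LINT s|lborel. K s * f (t - \<epsilon> * s)) - (LINT s|lborel. K s) * f t\<bar> \<partial>lborel)
      \<le> (\<integral>\<^sup>+t. \<integral>\<^sup>+s. ennreal (\<bar>K s\<bar> * \<bar>f (t - \<epsilon> * s) - f t\<bar>) \<partial>lborel \<partial>lborel)"
      using ae
    proof (intro nn_integral_mono_AE, eventually_elim)
      case (elim t)
      have "(LINT s|lborel. K s * f (t - \<epsilon> * s)) - (LINT s|lborel. K s) * f t
        = (LINT s|lborel. K s * (f (t - \<epsilon> * s) - f t))"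
        using elim K by (simp add: right_diff_distrib)
      moreover have "integrable lborel (\<lambda>s. K s * (f (t - \<epsilon> * s) - f t))"
        using elim K by (simp add: right_diff_distrib)
      ultimately show ?case
        using integral_norm_bound_ennreal[of lborel "\<lambda>s. K s * (f (t - \<epsilon> * s) - f t)"]
        by (simp add: abs_mult)
    qed
    also have "\<dots> = (\<integral>\<^sup>+s. ennreal \<bar>K s\<bar> * (\<integral>\<^sup>+t. ennreal \<bar>f (t - \<epsilon> * s) - f t\<bar> \<partial>lborel) \<partial>lborel)"
      by (subst swap) auto
    also have "\<dots> = (\<integral>\<^sup>+s. ennreal (\<bar>K s\<bar> * translation_modulus f (\<epsilon> * s)) \<partial>lborel)"
      unfolding translation_modulus_def
      by (subst nn_integral_eq_integral[OF integrable_translation_diff[OF f]])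
         (auto simp: ennreal_mult')
    also have "\<dots> = ennreal (LINT s|lborel. \<bar>K s\<bar> * translation_modulus f (\<epsilon> * s))"
      by (intro nn_integral_eq_integral int) (auto simp: translation_modulus_nonneg)
    finally show ?thesis .
  qed
  show ?thesis
    by (rule tendsto_sandwich[OF _ _ tendsto_const lim]) (auto simp: le)
qed

text \<open>All identities between fractional integrals and derivatives below are instances of this
  associativity. Only the convolution \<open>C\<close> of the two nonnegative kernels has to be computed,
  and only the integrability of its product with \<open>f\<close> has to be checked.\<close>

lemma convolution_assoc:
  fixes A B C f :: "real \<Rightarrow> real"
  assumes [measurable]: "A \<in> borel_measurable borel" "B \<in> borel_measurable borel"
      "C \<in> borel_measurable borel" "f \<in> borel_measurable borel"
    and pos: "\<And>x. 0 \<le> A x" "\<And>x. 0 \<le> B x" "\<And>x. 0 \<le> C x"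
    and C: "\<And>x. (\<integral>\<^sup>+p. ennreal (A (x - p) * B p) \<partial>lborel) = ennreal (C x)"
    and int: "integrable lborel (\<lambda>r. C (t - r) * f r)"
  shows "(LINT p|lborel. A (t - p) * (LINT r|lborel. B (p - r) * f r)) = (LINT r|lborel. C (t - r) * f r)"
    and "integrable lborel (\<lambda>p. A (t - p) * (LINT r|lborel. B (p - r) * f r))"
proof -
  define F where "F r p = A (t - p) * (B (p - r) * f r)" for r p
  have Fm[measurable]: "case_prod F \<in> borel_measurable (borel \<Otimes>\<^sub>M borel)" unfolding F_def by measurable
  have nn: "(\<integral>\<^sup>+p. ennreal (A (t - p) * B (p - r)) \<partial>lborel) = ennreal (C (t - r))" for r
    using nn_integral_translate[of "\<lambda>p. ennreal (A (t - r - p) * B p)" r] C[of "t - r"]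
    by (simp add: algebra_simps)
  have "(\<integral>\<^sup>+z. ennreal (norm (case_prod F z)) \<partial>(lborel \<Otimes>\<^sub>M lborel))
    = (\<integral>\<^sup>+r. \<integral>\<^sup>+p. ennreal (A (t - p) * B (p - r)) * ennreal \<bar>f r\<bar> \<partial>lborel \<partial>lborel)"
    by (subst lborel.nn_integral_fst[symmetric]) (auto simp: F_def abs_mult pos ennreal_mult' mult.assoc)
  also have "\<dots> = (\<integral>\<^sup>+r. ennreal (C (t - r)) * ennreal \<bar>f r\<bar> \<partial>lborel)"
    by (simp add: nn_integral_multc nn)
  also have "\<dots> = (\<integral>\<^sup>+r. ennreal (norm (C (t - r) * f r)) \<partial>lborel)"
    by (simp add: abs_mult pos ennreal_mult')
  also have "\<dots> < \<infinity>" using int by (simp add: integrable_iff_bounded)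
  finally have Fi: "integrable (lborel \<Otimes>\<^sub>M lborel) (case_prod F)"
    by (auto simp: integrable_iff_bounded)
  have "(LINT p|lborel. A (t - p) * (LINT r|lborel. B (p - r) * f r)) = (LINT p|lborel. LINT r|lborel. F r p)"
    by (simp add: F_def)
  also have "\<dots> = (LINT r|lborel. LINT p|lborel. F r p)"
    by (rule lborel_pair.Fubini_integral[OF Fi])
  also have "\<dots> = (LINT r|lborel. C (t - r) * f r)"
  proof (intro Bochner_Integration.integral_cong refl)
    fix r
    have "(LINT p|lborel. A (t - p) * B (p - r)) = C (t - r)"
      by (subst integral_eq_nn_integral) (auto simp: pos nn)
    then show "(LINT p|lborel. F r p) = C (t - r) * f r"
      unfolding F_def by (simp flip: mult.assoc)
  qed
  finally show "(LINT p|lborel. A (t - p) * (LINT r|lborel. B (p - r) * f r)) = (LINT r|lborel. C (t - r) * f r)" .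
  show "integrable lborel (\<lambda>p. A (t - p) * (LINT r|lborel. B (p - r) * f r))"
    using lborel_pair.integrable_snd[OF Fi] by (simp add: F_def)
qed

section \<open>Riemann-Liouville kernels\<close>

definition rl_kernel :: "real \<Rightarrow> real \<Rightarrow> real" where
  "rl_kernel \<alpha> h = (if 0 < h then h powr (\<alpha> - 1) / Gamma \<alpha> else 0)"

definition rl_int :: "real \<Rightarrow> (real \<Rightarrow> real) \<Rightarrow> real \<Rightarrow> real" where
  "rl_int \<alpha> u t = (LINT r|lborel. rl_kernel \<alpha> (t - r) * u r)"

lemma rl_kernel_measurable [measurable]: "rl_kernel \<alpha> \<in> borel_measurable borel"
  unfolding rl_kernel_def by measurable

lemma rl_kernel_nonneg: "0 < \<alpha> \<Longrightarrow> 0 \<le> rl_kernel \<alpha> h"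
  unfolding rl_kernel_def by (auto intro!: divide_nonneg_pos Gamma_real_pos)

lemma rl_int_measurable [measurable]:
  assumes [measurable]: "u \<in> borel_measurable borel"
  shows "rl_int \<alpha> u \<in> borel_measurable borel"
  unfolding rl_int_def by measurable

lemma nn_convolution_commute:
  fixes A B :: "real \<Rightarrow> real"
  assumes [measurable]: "A \<in> borel_measurable borel" "B \<in> borel_measurable borel"
  shows "(\<integral>\<^sup>+p. ennreal (A (x - p) * B p) \<partial>lborel) = (\<integral>\<^sup>+p. ennreal (B (x - p) * A p) \<partial>lborel)"
  using nn_integral_reflect[of "\<lambda>p. ennreal (A (x - p) * B p)" x] by (simp add: mult.commute)

text \<open>The semigroup property; the substitution \<open>p = x * q\<close> leaves the Beta integral.\<close>

lemma rl_kernel_convolution: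
  assumes "0 < \<alpha>" "0 < \<beta>"
  shows "(\<integral>\<^sup>+p. ennreal (rl_kernel \<alpha> (x - p) * rl_kernel \<beta> p) \<partial>lborel) = ennreal (rl_kernel (\<alpha> + \<beta>) x)"
proof (cases "0 < x")
  case False
  then have "ennreal (rl_kernel \<alpha> (x - p) * rl_kernel \<beta> p) = 0" for p
    by (auto simp: rl_kernel_def)
  then show ?thesis using False
    by (simp add: rl_kernel_def[of _ x] del: ennreal_eq_zero_iff mult_eq_0_iff)
next
  case True
  define c where "c = x powr (\<alpha> + \<beta> - 2) / (Gamma \<alpha> * Gamma \<beta>)"
  have c: "0 \<le> c" using assms by (auto simp: c_def intro!: divide_nonneg_pos Gamma_real_pos mult_pos_pos)
  have eq: "rl_kernel \<alpha> (x - x * q) * rl_kernel \<beta> (x * q)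
      = c * (indicator {0..1} q * (q powr (\<beta> - 1) * (1 - q) powr (\<alpha> - 1)))" for q
  proof (cases "0 < q \<and> q < 1")
    case q: True
    have "x - x * q = x * (1 - q)" by (simp add: algebra_simps)
    moreover have "0 < x * (1 - q)" using True q by auto
    ultimately have "rl_kernel \<alpha> (x - x * q) * rl_kernel \<beta> (x * q)
      = (x powr (\<alpha> - 1) * x powr (\<beta> - 1)) * (q powr (\<beta> - 1) * (1 - q) powr (\<alpha> - 1)) / (Gamma \<alpha> * Gamma \<beta>)"
      using True q by (simp add: rl_kernel_def powr_mult)
    also have "x powr (\<alpha> - 1) * x powr (\<beta> - 1) = x powr (\<alpha> + \<beta> - 2)"
      by (simp flip: powr_add)
    finally show ?thesis using q by (simp add: c_def)
  next
    case q: False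
    have "rl_kernel \<alpha> (x - x * q) * rl_kernel \<beta> (x * q) = 0"
      using q True by (auto simp: rl_kernel_def zero_less_mult_iff)
    moreover have "indicator {0..1} q * (q powr (\<beta> - 1) * (1 - q) powr (\<alpha> - 1)) = 0"
      using q by (cases "q = 0"; cases "q = 1") (auto split: split_indicator)
    ultimately show ?thesis by (simp only: mult_zero_right)
  qed
  have beta: "(\<integral>\<^sup>+q. ennreal (indicator {0..1} q * (q powr (\<beta> - 1) * (1 - q) powr (\<alpha> - 1))) \<partial>lborel)
      = ennreal (Beta \<beta> \<alpha>)"
    by (rule nn_integral_has_integral_lebesgue[OF _ has_integral_Beta_real[OF assms(2,1)]]) auto
  have "(\<integral>\<^sup>+p. ennreal (rl_kernel \<alpha> (x - p) * rl_kernel \<beta> p) \<partial>lborel)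
     = ennreal x * (\<integral>\<^sup>+q. ennreal (rl_kernel \<alpha> (x - x * q) * rl_kernel \<beta> (x * q)) \<partial>lborel)"
    using True by (subst nn_integral_real_affine[of _ x 0]) auto
  also have "\<dots> = ennreal x * (ennreal c * Beta \<beta> \<alpha>)"
    unfolding eq ennreal_mult'[OF c] beta[symmetric] by (subst nn_integral_cmult) auto
  also have "\<dots> = ennreal (x * (c * Beta \<beta> \<alpha>))"
    by (simp only: ennreal_mult'[OF c] ennreal_mult'[OF less_imp_le[OF True]])
  also have "x * (c * Beta \<beta> \<alpha>) = rl_kernel (\<alpha> + \<beta>) x"
  proof -
    have "x powr (\<alpha> + \<beta> - 1) = x * x powr (\<alpha> + \<beta> - 2)"
      using True powr_add[of x 1 "\<alpha> + \<beta> - 2"] by simp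
    then show ?thesis
      using True Gamma_real_pos[OF assms(1)] Gamma_real_pos[OF assms(2)]
      by (simp add: c_def rl_kernel_def Beta_def add.commute)
  qed
  finally show ?thesis .
qed

text \<open>The kernel of order \<open>1\<close> is the Heaviside function, so this is the semigroup property for
  the orders \<open>1\<close> and \<open>\<alpha>\<close>.\<close>

lemma rl_kernel_mass:
  assumes "0 < \<alpha>"
  shows "(\<integral>\<^sup>+p. ennreal (rl_kernel \<alpha> p) * indicator {..x} p \<partial>lborel) = ennreal (rl_kernel (\<alpha> + 1) x)"
proof -
  have "(\<integral>\<^sup>+p. ennreal (rl_kernel \<alpha> p) * indicator {..x} p \<partial>lborel)
      = (\<integral>\<^sup>+p. ennreal (rl_kernel 1 (x - p) * rl_kernel \<alpha> p) \<partial>lborel)"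
    using AE_lborel_singleton[of x] by (intro nn_integral_cong_AE, eventually_elim)
       (auto simp: rl_kernel_def split: split_indicator)
  then show ?thesis using rl_kernel_convolution[of 1 \<alpha> x] assms by (simp add: add.commute)
qed

section \<open>The truncated Marchaud derivative\<close>

definition marchaud_tail :: "real \<Rightarrow> real \<Rightarrow> real \<Rightarrow> real" where
  "marchaud_tail \<alpha> \<epsilon> h = (if \<epsilon> < h then \<alpha> * h powr (- 1 - \<alpha>) else 0)"

text \<open>Marchaud's derivative of order \<open>\<alpha>\<close> is \<open>\<alpha> / Gamma (1 - \<alpha>)\<close> times the integral of
  \<open>(f t - f (t - h)) * h powr (- 1 - \<alpha>)\<close> over \<open>h > 0\<close>. Here it is truncated to \<open>h > \<epsilon>\<close>, and
  the constant part of the integrand is integrated out. In this form it is defined for every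
  integrable \<open>f\<close> and is a convolution operator.\<close>

definition marchaud_trunc :: "real \<Rightarrow> real \<Rightarrow> (real \<Rightarrow> real) \<Rightarrow> real \<Rightarrow> real" where
  "marchaud_trunc \<alpha> \<epsilon> f t =
     (\<epsilon> powr (- \<alpha>) * f t - (LINT r|lborel. marchaud_tail \<alpha> \<epsilon> (t - r) * f r)) / Gamma (1 - \<alpha>)"

text \<open>The convolution of \<open>marchaud_tail\<close> and \<open>rl_kernel\<close>; see \<open>tail_rl_convolution\<close>.\<close>

definition tail_rl :: "real \<Rightarrow> real \<Rightarrow> real \<Rightarrow> real" where
  "tail_rl \<alpha> \<epsilon> x = (if \<epsilon> < x then ((x - \<epsilon>) / \<epsilon>) powr \<alpha> / (x * Gamma \<alpha>) else 0)"

text \<open>The truncated derivative at level \<open>\<epsilon>\<close> composed with the fractional integral is the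
  convolution with \<open>K (s / \<epsilon>) / \<epsilon>\<close>, where \<open>K\<close> is this function.\<close>

definition marchaud_mollifier :: "real \<Rightarrow> real \<Rightarrow> real" where
  "marchaud_mollifier \<alpha> s =
     (if 0 < s then (s powr \<alpha> - (max 0 (s - 1)) powr \<alpha>) / (s * (Gamma \<alpha> * Gamma (1 - \<alpha>))) else 0)"

lemma marchaud_kernels_measurable [measurable]:
  "marchaud_tail \<alpha> \<epsilon> \<in> borel_measurable borel"
  "tail_rl \<alpha> \<epsilon> \<in> borel_measurable borel"
  "marchaud_mollifier \<alpha> \<in> borel_measurable borel"
  unfolding marchaud_tail_def tail_rl_def marchaud_mollifier_def by measurable

lemma marchaud_trunc_measurable [measurable]:
  assumes [measurable]: "f \<in> borel_measurable borel"
  shows "marchaud_trunc \<alpha> \<epsilon> f \<in> borel_measurable borel"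
  unfolding marchaud_trunc_def by measurable

lemma marchaud_tail_nonneg: "0 < \<alpha> \<Longrightarrow> 0 \<le> marchaud_tail \<alpha> \<epsilon> h"
  unfolding marchaud_tail_def by auto

lemma marchaud_tail_mult_integrable:
  assumes "0 < \<alpha>" "0 < \<epsilon>" "integrable lborel f" and [measurable]: "k \<in> borel_measurable borel"
  shows "integrable lborel (\<lambda>r. marchaud_tail \<alpha> \<epsilon> (k r) * f r)"
proof -
  have "\<bar>marchaud_tail \<alpha> \<epsilon> h\<bar> \<le> \<alpha> * \<epsilon> powr (- 1 - \<alpha>)" for h
    using assms by (auto simp: marchaud_tail_def intro!: mult_left_mono powr_mono2')
  then show ?thesis
    using integral_mult_bounded(1)[OF assms(3), of "\<lambda>r. marchaud_tail \<alpha> \<epsilon> (k r)" "\<alpha> * \<epsilon> powr (- 1 - \<alpha>)"]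
    by (simp add: mult.commute)
qed

lemma tail_rl_nonneg: "0 < \<alpha> \<Longrightarrow> 0 < \<epsilon> \<Longrightarrow> 0 \<le> tail_rl \<alpha> \<epsilon> x"
  unfolding tail_rl_def by (auto intro!: divide_nonneg_pos mult_pos_pos Gamma_real_pos)

text \<open>For \<open>0 < p < x - \<epsilon>\<close> the integrand is the derivative of
  \<open>(p / (x - p)) powr \<alpha> / (x * Gamma \<alpha>)\<close>.\<close>

lemma tail_rl_convolution:
  assumes "0 < \<alpha>" "\<alpha> < 1" "0 < \<epsilon>"
  shows "(\<integral>\<^sup>+p. ennreal (marchaud_tail \<alpha> \<epsilon> (x - p) * rl_kernel \<alpha> p) \<partial>lborel) = ennreal (tail_rl \<alpha> \<epsilon> x)"
proof (cases "\<epsilon> < x")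
  case False
  then have "ennreal (marchaud_tail \<alpha> \<epsilon> (x - p) * rl_kernel \<alpha> p) = 0" for p
    by (auto simp: rl_kernel_def marchaud_tail_def)
  then show ?thesis using False by (simp add: tail_rl_def del: ennreal_eq_zero_iff mult_eq_0_iff)
next
  case True
  define F where "F p = (p / (x - p)) powr \<alpha> / (x * Gamma \<alpha>)" for p
  define f where "f p = \<alpha> * (x - p) powr (- 1 - \<alpha>) * (p powr (\<alpha> - 1) / Gamma \<alpha>)" for p
  have "(f has_integral (F (x - \<epsilon>) - F 0)) {0..x - \<epsilon>}"
  proof (rule fundamental_theorem_of_calculus_interior)
    show "continuous_on {0..x - \<epsilon>} F"
      unfolding F_def using assms True
      by (intro continuous_intros continuous_on_powr') (auto simp: Gamma_eq_zero_iff)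
    fix p assume p: "p \<in> {0<..<x - \<epsilon>}"
    have xp: "0 < x - p" "0 < p" "Gamma \<alpha> \<noteq> 0" using p assms less_imp_neq[OF Gamma_real_pos[OF assms(1)]] by auto
    have "(F has_real_derivative
        (p / (x - p)) powr (\<alpha> - 1) * \<alpha> * ((1 * (x - p) - p * (0 - 1)) / ((x - p) * (x - p))) / (x * Gamma \<alpha>)) (at p)"
      unfolding F_def using xp
      by (auto intro!: derivative_eq_intros simp: divide_simps powr_diff)
    also have "(p / (x - p)) powr (\<alpha> - 1) * \<alpha> * ((1 * (x - p) - p * (0 - 1)) / ((x - p) * (x - p))) / (x * Gamma \<alpha>)
       = f p"
    proof -
      have e: "(x - p) powr (- 1 - \<alpha>) = inverse ((x - p) powr (\<alpha> - 1)) / ((x - p) * (x - p))"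
      proof -
        have "(x - p) powr (- 1 - \<alpha>) = (x - p) powr (- (\<alpha> - 1) - 2)" by simp
        also have "\<dots> = (x - p) powr (- (\<alpha> - 1)) / (x - p) powr 2" by (rule powr_diff)
        also have "\<dots> = inverse ((x - p) powr (\<alpha> - 1)) / ((x - p) * (x - p))"
          using xp powr_minus[of "x - p" "\<alpha> - 1"] by (simp add: powr_numeral power2_eq_square)
        finally show ?thesis .
      qed
      show ?thesis unfolding f_def e using xp True assms
        by (simp add: powr_divide divide_simps)
    qed
    finally show "(F has_vector_derivative f p) (at p)"
      by (simp add: has_real_derivative_iff_has_vector_derivative)
  qed (use True in auto)
  then have I: "(f has_integral (F (x - \<epsilon>) - F 0)) {0..x - \<epsilon>}" .
  have "(\<integral>\<^sup>+p. ennreal (marchaud_tail \<alpha> \<epsilon> (x - p) * rl_kernel \<alpha> p) \<partial>lborel)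
    = (\<integral>\<^sup>+p. ennreal (indicator {0..x - \<epsilon>} p * f p) \<partial>lborel)"
    using AE_lborel_singleton[of 0] AE_lborel_singleton[of "x - \<epsilon>"]
    by (intro nn_integral_cong_AE, eventually_elim)
      (auto simp: rl_kernel_def marchaud_tail_def f_def split: split_indicator)
  also have "\<dots> = ennreal (F (x - \<epsilon>) - F 0)"
  proof (rule nn_integral_has_integral_lebesgue[OF _ I])
    show "0 \<le> f p" for p using assms Gamma_real_pos[of \<alpha>] by (auto simp: f_def)
  qed
  also have "F (x - \<epsilon>) - F 0 = tail_rl \<alpha> \<epsilon> x"
    using True assms by (simp add: F_def tail_rl_def)
  finally show ?thesis .
qed

lemma tail_rl_le:
  assumes "0 < \<alpha>" "\<alpha> < 1" "0 < \<epsilon>"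
  shows "tail_rl \<alpha> \<epsilon> x \<le> \<epsilon> powr (- \<alpha>) * rl_kernel \<alpha> x"
proof (cases "\<epsilon> < x")
  case True
  have "((x - \<epsilon>) / \<epsilon>) powr \<alpha> = (x - \<epsilon>) powr \<alpha> * \<epsilon> powr (- \<alpha>)"
    using True assms by (simp add: powr_divide powr_minus_divide)
  also have "\<dots> \<le> x powr \<alpha> * \<epsilon> powr (- \<alpha>)"
    using True assms by (intro mult_right_mono powr_mono2) auto
  finally have "((x - \<epsilon>) / \<epsilon>) powr \<alpha> / (x * Gamma \<alpha>) \<le> x powr \<alpha> * \<epsilon> powr (- \<alpha>) / (x * Gamma \<alpha>)"
    using True assms Gamma_real_pos[of \<alpha>] by (intro divide_right_mono) auto
  also have "\<dots> = \<epsilon> powr (- \<alpha>) * (x powr (\<alpha> - 1) / Gamma \<alpha>)"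
    using True assms by (simp add: powr_diff)
  finally show ?thesis using True assms by (simp add: tail_rl_def rl_kernel_def)
next
  case False then show ?thesis using rl_kernel_nonneg[OF assms(1)] by (simp add: tail_rl_def)
qed

lemma marchaud_mollifier_eq:
  assumes "0 < \<alpha>" "\<alpha> < 1" "0 < \<epsilon>"
  shows "(\<epsilon> powr (- \<alpha>) * rl_kernel \<alpha> x - tail_rl \<alpha> \<epsilon> x) / Gamma (1 - \<alpha>)
    = marchaud_mollifier \<alpha> (x / \<epsilon>) / \<epsilon>"
proof (cases "0 < x")
  case True
  have g: "Gamma \<alpha> > 0" "Gamma (1 - \<alpha>) > 0" using assms by (auto intro: Gamma_real_pos)
  have "(x - \<epsilon>) / \<epsilon> = x / \<epsilon> - 1" using assms by (simp add: field_simps)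
  then have t: "tail_rl \<alpha> \<epsilon> x = (max 0 (x / \<epsilon> - 1)) powr \<alpha> / (x * Gamma \<alpha>)"
    using assms by (auto simp: tail_rl_def max_def field_simps)
  have k: "\<epsilon> powr (- \<alpha>) * rl_kernel \<alpha> x = (x / \<epsilon>) powr \<alpha> / (x * Gamma \<alpha>)"
    using True assms by (simp add: rl_kernel_def powr_divide powr_minus powr_diff field_simps)
  show ?thesis unfolding t k marchaud_mollifier_def using True assms g
    by (simp add: diff_divide_distrib)
next
  case False then show ?thesis
    using assms by (simp add: tail_rl_def rl_kernel_def marchaud_mollifier_def zero_less_divide_iff)
qed

lemma marchaud_mollifier_integrable:
  assumes "0 < \<alpha>" "\<alpha> < 1"
  shows "integrable lborel (marchaud_mollifier \<alpha>)"
proof -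
  define c where "c = 1 / (Gamma \<alpha> * Gamma (1 - \<alpha>))"
  have c: "0 < c" using assms by (auto simp: c_def intro!: Gamma_real_pos)
  have "((\<lambda>s. s powr (\<alpha> - 1)) has_integral (1 powr (\<alpha> - 1 + 1) / (\<alpha> - 1 + 1))) {0..1}"
    using assms by (intro has_integral_powr_from_0) auto
  from nn_integral_has_integral_lebesgue[OF _ this]
  have i1: "(\<integral>\<^sup>+s. ennreal (indicator {0..1} s * s powr (\<alpha> - 1)) \<partial>lborel) < \<infinity>" by simp
  have "((\<lambda>s. s powr (\<alpha> - 2)) has_integral (- (1 powr (\<alpha> - 2 + 1)) / (\<alpha> - 2 + 1))) {1..}"
    using assms by (intro has_integral_powr_to_inf) auto
  from nn_integral_has_integral_lebesgue[OF _ this]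
  have i2: "(\<integral>\<^sup>+s. ennreal (indicator {1..} s * s powr (\<alpha> - 2)) \<partial>lborel) < \<infinity>" by simp
  have le: "\<bar>marchaud_mollifier \<alpha> s\<bar>
     \<le> c * (indicator {0..1} s * s powr (\<alpha> - 1) + indicator {1..} s * s powr (\<alpha> - 2))" for s
  proof (cases "0 < s")
    case True
    have mono: "(max 0 (s - 1)) powr \<alpha> \<le> s powr \<alpha>" using True assms by (intro powr_mono2) auto
    have "(s powr \<alpha> - (max 0 (s - 1)) powr \<alpha>) / s
      \<le> indicator {0..1} s * s powr (\<alpha> - 1) + indicator {1..} s * s powr (\<alpha> - 2)"
    proof (cases "s \<le> 1")
      case s1: True
      then have "(s powr \<alpha> - (max 0 (s - 1)) powr \<alpha>) / s = s powr (\<alpha> - 1)"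
        using True assms by (simp add: powr_diff max_def)
      then show ?thesis using s1 True by (simp split: split_indicator)
    next
      case s1: False
      \<comment> \<open>For \<open>s > 1\<close> the numerator is \<open>s powr \<alpha> * (1 - z powr \<alpha>)\<close>, and \<open>z \<le> z powr \<alpha>\<close> gives
        the integrable decay \<open>s powr (\<alpha> - 2)\<close>.\<close>
      define z where "z = (s - 1) / s"
      have z: "0 < z" "z < 1" using s1 by (auto simp: z_def)
      have "z powr 1 \<le> z powr \<alpha>" using z assms by (intro powr_mono') auto
      then have "z \<le> z powr \<alpha>" using z by simp
      have "s - 1 = s * z" using s1 by (simp add: z_def)
      then have "(s - 1) powr \<alpha> = s powr \<alpha> * z powr \<alpha>" using s1 z by (simp add: powr_mult)
      then have "(s powr \<alpha> - (max 0 (s - 1)) powr \<alpha>) / s = s powr \<alpha> * (1 - z powr \<alpha>) / s"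
        using s1 by (simp add: max_def right_diff_distrib)
      also have "\<dots> \<le> s powr \<alpha> * (1 - z) / s"
        using \<open>z \<le> z powr \<alpha>\<close> True by (intro divide_right_mono mult_left_mono) auto
      also have "\<dots> = s powr (\<alpha> - 2)"
        using s1 powr_diff[of s \<alpha> 2] by (simp add: z_def powr_numeral power2_eq_square field_simps)
      finally show ?thesis using s1 by (simp split: split_indicator)
    qed
    moreover have "marchaud_mollifier \<alpha> s = c * ((s powr \<alpha> - (max 0 (s - 1)) powr \<alpha>) / s)"
      using True by (simp add: marchaud_mollifier_def c_def)
    moreover have "0 \<le> marchaud_mollifier \<alpha> s"
      unfolding calculation(2) using mono c True by simp
    ultimately show ?thesis using c by (simp del: times_divide_eq_right)
  next
    case False then show ?thesis using c by (auto simp: marchaud_mollifier_def)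
  qed
  have "integrable lborel (\<lambda>s. indicator {0..1} s * s powr (\<alpha> - 1) :: real)"
       "integrable lborel (\<lambda>s. indicator {1..} s * s powr (\<alpha> - 2) :: real)"
    using i1 i2 by (auto simp: integrable_iff_bounded)
  then have "integrable lborel (\<lambda>s. c * (indicator {0..1} s * s powr (\<alpha> - 1) + indicator {1..} s * s powr (\<alpha> - 2)))"
    by (intro integrable_mult_right Bochner_Integration.integrable_add)
  then show ?thesis
    by (rule Bochner_Integration.integrable_bound)
      (auto intro!: AE_I2 order_trans[OF le abs_ge_self])
qed

text \<open>The truncated derivative and the fractional integral are both convolutions, so they
  commute. In the limit, the first order of composition recovers \<open>f\<close> from its fractional
  integral, the second one shows that \<open>f\<close> is a fractional integral.\<close>

lemma marchaud_trunc_rl_int: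
  assumes \<alpha>: "0 < \<alpha>" "\<alpha> < 1" "0 < \<epsilon>" and [measurable]: "f \<in> borel_measurable borel"
    and int: "integrable lborel (\<lambda>r. rl_kernel \<alpha> (t - r) * f r)"
  shows "marchaud_trunc \<alpha> \<epsilon> (rl_int \<alpha> f) t = (LINT s|lborel. marchaud_mollifier \<alpha> s * f (t - \<epsilon> * s))"
    and "rl_int \<alpha> (marchaud_trunc \<alpha> \<epsilon> f) t = (LINT s|lborel. marchaud_mollifier \<alpha> s * f (t - \<epsilon> * s))"
proof -
  have int': "integrable lborel (\<lambda>r. tail_rl \<alpha> \<epsilon> (t - r) * f r)"
  proof (rule Bochner_Integration.integrable_bound[OF integrable_mult_right[OF int, of "\<epsilon> powr (- \<alpha>)"]])
    have "\<bar>tail_rl \<alpha> \<epsilon> (t - r) * f r\<bar> \<le> \<epsilon> powr (- \<alpha>) * rl_kernel \<alpha> (t - r) * \<bar>f r\<bar>" for r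
      using tail_rl_nonneg[OF \<alpha>(1,3)] by (auto simp: abs_mult intro!: mult_right_mono tail_rl_le \<alpha>)
    then show "AE r in lborel. norm (tail_rl \<alpha> \<epsilon> (t - r) * f r) \<le> norm (\<epsilon> powr (- \<alpha>) * (rl_kernel \<alpha> (t - r) * f r))"
      using rl_kernel_nonneg[OF \<alpha>(1)] by (simp add: abs_mult mult.assoc)
  qed simp
  have "(\<epsilon> powr (- \<alpha>) * (LINT r|lborel. rl_kernel \<alpha> (t - r) * f r) - (LINT r|lborel. tail_rl \<alpha> \<epsilon> (t - r) * f r)) / Gamma (1 - \<alpha>)
     = (LINT r|lborel. (\<epsilon> powr (- \<alpha>) * rl_kernel \<alpha> (t - r) - tail_rl \<alpha> \<epsilon> (t - r)) / Gamma (1 - \<alpha>) * f r)"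
    using int int' by (simp add: left_diff_distrib mult.assoc)
  also have "\<dots> = (LINT r|lborel. marchaud_mollifier \<alpha> ((t - r) / \<epsilon>) / \<epsilon> * f r)"
    using marchaud_mollifier_eq[OF \<alpha>] by simp
  also have "\<dots> = \<bar>- \<epsilon>\<bar> * (LINT s|lborel. marchaud_mollifier \<alpha> ((t - (t + (- \<epsilon>) * s)) / \<epsilon>) / \<epsilon> * f (t + (- \<epsilon>) * s))"
    using \<alpha> lborel_integral_real_affine[of "-\<epsilon>" "\<lambda>r. marchaud_mollifier \<alpha> ((t - r) / \<epsilon>) / \<epsilon> * f r" t] by simp
  also have "\<dots> = (LINT s|lborel. marchaud_mollifier \<alpha> s * f (t - \<epsilon> * s))"
    using \<alpha> by simp
  finally have eq: "(\<epsilon> powr (- \<alpha>) * (LINT r|lborel. rl_kernel \<alpha> (t - r) * f r) - (LINT r|lborel. tail_rl \<alpha> \<epsilon> (t - r) * f r)) / Gamma (1 - \<alpha>)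
     = (LINT s|lborel. marchaud_mollifier \<alpha> s * f (t - \<epsilon> * s))" .
  have "(LINT p|lborel. marchaud_tail \<alpha> \<epsilon> (t - p) * (LINT r|lborel. rl_kernel \<alpha> (p - r) * f r))
      = (LINT r|lborel. tail_rl \<alpha> \<epsilon> (t - r) * f r)"
    by (rule convolution_assoc(1))
       (auto simp: tail_rl_convolution[OF \<alpha>] marchaud_tail_nonneg rl_kernel_nonneg tail_rl_nonneg \<alpha> int')
  then show "marchaud_trunc \<alpha> \<epsilon> (rl_int \<alpha> f) t = (LINT s|lborel. marchaud_mollifier \<alpha> s * f (t - \<epsilon> * s))"
    unfolding marchaud_trunc_def rl_int_def eq[symmetric] by simp
  have conv: "(\<integral>\<^sup>+p. ennreal (rl_kernel \<alpha> (x - p) * marchaud_tail \<alpha> \<epsilon> p) \<partial>lborel) = ennreal (tail_rl \<alpha> \<epsilon> x)" for x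
    using nn_convolution_commute[of "rl_kernel \<alpha>" "marchaud_tail \<alpha> \<epsilon>" x] tail_rl_convolution[OF \<alpha>] by simp
  have A: "(LINT p|lborel. rl_kernel \<alpha> (t - p) * (LINT r|lborel. marchaud_tail \<alpha> \<epsilon> (p - r) * f r))
      = (LINT r|lborel. tail_rl \<alpha> \<epsilon> (t - r) * f r)"
    "integrable lborel (\<lambda>p. rl_kernel \<alpha> (t - p) * (LINT r|lborel. marchaud_tail \<alpha> \<epsilon> (p - r) * f r))"
    using convolution_assoc[of "rl_kernel \<alpha>" "marchaud_tail \<alpha> \<epsilon>" "tail_rl \<alpha> \<epsilon>" f t]
      conv int' marchaud_tail_nonneg[OF \<alpha>(1)] rl_kernel_nonneg[OF \<alpha>(1)] tail_rl_nonneg[OF \<alpha>(1,3)]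
    by auto
  have "rl_int \<alpha> (marchaud_trunc \<alpha> \<epsilon> f) t
     = (LINT p|lborel. (\<epsilon> powr (- \<alpha>) * (rl_kernel \<alpha> (t - p) * f p)
          - rl_kernel \<alpha> (t - p) * (LINT r|lborel. marchaud_tail \<alpha> \<epsilon> (p - r) * f r)) / Gamma (1 - \<alpha>))"
    unfolding rl_int_def marchaud_trunc_def
    by (intro Bochner_Integration.integral_cong) (auto simp: algebra_simps)
  also have "\<dots> = (\<epsilon> powr (- \<alpha>) * (LINT r|lborel. rl_kernel \<alpha> (t - r) * f r) - (LINT r|lborel. tail_rl \<alpha> \<epsilon> (t - r) * f r)) / Gamma (1 - \<alpha>)"
    using A int by (simp del: times_divide_eq_right)
  finally show "rl_int \<alpha> (marchaud_trunc \<alpha> \<epsilon> f) t = (LINT s|lborel. marchaud_mollifier \<alpha> s * f (t - \<epsilon> * s))"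
    unfolding eq .
qed

section \<open>Marchaud's formula inverts the fractional integral\<close>

text \<open>Functions on \<open>[a, b]\<close> are represented by their extensions by \<open>0\<close>; the fractional integrals
  then become convolutions on the line.\<close>

definition L1_on :: "real \<Rightarrow> real \<Rightarrow> (real \<Rightarrow> real) \<Rightarrow> bool" where
  "L1_on a b u \<longleftrightarrow> integrable lborel u \<and> (\<forall>t. t \<notin> {a..b} \<longrightarrow> u t = 0)"

definition L1_dist :: "real \<Rightarrow> real \<Rightarrow> (real \<Rightarrow> real) \<Rightarrow> (real \<Rightarrow> real) \<Rightarrow> ennreal" where
  "L1_dist a b f g = (\<integral>\<^sup>+t\<in>{a..b}. ennreal \<bar>f t - g t\<bar> \<partial>lborel)"

lemma L1_onD:
  assumes "L1_on a b u"
  shows "integrable lborel u" "u \<in> borel_measurable borel" "\<And>t. t < a \<Longrightarrow> u t = 0" "\<And>t. b < t \<Longrightarrow> u t = 0"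
  using assms unfolding L1_on_def by (auto dest: borel_measurable_integrable)

lemma L1_dist_cong_AE:
  assumes "AE t in lborel. t \<in> {a..b} \<longrightarrow> f t = f' t" "AE t in lborel. t \<in> {a..b} \<longrightarrow> g t = g' t"
  shows "L1_dist a b f g = L1_dist a b f' g'"
  unfolding L1_dist_def using assms
  by (intro nn_integral_cong_AE, eventually_elim) (auto split: split_indicator)

lemma L1_dist_commute: "L1_dist a b f g = L1_dist a b g f"
  unfolding L1_dist_def by (simp add: abs_minus_commute)

lemma L1_dist_triangle:
  assumes [measurable]: "f \<in> borel_measurable borel" "g \<in> borel_measurable borel" "k \<in> borel_measurable borel"
  shows "L1_dist a b f k \<le> L1_dist a b f g + L1_dist a b g k"
proof -
  have "ennreal \<bar>f t - k t\<bar> \<le> ennreal \<bar>f t - g t\<bar> + ennreal \<bar>g t - k t\<bar>" for t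
  proof -
    have "ennreal \<bar>f t - k t\<bar> \<le> ennreal (\<bar>f t - g t\<bar> + \<bar>g t - k t\<bar>)" by (rule ennreal_leI) linarith
    then show ?thesis by simp
  qed
  then have "L1_dist a b f k
     \<le> (\<integral>\<^sup>+t. ennreal \<bar>f t - g t\<bar> * indicator {a..b} t + ennreal \<bar>g t - k t\<bar> * indicator {a..b} t \<partial>lborel)"
    unfolding L1_dist_def by (intro nn_integral_mono) (auto split: split_indicator)
  also have "\<dots> = L1_dist a b f g + L1_dist a b g k"
    unfolding L1_dist_def by (rule nn_integral_add) auto
  finally show ?thesis .
qed

lemma L1_dist_eq_0D:
  assumes [measurable]: "f \<in> borel_measurable borel" "g \<in> borel_measurable borel"
    and "L1_dist a b f g = 0"
  shows "AE t in lborel. t \<in> {a..b} \<longrightarrow> f t = g t"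
  using assms(3) unfolding L1_dist_def
  by (subst (asm) nn_integral_0_iff_AE) (auto elim!: eventually_mono split: split_indicator_asm)

lemma L1_dist_limit_unique:
  assumes "\<And>\<epsilon>. F \<epsilon> \<in> borel_measurable borel" "f \<in> borel_measurable borel" "g \<in> borel_measurable borel"
    and "((\<lambda>\<epsilon>. L1_dist a b (F \<epsilon>) f) \<longlongrightarrow> 0) (at_right (0::real))"
    and "((\<lambda>\<epsilon>. L1_dist a b (F \<epsilon>) g) \<longlongrightarrow> 0) (at_right (0::real))"
  shows "AE t in lborel. t \<in> {a..b} \<longrightarrow> f t = g t"
proof (rule L1_dist_eq_0D)
  have "((\<lambda>\<epsilon>. L1_dist a b (F \<epsilon>) f + L1_dist a b (F \<epsilon>) g) \<longlongrightarrow> 0) (at_right (0::real))"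
    using tendsto_add[OF assms(4,5)] by simp
  moreover have "L1_dist a b f g \<le> L1_dist a b (F \<epsilon>) f + L1_dist a b (F \<epsilon>) g" for \<epsilon>
    using L1_dist_triangle[OF assms(2,1,3)] by (simp add: L1_dist_commute[of _ _ f])
  ultimately have "L1_dist a b f g \<le> 0"
    by (intro tendsto_lowerbound[of "\<lambda>\<epsilon>. L1_dist a b (F \<epsilon>) f + L1_dist a b (F \<epsilon>) g" 0 "at_right 0"])
      (auto intro: always_eventually)
  then show "L1_dist a b f g = 0" by simp
qed (use assms in auto)

lemma rl_kernel_mono_mass:
  assumes "0 < \<alpha>" "x \<le> y"
  shows "rl_kernel (\<alpha> + 1) x \<le> rl_kernel (\<alpha> + 1) y"
  using assms Gamma_real_pos[of "\<alpha> + 1"]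
  by (auto simp: rl_kernel_def intro!: divide_right_mono powr_mono2)

text \<open>The fractional integral maps \<open>L\<^sup>1\<close> of a bounded interval to itself: this is Tonelli's
  theorem and the mass of the kernel.\<close>

lemma rl_int_nn_bound:
  assumes "0 < \<alpha>" and [measurable]: "u \<in> borel_measurable borel" and "\<And>r. r < a \<Longrightarrow> u r = 0"
  shows "(\<integral>\<^sup>+t\<in>{..c}. (\<integral>\<^sup>+r. ennreal (rl_kernel \<alpha> (t - r)) * ennreal \<bar>u r\<bar> \<partial>lborel) \<partial>lborel)
    \<le> ennreal (rl_kernel (\<alpha> + 1) (c - a)) * (\<integral>\<^sup>+r. ennreal \<bar>u r\<bar> \<partial>lborel)"
proof -
  have "(\<integral>\<^sup>+t\<in>{..c}. (\<integral>\<^sup>+r. ennreal (rl_kernel \<alpha> (t - r)) * ennreal \<bar>u r\<bar> \<partial>lborel) \<partial>lborel)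
    = (\<integral>\<^sup>+t. \<integral>\<^sup>+r. ennreal (rl_kernel \<alpha> (t - r)) * indicator {..c} t * ennreal \<bar>u r\<bar> \<partial>lborel \<partial>lborel)"
    by (intro nn_integral_cong) (auto split: split_indicator)
  also have "\<dots> = (\<integral>\<^sup>+r. (\<integral>\<^sup>+t. ennreal (rl_kernel \<alpha> (t - r)) * indicator {..c} t \<partial>lborel) * ennreal \<bar>u r\<bar> \<partial>lborel)"
    by (subst lborel_pair.Fubini') (auto simp: nn_integral_multc)
  also have "\<dots> \<le> (\<integral>\<^sup>+r. ennreal (rl_kernel (\<alpha> + 1) (c - a)) * ennreal \<bar>u r\<bar> \<partial>lborel)"
  proof (rule nn_integral_mono)
    fix r
    have "(\<integral>\<^sup>+t. ennreal (rl_kernel \<alpha> (t - r)) * indicator {..c} t \<partial>lborel)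
       = (\<integral>\<^sup>+t. ennreal (rl_kernel \<alpha> t) * indicator {..c - r} t \<partial>lborel)"
      by (subst nn_integral_translate[of _ r, symmetric]) (auto intro!: nn_integral_cong split: split_indicator)
    also have "\<dots> = ennreal (rl_kernel (\<alpha> + 1) (c - r))" by (rule rl_kernel_mass[OF assms(1)])
    finally show "(\<integral>\<^sup>+t. ennreal (rl_kernel \<alpha> (t - r)) * indicator {..c} t \<partial>lborel) * ennreal \<bar>u r\<bar>
      \<le> ennreal (rl_kernel (\<alpha> + 1) (c - a)) * ennreal \<bar>u r\<bar>"
      using assms(3)[of r] rl_kernel_mono_mass[OF assms(1), of "c - r" "c - a"]
      by (cases "r < a") (auto intro!: mult_right_mono ennreal_leI)
  qed
  also have "\<dots> = ennreal (rl_kernel (\<alpha> + 1) (c - a)) * (\<integral>\<^sup>+r. ennreal \<bar>u r\<bar> \<partial>lborel)"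
    by (rule nn_integral_cmult) auto
  finally show ?thesis .
qed

lemma rl_int_integrable_AE:
  assumes "0 < \<alpha>" "integrable lborel u" "\<And>r. r < a \<Longrightarrow> u r = 0"
  shows "AE t in lborel. t \<le> c \<longrightarrow> integrable lborel (\<lambda>r. rl_kernel \<alpha> (t - r) * u r)"
proof -
  have [measurable]: "u \<in> borel_measurable borel" using assms(2) by (auto dest: borel_measurable_integrable)
  have "(\<integral>\<^sup>+t\<in>{..c}. (\<integral>\<^sup>+r. ennreal (rl_kernel \<alpha> (t - r)) * ennreal \<bar>u r\<bar> \<partial>lborel) \<partial>lborel) < \<infinity>"
    using assms(2) by (intro le_less_trans[OF rl_int_nn_bound[OF assms(1) _ assms(3)]])
      (auto simp: ennreal_mult_less_top integrable_iff_bounded)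
  then have "AE t in lborel. (\<integral>\<^sup>+r. ennreal (rl_kernel \<alpha> (t - r)) * ennreal \<bar>u r\<bar> \<partial>lborel) * indicator {..c} t \<noteq> \<infinity>"
    by (intro nn_integral_PInf_AE) auto
  then show ?thesis
    by eventually_elim
      (auto simp: integrable_iff_bounded abs_mult rl_kernel_nonneg[OF assms(1)] ennreal_mult' less_top)
qed

lemma rl_int_left_zero:
  assumes "\<And>r. r < a \<Longrightarrow> u r = 0" "t \<le> a"
  shows "rl_int \<alpha> u t = 0"
proof -
  have "rl_int \<alpha> u t = (LINT r::real|lborel. 0)"
    unfolding rl_int_def using assms
    by (intro Bochner_Integration.integral_cong refl) (auto simp: rl_kernel_def)
  then show ?thesis by simp
qed

lemma rl_int_L1_bound:
  assumes \<alpha>: "0 < \<alpha>" and u: "integrable lborel u" "\<And>r. r < a \<Longrightarrow> u r = 0"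
  shows "(\<integral>\<^sup>+t\<in>{..c}. ennreal \<bar>rl_int \<alpha> u t\<bar> \<partial>lborel)
    \<le> ennreal (rl_kernel (\<alpha> + 1) (c - a)) * (\<integral>\<^sup>+r. ennreal \<bar>u r\<bar> \<partial>lborel)"
proof -
  have [measurable]: "u \<in> borel_measurable borel" using u(1) by (auto dest: borel_measurable_integrable)
  have "ennreal \<bar>rl_int \<alpha> u t\<bar> \<le> (\<integral>\<^sup>+r. ennreal (rl_kernel \<alpha> (t - r)) * ennreal \<bar>u r\<bar> \<partial>lborel)"
    if "integrable lborel (\<lambda>r. rl_kernel \<alpha> (t - r) * u r)" for t
    unfolding rl_int_def using integral_norm_bound_ennreal[OF that] rl_kernel_nonneg[OF \<alpha>]
    by (simp add: abs_mult ennreal_mult')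
  then have "(\<integral>\<^sup>+t\<in>{..c}. ennreal \<bar>rl_int \<alpha> u t\<bar> \<partial>lborel)
    \<le> (\<integral>\<^sup>+t\<in>{..c}. (\<integral>\<^sup>+r. ennreal (rl_kernel \<alpha> (t - r)) * ennreal \<bar>u r\<bar> \<partial>lborel) \<partial>lborel)"
    using rl_int_integrable_AE[OF \<alpha> u, where a=a and c=c]
    by (intro nn_integral_mono_AE) (auto elim!: eventually_mono split: split_indicator)
  also have "\<dots> \<le> ennreal (rl_kernel (\<alpha> + 1) (c - a)) * (\<integral>\<^sup>+r. ennreal \<bar>u r\<bar> \<partial>lborel)"
    using u by (intro rl_int_nn_bound[OF \<alpha>]) auto
  finally show ?thesis .
qed

lemma rl_int_L1_on:
  assumes "0 < \<alpha>" "L1_on a b u"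
  shows "L1_on a b (\<lambda>t. indicator {a..b} t * rl_int \<alpha> u t)"
  unfolding L1_on_def
proof safe
  note u = L1_onD[OF assms(2)]
  note [measurable] = u(2)
  have "(\<integral>\<^sup>+t. ennreal (norm (indicator {a..b} t * rl_int \<alpha> u t)) \<partial>lborel) \<le> (\<integral>\<^sup>+t\<in>{..b}. ennreal \<bar>rl_int \<alpha> u t\<bar> \<partial>lborel)"
    by (intro nn_integral_mono) (auto split: split_indicator)
  also have "\<dots> < \<infinity>"
    using u(1) by (intro le_less_trans[OF rl_int_L1_bound[OF assms(1) u(1,3)]])
      (auto simp: ennreal_mult_less_top integrable_iff_bounded)
  finally show "integrable lborel (\<lambda>t. indicator {a..b} t * rl_int \<alpha> u t)"
    by (auto simp: integrable_iff_bounded)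
qed auto

lemma powr_tail_integral:
  fixes \<alpha> l u :: real
  assumes "0 < \<alpha>" "0 < l" "l \<le> u"
  shows "integrable lborel (\<lambda>h. indicator {l..u} h * (\<alpha> * h powr (- 1 - \<alpha>)))"
    and "(LINT h|lborel. indicator {l..u} h * (\<alpha> * h powr (- 1 - \<alpha>))) = l powr (- \<alpha>) - u powr (- \<alpha>)"
proof -
  have c: "continuous_on {l..u} (\<lambda>h. \<alpha> * h powr (- 1 - \<alpha>))"
    using assms by (auto intro!: continuous_intros)
  show "integrable lborel (\<lambda>h. indicator {l..u} h * (\<alpha> * h powr (- 1 - \<alpha>)))"
    using borel_integrable_compact[OF _ c] by (simp add: mult.commute)
  have "(LINT h|lborel. indicator {l..u} h *\<^sub>R (\<alpha> * h powr (- 1 - \<alpha>))) = - (u powr (- \<alpha>)) - (- (l powr (- \<alpha>)))"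
  proof (rule integral_FTC_atLeastAtMost[OF assms(3) _ c])
    have e: "- 1 - \<alpha> = - \<alpha> - 1" by simp
    fix h assume h: "l \<le> h" "h \<le> u"
    have "((\<lambda>h. - (h powr (- \<alpha>))) has_real_derivative \<alpha> * h powr (- 1 - \<alpha>)) (at h within {l..u})"
      unfolding e using h assms by (auto intro!: derivative_eq_intros)
    then show "((\<lambda>h. - (h powr (- \<alpha>))) has_vector_derivative \<alpha> * h powr (- 1 - \<alpha>)) (at h within {l..u})"
      by (simp add: has_real_derivative_iff_has_vector_derivative)
  qed
  then show "(LINT h|lborel. indicator {l..u} h * (\<alpha> * h powr (- 1 - \<alpha>))) = l powr (- \<alpha>) - u powr (- \<alpha>)"
    by simp
qed

lemma marchaud_tail_total:
  assumes "0 < \<alpha>" "0 < \<epsilon>"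
  shows "integrable lborel (marchaud_tail \<alpha> \<epsilon>)" "(LINT h|lborel. marchaud_tail \<alpha> \<epsilon> h) = \<epsilon> powr (- \<alpha>)"
proof -
  have "((\<lambda>h. h powr (- 1 - \<alpha>)) has_integral - (\<epsilon> powr (- 1 - \<alpha> + 1)) / (- 1 - \<alpha> + 1)) {\<epsilon>..}"
    using assms by (intro has_integral_powr_to_inf) auto
  then have "((\<lambda>h. \<alpha> * h powr (- 1 - \<alpha>)) has_integral \<alpha> * (- (\<epsilon> powr (- 1 - \<alpha> + 1)) / (- 1 - \<alpha> + 1))) {\<epsilon>..}"
    by (rule has_integral_mult_right)
  also have "\<alpha> * (- (\<epsilon> powr (- 1 - \<alpha> + 1)) / (- 1 - \<alpha> + 1)) = \<epsilon> powr (- \<alpha>)" using assms by simp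
  finally have "(\<integral>\<^sup>+h. ennreal (indicator {\<epsilon>..} h * (\<alpha> * h powr (- 1 - \<alpha>))) \<partial>lborel) = ennreal (\<epsilon> powr (- \<alpha>))"
    using assms by (intro nn_integral_has_integral_lebesgue) auto
  also have "(\<integral>\<^sup>+h. ennreal (indicator {\<epsilon>..} h * (\<alpha> * h powr (- 1 - \<alpha>))) \<partial>lborel)
     = (\<integral>\<^sup>+h. ennreal (marchaud_tail \<alpha> \<epsilon> h) \<partial>lborel)"
    using AE_lborel_singleton[of \<epsilon>] by (intro nn_integral_cong_AE, eventually_elim)
      (auto simp: marchaud_tail_def split: split_indicator)
  finally have *: "(\<integral>\<^sup>+h. ennreal (marchaud_tail \<alpha> \<epsilon> h) \<partial>lborel) = ennreal (\<epsilon> powr (- \<alpha>))" .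
  show "integrable lborel (marchaud_tail \<alpha> \<epsilon>)"
    using * marchaud_tail_nonneg[OF assms(1)] by (auto simp: integrable_iff_bounded)
  show "(LINT h|lborel. marchaud_tail \<alpha> \<epsilon> h) = \<epsilon> powr (- \<alpha>)"
    using * marchaud_tail_nonneg[OF assms(1)] by (subst integral_eq_nn_integral) auto
qed

text \<open>Truncated derivatives at \<open>t \<le> b\<close> only see values at points up to \<open>t\<close>, so \<open>f\<close> may be
  replaced by the fractional integral of \<open>\<phi>\<close>. The limit still carries the mass of the
  mollifier as a factor.\<close>

lemma marchaud_trunc_rl_int_tendsto_aux:
  assumes \<alpha>: "0 < \<alpha>" "\<alpha> < 1" and \<phi>: "L1_on a b \<phi>"
    and f: "f \<in> borel_measurable borel" "\<And>t. t < a \<Longrightarrow> f t = 0"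
      "AE t in lborel. t \<in> {a..b} \<longrightarrow> f t = rl_int \<alpha> \<phi> t"
  shows "((\<lambda>\<epsilon>. L1_dist a b (marchaud_trunc \<alpha> \<epsilon> f) (\<lambda>t. (LINT s|lborel. marchaud_mollifier \<alpha> s) * \<phi> t)) \<longlongrightarrow> 0) (at_right 0)"
proof -
  note \<phi> = L1_onD[OF \<phi>]
  note [measurable] = \<phi>(2) f(1)
  have eq: "L1_dist a b (marchaud_trunc \<alpha> \<epsilon> f) (\<lambda>t. (LINT s|lborel. marchaud_mollifier \<alpha> s) * \<phi> t)
    \<le> (\<integral>\<^sup>+t. ennreal \<bar>(LINT s|lborel. marchaud_mollifier \<alpha> s * \<phi> (t - \<epsilon> * s)) - (LINT s|lborel. marchaud_mollifier \<alpha> s) * \<phi> t\<bar> \<partial>lborel)"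
    if "0 < \<epsilon>" for \<epsilon>
  proof -
    have "marchaud_trunc \<alpha> \<epsilon> f t = (LINT s|lborel. marchaud_mollifier \<alpha> s * \<phi> (t - \<epsilon> * s))"
      if t: "t \<in> {a..b}" "f t = rl_int \<alpha> \<phi> t" "integrable lborel (\<lambda>r. rl_kernel \<alpha> (t - r) * \<phi> r)" for t
    proof -
      have "AE r in lborel. marchaud_tail \<alpha> \<epsilon> (t - r) * f r = marchaud_tail \<alpha> \<epsilon> (t - r) * rl_int \<alpha> \<phi> r"
        using f(3)
      proof eventually_elim
        case (elim r)
        have "f r = 0 \<and> rl_int \<alpha> \<phi> r = 0" if "r < a" using that f(2) rl_int_left_zero[of a \<phi> r] \<phi>(3) by auto
        then show ?case using elim t \<open>0 < \<epsilon>\<close>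
          by (cases "r \<in> {a..b}") (auto simp: marchaud_tail_def)
      qed
      then have "(LINT r|lborel. marchaud_tail \<alpha> \<epsilon> (t - r) * f r) = (LINT r|lborel. marchaud_tail \<alpha> \<epsilon> (t - r) * rl_int \<alpha> \<phi> r)"
        by (intro integral_cong_AE) auto
      then have "marchaud_trunc \<alpha> \<epsilon> f t = marchaud_trunc \<alpha> \<epsilon> (rl_int \<alpha> \<phi>) t"
        using t by (simp add: marchaud_trunc_def)
      then show ?thesis using marchaud_trunc_rl_int(1)[OF \<alpha> \<open>0 < \<epsilon>\<close> _ t(3)] by simp
    qed
    then show ?thesis
      unfolding L1_dist_def using f(3) rl_int_integrable_AE[OF \<alpha>(1) \<phi>(1,3), where a=a and c=b]
      by (intro nn_integral_mono_AE) (auto elim!: eventually_elim2 split: split_indicator)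
  qed
  show ?thesis
    by (rule tendsto_sandwich[OF _ _ tendsto_const approximate_identity[OF marchaud_mollifier_integrable[OF \<alpha>] \<phi>(1)]])
       (auto simp: eventually_at_filter eq)
qed

text \<open>The mass is found by testing the preceding limit on one function. The kernel of order
  \<open>1 - \<alpha>\<close> has the fractional integral \<open>1\<close> of order \<open>\<alpha>\<close> on \<open>(0, 1]\<close>, and the truncated
  derivative of the constant \<open>1\<close>, extended by \<open>0\<close>, is that kernel again as soon as \<open>\<epsilon> < t\<close>.\<close>

lemma marchaud_mollifier_mass:
  assumes \<alpha>: "0 < \<alpha>" "\<alpha> < 1"
  shows "(LINT s|lborel. marchaud_mollifier \<alpha> s) = 1"
proof -
  define c where "c = (LINT s|lborel. marchaud_mollifier \<alpha> s)"
  define \<phi> where "\<phi> t = rl_kernel (1 - \<alpha>) t * indicator {..1} t" for t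
  define f :: "real \<Rightarrow> real" where "f t = indicator {0..1} t" for t
  have [measurable]: "\<phi> \<in> borel_measurable borel" "f \<in> borel_measurable borel"
    unfolding \<phi>_def f_def by measurable
  have pos: "0 \<le> rl_kernel (1 - \<alpha>) h" for h using rl_kernel_nonneg[of "1 - \<alpha>" h] \<alpha> by simp
  have "(\<integral>\<^sup>+t. ennreal \<bar>\<phi> t\<bar> \<partial>lborel) = (\<integral>\<^sup>+p. ennreal (rl_kernel (1 - \<alpha>) p) * indicator {..1} p \<partial>lborel)"
    unfolding \<phi>_def using pos by (intro nn_integral_cong) (auto split: split_indicator)
  also have "\<dots> < \<infinity>" using rl_kernel_mass[of "1 - \<alpha>" 1] \<alpha> by simp
  finally have \<phi>: "L1_on 0 1 \<phi>"
    unfolding L1_on_def by (auto simp: integrable_iff_bounded) (auto simp: \<phi>_def rl_kernel_def)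
  have rl: "rl_int \<alpha> \<phi> t = 1" if t: "t \<in> {0<..1}" for t
  proof -
    have eq: "(\<lambda>r. rl_kernel \<alpha> (t - r) * \<phi> r) = (\<lambda>r. rl_kernel \<alpha> (t - r) * rl_kernel (1 - \<alpha>) r)"
      using t by (auto simp: \<phi>_def rl_kernel_def)
    have "rl_int \<alpha> \<phi> t = enn2real (\<integral>\<^sup>+r. ennreal (rl_kernel \<alpha> (t - r) * rl_kernel (1 - \<alpha>) r) \<partial>lborel)"
      unfolding rl_int_def eq using rl_kernel_nonneg[OF \<alpha>(1)] pos
      by (intro integral_eq_nn_integral) auto
    then show ?thesis using rl_kernel_convolution[of \<alpha> "1 - \<alpha>" t] \<alpha> t by (simp add: rl_kernel_def)
  qed
  have "AE t in lborel. t \<in> {0..1} \<longrightarrow> f t = rl_int \<alpha> \<phi> t"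
    using AE_lborel_singleton[of 0] by eventually_elim (auto simp: f_def rl)
  with marchaud_trunc_rl_int_tendsto_aux[OF \<alpha> \<phi>, of f]
  have lim: "((\<lambda>\<epsilon>. L1_dist 0 1 (marchaud_trunc \<alpha> \<epsilon> f) (\<lambda>t. c * \<phi> t)) \<longlongrightarrow> 0) (at_right 0)"
    by (simp add: f_def c_def)
  have mt: "marchaud_trunc \<alpha> \<epsilon> f t = \<phi> t" if t: "0 < \<epsilon>" "\<epsilon> < t" "t \<le> 1" for \<epsilon> t
  proof -
    have "(LINT r|lborel. marchaud_tail \<alpha> \<epsilon> (t - r) * f r) = (LINT h|lborel. marchaud_tail \<alpha> \<epsilon> h * f (t - h))"
      using integral_reflect_at[of "\<lambda>r. marchaud_tail \<alpha> \<epsilon> (t - r) * f r" t] by simp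
    also have "\<dots> = (LINT h|lborel. indicator {\<epsilon>..t} h * (\<alpha> * h powr (- 1 - \<alpha>)))"
      using AE_lborel_singleton[of \<epsilon>] t
      by (intro integral_cong_AE)
        (auto elim!: eventually_mono simp: marchaud_tail_def f_def split: split_indicator)
    also have "\<dots> = \<epsilon> powr (- \<alpha>) - t powr (- \<alpha>)"
      using t \<alpha> by (intro powr_tail_integral) auto
    finally show ?thesis using t by (simp add: marchaud_trunc_def f_def \<phi>_def rl_kernel_def)
  qed
  define I where "I = (\<integral>\<^sup>+t\<in>{1/2..1}. ennreal (\<bar>1 - c\<bar> * \<bar>\<phi> t\<bar>) \<partial>lborel)"
  have "I \<le> L1_dist 0 1 (marchaud_trunc \<alpha> \<epsilon> f) (\<lambda>t. c * \<phi> t)" if "0 < \<epsilon>" "\<epsilon> < 1/2" for \<epsilon>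
    unfolding I_def L1_dist_def using mt that
    by (intro nn_integral_mono) (auto split: split_indicator simp flip: abs_mult simp: left_diff_distrib)
  then have "I \<le> 0"
    by (intro tendsto_lowerbound[OF lim])
       (auto simp: eventually_at_right[of "0::real" 1] intro!: exI[of _ "1/2"])
  then have "AE t::real in lborel. t \<in> {1/2..1} \<longrightarrow> c = 1"
  proof -
    have "I = 0" using \<open>I \<le> 0\<close> by simp
    then have "AE t in lborel. ennreal (\<bar>1 - c\<bar> * \<bar>\<phi> t\<bar>) * indicator {1/2..1} t = 0"
      unfolding I_def by (subst (asm) nn_integral_0_iff_AE) auto
    then show ?thesis
    proof eventually_elim
      case (elim t)
      have "\<phi> t \<noteq> 0" if "t \<in> {1/2..1}"
        using that \<alpha> less_imp_neq[OF Gamma_real_pos[of "1 - \<alpha>"]] by (auto simp: \<phi>_def rl_kernel_def)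
      then show ?case using elim by auto
    qed
  qed
  moreover have "emeasure lborel {1/2..1::real} \<noteq> 0" by simp
  ultimately have "c = 1"
  proof -
    have "\<not> (AE t in lborel. t \<notin> {1/2..1::real})"
      by (subst AE_iff_measurable[of "{1/2..1::real}"]) auto
    moreover have "AE t in lborel. t \<notin> {1/2..1::real}" if "c \<noteq> 1"
      using \<open>AE t::real in lborel. t \<in> {1/2..1} \<longrightarrow> c = 1\<close> by (rule eventually_mono) (use that in blast)
    ultimately show ?thesis by blast
  qed
  then show ?thesis by (simp add: c_def)
qed

theorem marchaud_trunc_rl_int_tendsto:
  assumes \<alpha>: "0 < \<alpha>" "\<alpha> < 1" and \<phi>: "L1_on a b \<phi>"
    and f: "f \<in> borel_measurable borel" "\<And>t. t < a \<Longrightarrow> f t = 0"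
      "AE t in lborel. t \<in> {a..b} \<longrightarrow> f t = rl_int \<alpha> \<phi> t"
  shows "((\<lambda>\<epsilon>. L1_dist a b (marchaud_trunc \<alpha> \<epsilon> f) \<phi>) \<longlongrightarrow> 0) (at_right 0)"
  using marchaud_trunc_rl_int_tendsto_aux[OF assms] marchaud_mollifier_mass[OF \<alpha>] by simp

lemma L1_on_rl_int_integrable:
  assumes "0 < \<alpha>" "L1_on a b u"
  shows "AE t in lborel. t \<le> c \<longrightarrow> integrable lborel (\<lambda>r. rl_kernel \<alpha> (t - r) * u r)"
  by (rule rl_int_integrable_AE[OF assms(1), of u a c]) (use L1_onD[OF assms(2)] in auto)

lemma rl_int_unique:
  assumes "0 < \<alpha>" "\<alpha> < 1" "L1_on a b \<phi>" "L1_on a b \<psi>"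
    and "AE t in lborel. t \<in> {a..b} \<longrightarrow> rl_int \<alpha> \<phi> t = rl_int \<alpha> \<psi> t"
  shows "AE t in lborel. t \<in> {a..b} \<longrightarrow> \<phi> t = \<psi> t"
proof -
  note [measurable] = L1_onD(2)[OF assms(3)] L1_onD(2)[OF assms(4)]
  have left: "rl_int \<alpha> \<phi> t = 0" if "t < a" for t
    using that L1_onD(3)[OF assms(3)] by (intro rl_int_left_zero[of a]) auto
  show ?thesis
    by (rule L1_dist_limit_unique[where F="\<lambda>\<epsilon>. marchaud_trunc \<alpha> \<epsilon> (rl_int \<alpha> \<phi>)"])
       (auto intro!: marchaud_trunc_rl_int_tendsto assms simp: left)
qed

section \<open>Finite fractional energy\<close>

text \<open>The inner integral runs over all \<open>h > 0\<close>. For \<open>f\<close> that vanishes left of \<open>a\<close> it therefore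
  also contains \<open>\<bar>f t\<bar> / (s * (t - a) powr s)\<close>, the contribution of the boundary.\<close>

definition frac_energy :: "real \<Rightarrow> real \<Rightarrow> real \<Rightarrow> (real \<Rightarrow> real) \<Rightarrow> ennreal" where
  "frac_energy s a b f =
     (\<integral>\<^sup>+t\<in>{a..b}. (\<integral>\<^sup>+h\<in>{0<..}. ennreal (\<bar>f t - f (t - h)\<bar> * h powr (- 1 - s)) \<partial>lborel) \<partial>lborel)"

definition marchaud :: "real \<Rightarrow> (real \<Rightarrow> real) \<Rightarrow> real \<Rightarrow> real" where
  "marchaud s f t = s / Gamma (1 - s) * (LINT h:{0<..}|lborel. (f t - f (t - h)) * h powr (- 1 - s))"

lemma marchaud_measurable [measurable]:
  assumes [measurable]: "f \<in> borel_measurable borel"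
  shows "marchaud s f \<in> borel_measurable borel"
  unfolding marchaud_def set_lebesgue_integral_def by measurable

lemma marchaud_trunc_eq:
  assumes s: "0 < s" "0 < \<epsilon>" and f: "integrable lborel f"
  shows "marchaud_trunc s \<epsilon> f t
    = s / Gamma (1 - s) * (LINT h:{\<epsilon><..}|lborel. (f t - f (t - h)) * h powr (- 1 - s))"
    and "set_integrable lborel {\<epsilon><..} (\<lambda>h. (f t - f (t - h)) * h powr (- 1 - s))"
proof -
  have [measurable]: "f \<in> borel_measurable borel" using f by (auto dest: borel_measurable_integrable)
  have ft: "integrable lborel (\<lambda>h. f (t - h))" using f integrable_reflect_at[of f t] by simp
  have i: "integrable lborel (\<lambda>h. marchaud_tail s \<epsilon> h * f (t - h))"
    by (rule marchaud_tail_mult_integrable[OF s ft]) measurable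
  have e: "indicator {\<epsilon><..} h *\<^sub>R ((f t - f (t - h)) * h powr (- 1 - s))
     = (marchaud_tail s \<epsilon> h * f t - marchaud_tail s \<epsilon> h * f (t - h)) / s" for h
    using s by (simp add: marchaud_tail_def field_simps split: split_indicator)
  show "set_integrable lborel {\<epsilon><..} (\<lambda>h. (f t - f (t - h)) * h powr (- 1 - s))"
    unfolding set_integrable_def e using marchaud_tail_total(1)[OF s] i by auto
  have "(LINT h:{\<epsilon><..}|lborel. (f t - f (t - h)) * h powr (- 1 - s))
     = (\<epsilon> powr (- s) * f t - (LINT h|lborel. marchaud_tail s \<epsilon> h * f (t - h))) / s"
    unfolding set_lebesgue_integral_def e using marchaud_tail_total[OF s] i by simp
  also have "(LINT h|lborel. marchaud_tail s \<epsilon> h * f (t - h)) = (LINT r|lborel. marchaud_tail s \<epsilon> (t - r) * f r)"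
    using integral_reflect_at[of "\<lambda>r. marchaud_tail s \<epsilon> (t - r) * f r" t] by simp
  finally show "marchaud_trunc s \<epsilon> f t
    = s / Gamma (1 - s) * (LINT h:{\<epsilon><..}|lborel. (f t - f (t - h)) * h powr (- 1 - s))"
    using s by (simp add: marchaud_trunc_def)
qed

lemma marchaud_bound:
  assumes [measurable]: "f \<in> borel_measurable borel" and s: "0 < s" "s < 1"
  shows "ennreal \<bar>marchaud s f t\<bar>
    \<le> ennreal (s / Gamma (1 - s)) * (\<integral>\<^sup>+h\<in>{0<..}. ennreal (\<bar>f t - f (t - h)\<bar> * h powr (- 1 - s)) \<partial>lborel)"
proof (cases "set_integrable lborel {0<..} (\<lambda>h. (f t - f (t - h)) * h powr (- 1 - s))")
  case True
  have le: "ennreal \<bar>LINT h:{0<..}|lborel. (f t - f (t - h)) * h powr (- 1 - s)\<bar>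
    \<le> (\<integral>\<^sup>+h\<in>{0<..}. ennreal (\<bar>f t - f (t - h)\<bar> * h powr (- 1 - s)) \<partial>lborel)"
    using integral_norm_bound_ennreal[OF True[unfolded set_integrable_def]]
    unfolding set_lebesgue_integral_def
    by (auto elim!: order_trans intro!: nn_integral_mono split: split_indicator simp: abs_mult)
  show ?thesis
  proof -
    have "0 \<le> s / Gamma (1 - s)" using s Gamma_real_pos[of "1 - s"] by simp
    then have "ennreal \<bar>marchaud s f t\<bar>
       = ennreal (s / Gamma (1 - s)) * ennreal \<bar>LINT h:{0<..}|lborel. (f t - f (t - h)) * h powr (- 1 - s)\<bar>"
      unfolding marchaud_def abs_mult by (simp only: ennreal_mult' abs_of_nonneg)
    with le show ?thesis by (simp only: mult_left_mono zero_le)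
  qed
next
  case False
  then have "marchaud s f t = 0"
    unfolding marchaud_def set_integrable_def set_lebesgue_integral_def
    by (simp add: not_integrable_integral_eq)
  then show ?thesis by simp
qed

lemma marchaud_L1:
  assumes s: "0 < s" "s < 1" and f: "L1_on a b f" and fin: "frac_energy s a b f < \<infinity>"
  shows "L1_on a b (\<lambda>t. indicator {a..b} t * marchaud s f t)"
    and "(\<integral>\<^sup>+t. ennreal \<bar>indicator {a..b} t * marchaud s f t\<bar> \<partial>lborel)
      \<le> ennreal (s / Gamma (1 - s)) * frac_energy s a b f"
proof -
  note [measurable] = L1_onD(2)[OF f]
  show le: "(\<integral>\<^sup>+t. ennreal \<bar>indicator {a..b} t * marchaud s f t\<bar> \<partial>lborel)
      \<le> ennreal (s / Gamma (1 - s)) * frac_energy s a b f"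
    unfolding frac_energy_def
    by (subst nn_integral_cmult[symmetric])
      (auto intro!: nn_integral_mono marchaud_bound s split: split_indicator)
  show "L1_on a b (\<lambda>t. indicator {a..b} t * marchaud s f t)"
    unfolding L1_on_def using le_less_trans[OF le] fin
    by (auto simp: integrable_iff_bounded ennreal_mult_less_top)
qed

text \<open>The error of the truncation is at most the part \<open>h \<le> \<epsilon>\<close> of the energy, which tends to \<open>0\<close>
  by dominated convergence on the plane.\<close>

lemma marchaud_trunc_tendsto:
  assumes s: "0 < s" "s < 1" and f: "L1_on a b f" and fin: "frac_energy s a b f < \<infinity>"
  shows "((\<lambda>\<epsilon>. L1_dist a b (marchaud_trunc s \<epsilon> f) (marchaud s f)) \<longlongrightarrow> 0) (at_right 0)"
proof -
  note [measurable] = L1_onD(2)[OF f]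
  define F where "F = (\<lambda>(t, h). indicator {a..b} t * (indicator {0<..} h * (\<bar>f t - f (t - h)\<bar> * h powr (- 1 - s))) :: real)"
  have [measurable]: "F \<in> borel_measurable (borel \<Otimes>\<^sub>M borel)" unfolding F_def by measurable
  have "(\<integral>\<^sup>+z. ennreal (norm (F z)) \<partial>(lborel \<Otimes>\<^sub>M lborel)) = frac_energy s a b f"
    unfolding frac_energy_def
    by (subst lborel.nn_integral_fst[symmetric])
       (auto simp: F_def nn_integral_multc[symmetric] intro!: nn_integral_cong split: split_indicator)
  then have F: "integrable (lborel \<Otimes>\<^sub>M lborel) F" using fin by (auto simp: integrable_iff_bounded)
  have "((\<lambda>\<epsilon>. \<integral>z. F z * indicator {..\<epsilon>} (snd z) \<partial>(lborel \<Otimes>\<^sub>M lborel)) \<longlongrightarrow> integral\<^sup>L (lborel \<Otimes>\<^sub>M lborel) (\<lambda>z::real \<times> real. 0::real)) (at_right 0)"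
  proof (rule dominated_convergence_within[where w="\<lambda>z. \<bar>F z\<bar>"])
    show "AE z in lborel \<Otimes>\<^sub>M lborel. ((\<lambda>\<epsilon>. F z * indicator {..\<epsilon>} (snd z)) \<longlongrightarrow> 0) (at_right 0)"
    proof (rule AE_I2)
      fix z :: "real \<times> real"
      have "\<forall>\<^sub>F \<epsilon> in at_right 0. F z * indicator {..\<epsilon>} (snd z) = 0"
      proof (cases "0 < snd z")
        case True
        show ?thesis using eventually_at_right_real[OF True]
          by (rule eventually_mono) (auto split: split_indicator)
      next
        case False then show ?thesis by (auto simp: F_def split: prod.split)
      qed
      then show "((\<lambda>\<epsilon>. F z * indicator {..\<epsilon>} (snd z)) \<longlongrightarrow> 0) (at_right 0)"
        by (rule tendsto_eventually)
    qed
    show "AE z in lborel \<Otimes>\<^sub>M lborel. \<bar>F z * indicator {..h} (snd z)\<bar> \<le> \<bar>F z\<bar>" for h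
      by (auto split: split_indicator)
    show "(\<lambda>z. F z * indicator {..h} (snd z)) \<in> borel_measurable (lborel \<Otimes>\<^sub>M lborel)" for h by measurable
  qed (use F in auto)
  then have lim: "((\<lambda>\<epsilon>. ennreal (s / Gamma (1 - s) * (\<integral>z. F z * indicator {..\<epsilon>} (snd z) \<partial>(lborel \<Otimes>\<^sub>M lborel)))) \<longlongrightarrow> 0) (at_right 0)"
    using tendsto_ennrealI[OF tendsto_mult_left[of _ 0 "at_right 0" "s / Gamma (1 - s)"]] by simp
  have ae: "AE t in lborel. t \<in> {a..b} \<longrightarrow> set_integrable lborel {0<..} (\<lambda>h. (f t - f (t - h)) * h powr (- 1 - s))"
  proof -
    have "AE t in lborel. (\<integral>\<^sup>+h\<in>{0<..}. ennreal (\<bar>f t - f (t - h)\<bar> * h powr (- 1 - s)) \<partial>lborel) * indicator {a..b} t \<noteq> \<infinity>"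
      using fin unfolding frac_energy_def by (intro nn_integral_PInf_AE) auto
    then show ?thesis
    proof eventually_elim
      case (elim t)
      have "(\<integral>\<^sup>+h. ennreal (norm (indicator {0<..} h *\<^sub>R ((f t - f (t - h)) * h powr (- 1 - s)))) \<partial>lborel)
         = (\<integral>\<^sup>+h\<in>{0<..}. ennreal (\<bar>f t - f (t - h)\<bar> * h powr (- 1 - s)) \<partial>lborel)"
        by (intro nn_integral_cong) (auto split: split_indicator simp: abs_mult)
      then show ?case using elim unfolding set_integrable_def
        by (auto simp: integrable_iff_bounded less_top)
    qed
  qed
  have "L1_dist a b (marchaud_trunc s \<epsilon> f) (marchaud s f)
    \<le> ennreal (s / Gamma (1 - s) * (\<integral>z. F z * indicator {..\<epsilon>} (snd z) \<partial>(lborel \<Otimes>\<^sub>M lborel)))" if \<epsilon>: "0 < \<epsilon>" for \<epsilon>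
  proof -
    define c where "c = s / Gamma (1 - s)"
    have c: "0 < c" using s Gamma_real_pos[of "1 - s"] by (simp add: c_def)
    have "L1_dist a b (marchaud_trunc s \<epsilon> f) (marchaud s f)
      \<le> (\<integral>\<^sup>+t. \<integral>\<^sup>+h. ennreal c * ennreal (F (t, h) * indicator {..\<epsilon>} h) \<partial>lborel \<partial>lborel)"
      unfolding L1_dist_def using ae
    proof (intro nn_integral_mono_AE, eventually_elim)
      case (elim t)
      show ?case
      proof (cases "t \<in> {a..b}")
        case True
        let ?g = "\<lambda>h. (f t - f (t - h)) * h powr (- 1 - s)"
        have i0: "set_integrable lborel {0<..} ?g" using elim True by auto
        have i1: "set_integrable lborel {\<epsilon><..} ?g" by (rule set_integrable_subset[OF i0]) (use \<epsilon> in auto)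
        have i2: "set_integrable lborel {0<..\<epsilon>} ?g" by (rule set_integrable_subset[OF i0]) auto
        have "{0<..} = {0<..\<epsilon>} \<union> {\<epsilon><..}" "{0<..\<epsilon>} \<inter> {\<epsilon><..} = {}" using \<epsilon> by auto
        then have "(LINT h:{0<..}|lborel. ?g h) = (LINT h:{0<..\<epsilon>}|lborel. ?g h) + (LINT h:{\<epsilon><..}|lborel. ?g h)"
          using set_integral_Un[OF _ i2 i1] by metis
        then have "marchaud_trunc s \<epsilon> f t - marchaud s f t = - c * (LINT h:{0<..\<epsilon>}|lborel. ?g h)"
          using marchaud_trunc_eq(1)[OF s(1) \<epsilon> L1_onD(1)[OF f], of t]
          by (simp add: marchaud_def c_def algebra_simps)
        then have "ennreal \<bar>marchaud_trunc s \<epsilon> f t - marchaud s f t\<bar>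
           = ennreal c * ennreal \<bar>LINT h:{0<..\<epsilon>}|lborel. ?g h\<bar>"
          using c by (simp add: abs_mult ennreal_mult')
        also have "\<dots> \<le> ennreal c * (\<integral>\<^sup>+h. ennreal (norm (indicator {0<..\<epsilon>} h *\<^sub>R ?g h)) \<partial>lborel)"
          unfolding set_lebesgue_integral_def
          using integral_norm_bound_ennreal[OF i2[unfolded set_integrable_def]] by (intro mult_left_mono) auto
        also have "\<dots> = (\<integral>\<^sup>+h. ennreal c * ennreal (F (t, h) * indicator {..\<epsilon>} h) \<partial>lborel)"
          using True by (subst nn_integral_cmult[symmetric])
            (auto intro!: nn_integral_cong simp: F_def abs_mult split: split_indicator)
        finally show ?thesis using True by simp
      qed simp
    qed
    also have "\<dots> = (\<integral>\<^sup>+z. ennreal c * ennreal (F z * indicator {..\<epsilon>} (snd z)) \<partial>(lborel \<Otimes>\<^sub>M lborel))"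
      by (subst lborel.nn_integral_fst[symmetric]) auto
    also have "\<dots> = ennreal c * (\<integral>\<^sup>+z. ennreal (F z * indicator {..\<epsilon>} (snd z)) \<partial>(lborel \<Otimes>\<^sub>M lborel))"
      by (rule nn_integral_cmult) auto
    also have "\<dots> = ennreal c * ennreal (\<integral>z. F z * indicator {..\<epsilon>} (snd z) \<partial>(lborel \<Otimes>\<^sub>M lborel))"
    proof (subst nn_integral_eq_integral)
      show "integrable (lborel \<Otimes>\<^sub>M lborel) (\<lambda>z. F z * indicator {..\<epsilon>} (snd z))"
        by (rule Bochner_Integration.integrable_bound[OF F]) (auto split: split_indicator)
      show "AE z in lborel \<Otimes>\<^sub>M lborel. 0 \<le> F z * indicator {..\<epsilon>} (snd z)"
        by (auto simp: F_def split: split_indicator)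
    qed simp
    also have "\<dots> = ennreal (c * (\<integral>z. F z * indicator {..\<epsilon>} (snd z) \<partial>(lborel \<Otimes>\<^sub>M lborel)))"
      using c by (simp add: ennreal_mult')
    finally show ?thesis unfolding c_def .
  qed
  then show ?thesis
    by (intro tendsto_sandwich[OF _ _ tendsto_const lim]) (auto simp: eventually_at_filter)
qed

text \<open>The truncated derivatives converge in \<open>L\<^sup>1\<close> to Marchaud's derivative, and fractional
  integration is continuous on \<open>L\<^sup>1\<close>. The fractional integrals of the truncated derivatives
  are also the convolutions of \<open>f\<close> with the approximate identity, which converge to \<open>f\<close>.\<close>

theorem rl_int_marchaud:
  assumes s: "0 < s" "s < 1" and f: "L1_on a b f" and fin: "frac_energy s a b f < \<infinity>"
  shows "AE t in lborel. t \<in> {a..b} \<longrightarrow> f t = rl_int s (\<lambda>t. indicator {a..b} t * marchaud s f t) t"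
proof -
  note f' = L1_onD[OF f]
  note [measurable] = f'(2)
  define u where "u t = indicator {a..b} t * marchaud s f t" for t
  have u: "L1_on a b u" unfolding u_def by (rule marchaud_L1[OF assms])
  note u' = L1_onD[OF u]
  note [measurable] = u'(2)
  define C where "C = ennreal (rl_kernel (s + 1) (b - a))"
  define v where "v \<epsilon> t = indicator {a..b} t * marchaud_trunc s \<epsilon> f t" for \<epsilon> t
  have [measurable]: "v \<epsilon> \<in> borel_measurable borel" for \<epsilon> unfolding v_def by measurable
  have trunc_left: "marchaud_trunc s \<epsilon> f t = 0" if "t < a" "0 < \<epsilon>" for t \<epsilon>
  proof -
    have z: "(\<lambda>r. marchaud_tail s \<epsilon> (t - r) * f r) = (\<lambda>_. 0)"
      using f'(3) that by (auto simp: marchaud_tail_def fun_eq_iff)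
    show ?thesis unfolding marchaud_trunc_def z using f'(3) that by simp
  qed
  have lim: "((\<lambda>\<epsilon>. L1_dist a b (marchaud_trunc s \<epsilon> f) (marchaud s f)) \<longlongrightarrow> 0) (at_right 0)"
    by (rule marchaud_trunc_tendsto[OF assms])
  have dist_vu: "(\<integral>\<^sup>+t. ennreal \<bar>v \<epsilon> t - u t\<bar> \<partial>lborel) = L1_dist a b (marchaud_trunc s \<epsilon> f) (marchaud s f)" for \<epsilon>
    unfolding L1_dist_def by (intro nn_integral_cong) (auto simp: v_def u_def split: split_indicator)
  have lim0: "((\<lambda>\<epsilon>. C * L1_dist a b (marchaud_trunc s \<epsilon> f) (marchaud s f)) \<longlongrightarrow> 0) (at_right 0)"
    using ennreal_tendsto_cmult[OF _ lim, of C] by (simp add: C_def)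
  have lim1: "((\<lambda>\<epsilon>. \<integral>\<^sup>+t. ennreal \<bar>(LINT x|lborel. marchaud_mollifier s x * f (t - \<epsilon> * x)) - f t\<bar> \<partial>lborel) \<longlongrightarrow> 0) (at_right 0)"
    using approximate_identity[OF marchaud_mollifier_integrable[OF s] f'(1)] marchaud_mollifier_mass[OF s] by simp
  have le: "L1_dist a b f (rl_int s u)
      \<le> (\<integral>\<^sup>+t. ennreal \<bar>(LINT x|lborel. marchaud_mollifier s x * f (t - \<epsilon> * x)) - f t\<bar> \<partial>lborel)
        + C * L1_dist a b (marchaud_trunc s \<epsilon> f) (marchaud s f)"
    if \<epsilon>: "0 < \<epsilon>" and fin\<epsilon>: "L1_dist a b (marchaud_trunc s \<epsilon> f) (marchaud s f) < 1" for \<epsilon>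
  proof -
    have "(\<integral>\<^sup>+t. ennreal \<bar>v \<epsilon> t - u t\<bar> \<partial>lborel) < top"
      unfolding dist_vu using fin\<epsilon> by (auto elim: order.strict_trans)
    then have vu: "integrable lborel (\<lambda>t. v \<epsilon> t - u t)" by (auto simp: integrable_iff_bounded)
    have vu0: "v \<epsilon> r - u r = 0" if "r < a" for r using that by (simp add: v_def u_def)
    have v: "L1_on a b (v \<epsilon>)"
    proof -
      have "integrable lborel (v \<epsilon>)" using Bochner_Integration.integrable_add[OF vu u'(1)] by simp
      then show ?thesis by (simp add: L1_on_def) (simp add: v_def)
    qed
    have "AE t in lborel. t \<in> {a..b} \<longrightarrow> rl_int s (v \<epsilon>) t = (LINT x|lborel. marchaud_mollifier s x * f (t - \<epsilon> * x))"
      using L1_on_rl_int_integrable[OF s(1) f, of b]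
    proof eventually_elim
      case (elim t)
      have "rl_int s (v \<epsilon>) t = rl_int s (marchaud_trunc s \<epsilon> f) t" if "t \<le> b"
        unfolding rl_int_def using that trunc_left[OF _ \<epsilon>]
        by (intro Bochner_Integration.integral_cong refl) (auto simp: v_def rl_kernel_def split: split_indicator)
      then show ?case using elim marchaud_trunc_rl_int(2)[OF s \<epsilon> f'(2), of t] by auto
    qed
    then have "L1_dist a b f (rl_int s (v \<epsilon>))
       = L1_dist a b f (\<lambda>t. LINT x|lborel. marchaud_mollifier s x * f (t - \<epsilon> * x))"
      by (intro L1_dist_cong_AE) auto
    also have "\<dots> \<le> (\<integral>\<^sup>+t. ennreal \<bar>(LINT x|lborel. marchaud_mollifier s x * f (t - \<epsilon> * x)) - f t\<bar> \<partial>lborel)"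
      unfolding L1_dist_def by (intro nn_integral_mono) (auto simp: abs_minus_commute split: split_indicator)
    finally have 1: "L1_dist a b f (rl_int s (v \<epsilon>)) \<le> \<dots>" .
    have "AE t in lborel. t \<in> {a..b} \<longrightarrow> rl_int s (v \<epsilon>) t - rl_int s u t = rl_int s (\<lambda>t. v \<epsilon> t - u t) t"
      using L1_on_rl_int_integrable[OF s(1) v, of b] L1_on_rl_int_integrable[OF s(1) u, of b]
      by eventually_elim (auto simp: rl_int_def right_diff_distrib)
    then have "L1_dist a b (rl_int s (v \<epsilon>)) (rl_int s u) \<le> (\<integral>\<^sup>+t\<in>{..b}. ennreal \<bar>rl_int s (\<lambda>t. v \<epsilon> t - u t) t\<bar> \<partial>lborel)"
      unfolding L1_dist_def by (intro nn_integral_mono_AE) (auto elim!: eventually_mono split: split_indicator)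
    also have "\<dots> \<le> C * (\<integral>\<^sup>+t. ennreal \<bar>v \<epsilon> t - u t\<bar> \<partial>lborel)"
      unfolding C_def by (rule rl_int_L1_bound[OF s(1) vu vu0])
    finally have 2: "L1_dist a b (rl_int s (v \<epsilon>)) (rl_int s u) \<le> C * L1_dist a b (marchaud_trunc s \<epsilon> f) (marchaud s f)"
      unfolding dist_vu .
    have "L1_dist a b f (rl_int s u) \<le> L1_dist a b f (rl_int s (v \<epsilon>)) + L1_dist a b (rl_int s (v \<epsilon>)) (rl_int s u)"
      by (rule L1_dist_triangle) auto
    then show ?thesis using add_mono[OF 1 2] by (rule order_trans)
  qed
  have "L1_dist a b f (rl_int s u) \<le> 0"
  proof (rule tendsto_lowerbound)
    show "((\<lambda>\<epsilon>. (\<integral>\<^sup>+t. ennreal \<bar>(LINT x|lborel. marchaud_mollifier s x * f (t - \<epsilon> * x)) - f t\<bar> \<partial>lborel)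
        + C * L1_dist a b (marchaud_trunc s \<epsilon> f) (marchaud s f)) \<longlongrightarrow> 0) (at_right 0)"
      using tendsto_add[OF lim1 lim0] by simp
    have "\<forall>\<^sub>F \<epsilon> in at_right 0. L1_dist a b (marchaud_trunc s \<epsilon> f) (marchaud s f) < 1"
      using order_tendstoD(2)[OF lim, of 1] by simp
    moreover have "\<forall>\<^sub>F \<epsilon>::real in at_right 0. 0 < \<epsilon>" by (simp add: eventually_at_filter)
    ultimately show "\<forall>\<^sub>F \<epsilon> in at_right 0. L1_dist a b f (rl_int s u)
       \<le> (\<integral>\<^sup>+t. ennreal \<bar>(LINT x|lborel. marchaud_mollifier s x * f (t - \<epsilon> * x)) - f t\<bar> \<partial>lborel)
        + C * L1_dist a b (marchaud_trunc s \<epsilon> f) (marchaud s f)"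
      by eventually_elim (rule le)
  qed simp
  then show ?thesis unfolding u_def[symmetric]
    by (intro L1_dist_eq_0D) (auto simp flip: u_def)
qed

text \<open>The energy density at a point whose increments are Hoelder of order \<open>\<gamma>\<close> up to the distance
  \<open>L\<close> and do not grow any further beyond it.\<close>

lemma min_powr_integral:
  fixes s \<gamma> L :: real
  assumes "0 < s" "s < \<gamma>" "0 < L"
  shows "(\<integral>\<^sup>+h\<in>{0<..}. ennreal (min h L powr \<gamma> * h powr (- 1 - s)) \<partial>lborel)
    \<le> ennreal (L powr (\<gamma> - s) * (1 / (\<gamma> - s) + 1 / s))"
proof -
  have i1: "((\<lambda>h. h powr (\<gamma> - 1 - s)) has_integral (L powr (\<gamma> - 1 - s + 1) / (\<gamma> - 1 - s + 1))) {0..L}"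
    using assms by (intro has_integral_powr_from_0) auto
  have i2: "((\<lambda>h. h powr (- 1 - s)) has_integral (- (L powr (- 1 - s + 1)) / (- 1 - s + 1))) {L..}"
    using assms by (intro has_integral_powr_to_inf) auto
  have "ennreal (min h L powr \<gamma> * h powr (- 1 - s)) * indicator {0<..} h
    \<le> ennreal (indicator {0..L} h * h powr (\<gamma> - 1 - s)) + ennreal (L powr \<gamma>) * ennreal (indicator {L..} h * h powr (- 1 - s))" for h
  proof (cases "0 < h \<and> h \<le> L")
    case True
    then have "min h L powr \<gamma> * h powr (- 1 - s) = h powr (\<gamma> - 1 - s)"
      using powr_add[of h \<gamma> "- 1 - s"] by (simp add: min_def algebra_simps)
    then show ?thesis using True by (simp add: add_increasing2)
  next
    case False
    then show ?thesis by (cases "0 < h") (auto simp: min_def ennreal_mult')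
  qed
  then have "(\<integral>\<^sup>+h\<in>{0<..}. ennreal (min h L powr \<gamma> * h powr (- 1 - s)) \<partial>lborel)
    \<le> (\<integral>\<^sup>+h. ennreal (indicator {0..L} h * h powr (\<gamma> - 1 - s)) + ennreal (L powr \<gamma>) * ennreal (indicator {L..} h * h powr (- 1 - s)) \<partial>lborel)"
    by (rule nn_integral_mono)
  also have "\<dots> = ennreal (L powr (\<gamma> - 1 - s + 1) / (\<gamma> - 1 - s + 1)) + ennreal (L powr \<gamma>) * ennreal (- (L powr (- 1 - s + 1)) / (- 1 - s + 1))"
    by (subst nn_integral_add, measurable, subst nn_integral_cmult, measurable)
      (simp only: nn_integral_has_integral_lebesgue[OF powr_ge_zero i1] nn_integral_has_integral_lebesgue[OF powr_ge_zero i2])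
  also have "\<dots> = ennreal (L powr (\<gamma> - s) / (\<gamma> - s) + L powr \<gamma> * (L powr (- s) / s))"
    using assms by (simp add: ennreal_mult' ennreal_plus flip: ennreal_mult)
  also have "L powr (\<gamma> - s) / (\<gamma> - s) + L powr \<gamma> * (L powr (- s) / s) = L powr (\<gamma> - s) * (1 / (\<gamma> - s) + 1 / s)"
    using powr_add[of L \<gamma> "- s"] by (simp add: distrib_left)
  finally show ?thesis .
qed

text \<open>The kernel is decreasing on the positive axis and vanishes on the negative one. So the
  absolute value is \<open>rl_kernel \<sigma> (x - h) - rl_kernel \<sigma> x\<close>, plus twice the kernel on \<open>{..h}\<close>,
  and the first two terms have a nonpositive integral over \<open>{..M}\<close>.\<close>

lemma rl_kernel_shift_L1:
  assumes \<sigma>: "0 < \<sigma>" "\<sigma> < 1" and h: "0 < h"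
  shows "(\<integral>\<^sup>+x\<in>{..M}. ennreal \<bar>rl_kernel \<sigma> x - rl_kernel \<sigma> (x - h)\<bar> \<partial>lborel)
    \<le> ennreal (2 * rl_kernel (\<sigma> + 1) (min h M))"
proof -
  have i: "integrable lborel (\<lambda>x. rl_kernel \<sigma> x * indicator {..c} x)"
    and e: "(LINT x|lborel. rl_kernel \<sigma> x * indicator {..c} x) = rl_kernel (\<sigma> + 1) c" for c
  proof -
    have eq: "(\<integral>\<^sup>+x. ennreal (rl_kernel \<sigma> x * indicator {..c} x) \<partial>lborel) = ennreal (rl_kernel (\<sigma> + 1) c)"
      unfolding rl_kernel_mass[OF \<sigma>(1), symmetric] by (intro nn_integral_cong) (auto split: split_indicator)
    then show "integrable lborel (\<lambda>x. rl_kernel \<sigma> x * indicator {..c} x)"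
      using rl_kernel_nonneg[OF \<sigma>(1)] by (auto simp: integrable_iff_bounded abs_mult)
    show "(LINT x|lborel. rl_kernel \<sigma> x * indicator {..c} x) = rl_kernel (\<sigma> + 1) c"
      using eq rl_kernel_nonneg[of "\<sigma> + 1"] rl_kernel_nonneg[OF \<sigma>(1)] \<sigma>
      by (subst integral_eq_nn_integral) auto
  qed
  define g where "g x = rl_kernel \<sigma> (x - h) * indicator {..M - h} (x - h)
     - rl_kernel \<sigma> x * indicator {..M} x + 2 * (rl_kernel \<sigma> x * indicator {..min h M} x)" for x
  have ig: "integrable lborel g"
    unfolding g_def using i integrable_translate[of "\<lambda>x. rl_kernel \<sigma> x * indicator {..M - h} x" h] by auto
  have "(LINT x|lborel. g x) = rl_kernel (\<sigma> + 1) (M - h) - rl_kernel (\<sigma> + 1) M + 2 * rl_kernel (\<sigma> + 1) (min h M)"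
    unfolding g_def
    using i e integrable_translate[of "\<lambda>x. rl_kernel \<sigma> x * indicator {..M - h} x" h]
      integral_translate[of "\<lambda>x. rl_kernel \<sigma> x * indicator {..M - h} x" h] by simp
  then have le: "(LINT x|lborel. g x) \<le> 2 * rl_kernel (\<sigma> + 1) (min h M)"
    using rl_kernel_mono_mass[OF \<sigma>(1), of "M - h" M] h by simp
  have abs_eq: "\<bar>rl_kernel \<sigma> x - rl_kernel \<sigma> (x - h)\<bar> * indicator {..M} x = g x" for x
  proof -
    have "rl_kernel \<sigma> x \<le> rl_kernel \<sigma> (x - h)" if "h < x"
      using that h \<sigma> Gamma_real_pos[OF \<sigma>(1)] unfolding rl_kernel_def
      by (auto intro!: divide_right_mono powr_mono2')
    moreover have "rl_kernel \<sigma> (x - h) = 0" if "x \<le> h" using that by (simp add: rl_kernel_def)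
    ultimately show ?thesis
      using rl_kernel_nonneg[OF \<sigma>(1), of x] by (cases "x \<le> h") (auto simp: g_def split: split_indicator)
  qed
  have g0: "0 \<le> g x" for x unfolding abs_eq[symmetric] by simp
  have "(\<integral>\<^sup>+x\<in>{..M}. ennreal \<bar>rl_kernel \<sigma> x - rl_kernel \<sigma> (x - h)\<bar> \<partial>lborel) = (\<integral>\<^sup>+x. ennreal (g x) \<partial>lborel)"
    unfolding abs_eq[symmetric] by (intro nn_integral_cong) (auto split: split_indicator)
  also have "\<dots> = ennreal (LINT x|lborel. g x)" using g0 by (intro nn_integral_eq_integral ig) auto
  also have "\<dots> \<le> ennreal (2 * rl_kernel (\<sigma> + 1) (min h M))" by (rule ennreal_leI[OF le])
  finally show ?thesis .
qed

lemma rl_int_shift_L1: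
  assumes \<sigma>: "0 < \<sigma>" "\<sigma> < 1" and h: "0 < h" and u: "L1_on a b u" and M: "b - a \<le> M"
  shows "(\<integral>\<^sup>+t\<in>{a..b}. ennreal \<bar>rl_int \<sigma> u t - rl_int \<sigma> u (t - h)\<bar> \<partial>lborel)
    \<le> ennreal (2 * rl_kernel (\<sigma> + 1) (min h M)) * (\<integral>\<^sup>+r. ennreal \<bar>u r\<bar> \<partial>lborel)"
proof -
  note u' = L1_onD[OF u]
  note [measurable] = u'(2)
  have ae1: "AE t in lborel. t \<le> b \<longrightarrow> integrable lborel (\<lambda>r. rl_kernel \<sigma> (t - r) * u r)"
    by (rule L1_on_rl_int_integrable[OF \<sigma>(1) u])
  have "AE t in lborel. t \<le> b \<longrightarrow> integrable lborel (\<lambda>r. rl_kernel \<sigma> (- h + 1 * t - r) * u r)"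
    using AE_borel_affine[of 1 "\<lambda>t. t \<le> b \<longrightarrow> integrable lborel (\<lambda>r. rl_kernel \<sigma> (t - r) * u r)" "-h"] ae1 h
    by (auto elim!: eventually_mono)
  then have ae2: "AE t in lborel. t \<le> b \<longrightarrow> integrable lborel (\<lambda>r. rl_kernel \<sigma> (t - h - r) * u r)"
    by (simp add: algebra_simps)
  have "(\<integral>\<^sup>+t\<in>{a..b}. ennreal \<bar>rl_int \<sigma> u t - rl_int \<sigma> u (t - h)\<bar> \<partial>lborel)
    \<le> (\<integral>\<^sup>+t. \<integral>\<^sup>+r. (ennreal \<bar>rl_kernel \<sigma> (t - r) - rl_kernel \<sigma> (t - r - h)\<bar> * indicator {..M} (t - r)) * ennreal \<bar>u r\<bar> \<partial>lborel \<partial>lborel)"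
    using ae1 ae2
  proof (intro nn_integral_mono_AE, eventually_elim)
    case (elim t)
    show ?case
    proof (cases "t \<in> {a..b}")
      case True
      then have int: "integrable lborel (\<lambda>r. rl_kernel \<sigma> (t - r) * u r)" "integrable lborel (\<lambda>r. rl_kernel \<sigma> (t - h - r) * u r)"
        using elim by auto
      have "rl_int \<sigma> u t - rl_int \<sigma> u (t - h) = (LINT r|lborel. rl_kernel \<sigma> (t - r) * u r - rl_kernel \<sigma> (t - h - r) * u r)"
        unfolding rl_int_def using int by simp
      then have "ennreal \<bar>rl_int \<sigma> u t - rl_int \<sigma> u (t - h)\<bar>
         \<le> (\<integral>\<^sup>+r. ennreal (norm (rl_kernel \<sigma> (t - r) * u r - rl_kernel \<sigma> (t - h - r) * u r)) \<partial>lborel)"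
        using integral_norm_bound_ennreal[OF Bochner_Integration.integrable_diff[OF int]] by simp
      also have "\<dots> = (\<integral>\<^sup>+r. (ennreal \<bar>rl_kernel \<sigma> (t - r) - rl_kernel \<sigma> (t - r - h)\<bar> * indicator {..M} (t - r)) * ennreal \<bar>u r\<bar> \<partial>lborel)"
      proof (intro nn_integral_cong)
        fix r
        have e: "t - h - r = t - r - h" by simp
        show "ennreal (norm (rl_kernel \<sigma> (t - r) * u r - rl_kernel \<sigma> (t - h - r) * u r))
           = (ennreal \<bar>rl_kernel \<sigma> (t - r) - rl_kernel \<sigma> (t - r - h)\<bar> * indicator {..M} (t - r)) * ennreal \<bar>u r\<bar>"
          using True M u'(3)[of r] unfolding e
          by (cases "r < a") (auto simp flip: left_diff_distrib simp: abs_mult ennreal_mult')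
      qed
      finally show ?thesis using True by simp
    qed simp
  qed
  also have "\<dots> = (\<integral>\<^sup>+r. (\<integral>\<^sup>+t. ennreal \<bar>rl_kernel \<sigma> (t - r) - rl_kernel \<sigma> (t - r - h)\<bar> * indicator {..M} (t - r) \<partial>lborel) * ennreal \<bar>u r\<bar> \<partial>lborel)"
    by (subst lborel_pair.Fubini') (auto simp: nn_integral_multc)
  also have "\<dots> = (\<integral>\<^sup>+r. (\<integral>\<^sup>+x\<in>{..M}. ennreal \<bar>rl_kernel \<sigma> x - rl_kernel \<sigma> (x - h)\<bar> \<partial>lborel) * ennreal \<bar>u r\<bar> \<partial>lborel)"
    by (intro nn_integral_cong arg_cong2[where f="(*)"] refl
      nn_integral_translate[of "\<lambda>x. ennreal \<bar>rl_kernel \<sigma> x - rl_kernel \<sigma> (x - h)\<bar> * indicator {..M} x"]) auto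
  also have "\<dots> \<le> ennreal (2 * rl_kernel (\<sigma> + 1) (min h M)) * (\<integral>\<^sup>+r. ennreal \<bar>u r\<bar> \<partial>lborel)"
    by (subst nn_integral_cmult[symmetric]) (auto intro!: nn_integral_mono mult_right_mono rl_kernel_shift_L1 \<sigma> h)
  finally show ?thesis .
qed

text \<open>By the bound on its increments in \<open>L\<^sup>1\<close>, a fractional integral of order \<open>\<sigma>\<close> has the
  modulus of continuity \<open>h powr \<sigma>\<close>, and \<open>h powr (\<sigma> - 1 - s)\<close> is integrable at \<open>0\<close>.\<close>

theorem rl_int_frac_energy:
  assumes s: "0 < s" "s < \<sigma>" "\<sigma> < 1" and u: "L1_on a b u"
  shows "frac_energy s a b (\<lambda>t. indicator {a..b} t * rl_int \<sigma> u t) < \<infinity>"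
proof -
  note u' = L1_onD[OF u]
  note [measurable] = u'(2)
  have \<sigma>: "0 < \<sigma>" "\<sigma> < 1" using s by auto
  define M where "M = max 1 (b - a)"
  have M: "0 < M" "b - a \<le> M" by (auto simp: M_def)
  define f where "f t = indicator {a..b} t * rl_int \<sigma> u t" for t
  have [measurable]: "f \<in> borel_measurable borel" unfolding f_def by measurable
  define N where "N = (\<integral>\<^sup>+r. ennreal \<bar>u r\<bar> \<partial>lborel)"
  have N: "N < \<infinity>" using u'(1) by (simp add: N_def integrable_iff_bounded)
  have "frac_energy s a b f = (\<integral>\<^sup>+t. \<integral>\<^sup>+h. ennreal (\<bar>f t - f (t - h)\<bar> * h powr (- 1 - s)) * indicator {0<..} h * indicator {a..b} t \<partial>lborel \<partial>lborel)"
    unfolding frac_energy_def by (subst nn_integral_multc) auto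
  also have "\<dots> = (\<integral>\<^sup>+h. \<integral>\<^sup>+t. ennreal (\<bar>f t - f (t - h)\<bar> * h powr (- 1 - s)) * indicator {0<..} h * indicator {a..b} t \<partial>lborel \<partial>lborel)"
    by (rule lborel_pair.Fubini') measurable
  also have "\<dots> \<le> (\<integral>\<^sup>+h. ennreal (indicator {0<..} h * (2 * rl_kernel (\<sigma> + 1) (min h M) * h powr (- 1 - s))) * N \<partial>lborel)"
  proof (rule nn_integral_mono)
    fix h :: real
    show "(\<integral>\<^sup>+t. ennreal (\<bar>f t - f (t - h)\<bar> * h powr (- 1 - s)) * indicator {0<..} h * indicator {a..b} t \<partial>lborel)
      \<le> ennreal (indicator {0<..} h * (2 * rl_kernel (\<sigma> + 1) (min h M) * h powr (- 1 - s))) * N"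
    proof (cases "0 < h")
      case True
      have feq: "f t - f (t - h) = rl_int \<sigma> u t - rl_int \<sigma> u (t - h)" if "t \<in> {a..b}" for t
        using that True rl_int_left_zero[of a u "t - h" \<sigma>] u'(3) by (auto simp: f_def split: split_indicator)
      have "(\<integral>\<^sup>+t. ennreal (\<bar>f t - f (t - h)\<bar> * h powr (- 1 - s)) * indicator {0<..} h * indicator {a..b} t \<partial>lborel)
        = (\<integral>\<^sup>+t. (ennreal \<bar>rl_int \<sigma> u t - rl_int \<sigma> u (t - h)\<bar> * indicator {a..b} t) * ennreal (h powr (- 1 - s)) \<partial>lborel)"
        using True by (intro nn_integral_cong) (auto simp: feq ennreal_mult' split: split_indicator)
      also have "\<dots> = (\<integral>\<^sup>+t\<in>{a..b}. ennreal \<bar>rl_int \<sigma> u t - rl_int \<sigma> u (t - h)\<bar> \<partial>lborel) * ennreal (h powr (- 1 - s))"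
        by (rule nn_integral_multc) auto
      also have "\<dots> \<le> ennreal (2 * rl_kernel (\<sigma> + 1) (min h M)) * N * ennreal (h powr (- 1 - s))"
        unfolding N_def by (intro mult_right_mono rl_int_shift_L1[OF \<sigma> True u M(2)]) auto
      also have "\<dots> = ennreal (indicator {0<..} h * (2 * rl_kernel (\<sigma> + 1) (min h M) * h powr (- 1 - s))) * N"
        using True rl_kernel_nonneg[of "\<sigma> + 1" "min h M"] \<sigma> by (simp add: ennreal_mult' mult_ac)
      finally show ?thesis .
    qed simp
  qed
  also have "\<dots> = (\<integral>\<^sup>+h. ennreal (indicator {0<..} h * (2 * rl_kernel (\<sigma> + 1) (min h M) * h powr (- 1 - s))) \<partial>lborel) * N"
    by (rule nn_integral_multc) measurable
  also have "\<dots> < \<infinity>"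
  proof -
    define c where "c = 2 / Gamma (\<sigma> + 1)"
    have c: "0 \<le> c" using \<sigma> Gamma_real_pos[of "\<sigma> + 1"] by (simp add: c_def)
    have "(\<integral>\<^sup>+h. ennreal (indicator {0<..} h * (2 * rl_kernel (\<sigma> + 1) (min h M) * h powr (- 1 - s))) \<partial>lborel)
      = (\<integral>\<^sup>+h. ennreal c * (ennreal (min h M powr \<sigma> * h powr (- 1 - s)) * indicator {0<..} h) \<partial>lborel)"
      using M(1) c by (intro nn_integral_cong)
        (auto simp: rl_kernel_def c_def ennreal_mult'[symmetric] split: split_indicator)
    also have "\<dots> = ennreal c * (\<integral>\<^sup>+h\<in>{0<..}. ennreal (min h M powr \<sigma> * h powr (- 1 - s)) \<partial>lborel)"
      by (rule nn_integral_cmult) measurable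
    also have "\<dots> < \<infinity>"
      using le_less_trans[OF min_powr_integral[OF s(1,2) M(1)]] by (simp add: ennreal_mult_less_top)
    finally show ?thesis using N by (simp add: ennreal_mult_less_top)
  qed
  finally show ?thesis unfolding f_def .
qed

section \<open>Fractional integration by parts\<close>

definition rl_int_right :: "real \<Rightarrow> (real \<Rightarrow> real) \<Rightarrow> real \<Rightarrow> real" where
  "rl_int_right \<alpha> u t = rl_int \<alpha> (\<lambda>x. u (- x)) (- t)"

lemma rl_int_right_eq: "rl_int_right \<alpha> u t = (LINT r|lborel. rl_kernel \<alpha> (r - t) * u r)"
  unfolding rl_int_right_def rl_int_def
  using integral_reflect_at[of "\<lambda>r. rl_kernel \<alpha> (r - t) * u r" 0] by (simp add: minus_diff_commute)

lemma rl_int_right_measurable [measurable]: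
  assumes [measurable]: "u \<in> borel_measurable borel"
  shows "rl_int_right \<alpha> u \<in> borel_measurable borel"
  unfolding rl_int_right_def by measurable

lemma rl_int_right_shift: "rl_int_right \<alpha> (\<lambda>r. u (r + h)) t = rl_int_right \<alpha> u (t + h)"
  unfolding rl_int_right_eq
  using integral_translate[of "\<lambda>r. rl_kernel \<alpha> (r - t) * u (r + h)" h] by (simp add: algebra_simps)

lemma rl_int_right_zero:
  assumes "\<And>r. b < r \<Longrightarrow> u r = 0" "b \<le> t"
  shows "rl_int_right \<alpha> u t = 0"
  unfolding rl_int_right_def using assms by (intro rl_int_left_zero[of "-b"]) auto

lemma rl_int_semigroup:
  assumes "0 < \<alpha>" "0 < \<beta>" "u \<in> borel_measurable borel"
    and "integrable lborel (\<lambda>r. rl_kernel (\<alpha> + \<beta>) (t - r) * u r)"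
  shows "rl_int \<alpha> (rl_int \<beta> u) t = rl_int (\<alpha> + \<beta>) u t"
  unfolding rl_int_def
  by (rule convolution_assoc(1))
     (use assms in \<open>auto simp: rl_kernel_convolution rl_kernel_nonneg\<close>)

lemma rl_int_duality:
  assumes \<alpha>: "0 < \<alpha>" and [measurable]: "\<phi> \<in> borel_measurable borel" "g \<in> borel_measurable borel"
    and fin: "(\<integral>\<^sup>+p. ennreal \<bar>\<phi> p\<bar> * (\<integral>\<^sup>+r. ennreal (rl_kernel \<alpha> (r - p)) * ennreal \<bar>g r\<bar> \<partial>lborel) \<partial>lborel) < \<infinity>"
  shows "(LINT r|lborel. rl_int \<alpha> \<phi> r * g r) = (LINT p|lborel. \<phi> p * rl_int_right \<alpha> g p)"
    and "integrable lborel (\<lambda>r. rl_int \<alpha> \<phi> r * g r)"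
    and "integrable lborel (\<lambda>p. \<phi> p * rl_int_right \<alpha> g p)"
proof -
  define F where "F p r = \<phi> p * (rl_kernel \<alpha> (r - p) * g r)" for p r
  have [measurable]: "case_prod F \<in> borel_measurable (borel \<Otimes>\<^sub>M borel)" unfolding F_def by measurable
  have "(\<integral>\<^sup>+z. ennreal (norm (case_prod F z)) \<partial>(lborel \<Otimes>\<^sub>M lborel))
     = (\<integral>\<^sup>+p. \<integral>\<^sup>+r. ennreal \<bar>\<phi> p\<bar> * (ennreal (rl_kernel \<alpha> (r - p)) * ennreal \<bar>g r\<bar>) \<partial>lborel \<partial>lborel)"
    by (subst lborel.nn_integral_fst[symmetric])
      (auto simp: F_def abs_mult rl_kernel_nonneg[OF \<alpha>] ennreal_mult')
  also have "\<dots> < \<infinity>" using fin by (subst nn_integral_cmult) auto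
  finally have F: "integrable (lborel \<Otimes>\<^sub>M lborel) (case_prod F)" by (auto simp: integrable_iff_bounded)
  have 1: "(LINT p|lborel. F p r) = rl_int \<alpha> \<phi> r * g r" for r
    unfolding rl_int_def F_def by (subst integral_mult_left_zero[symmetric]) (simp add: mult_ac)
  have 2: "(LINT r|lborel. F p r) = \<phi> p * rl_int_right \<alpha> g p" for p
    unfolding rl_int_right_eq F_def by simp
  show "(LINT r|lborel. rl_int \<alpha> \<phi> r * g r) = (LINT p|lborel. \<phi> p * rl_int_right \<alpha> g p)"
    using lborel_pair.Fubini_integral[OF F] by (simp add: 1 2)
  show "integrable lborel (\<lambda>r. rl_int \<alpha> \<phi> r * g r)"
    using lborel_pair.integrable_snd[OF F] by (simp add: 1)
  show "integrable lborel (\<lambda>p. \<phi> p * rl_int_right \<alpha> g p)"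
    using lborel_pair.integrable_fst[OF F] by (simp add: 2)
qed

section \<open>The integral as a limit of difference quotients\<close>

lemma rl_int_right_one:
  "rl_int_right 1 u p = (LINT q|lborel. indicator {p<..} q * u q)"
  unfolding rl_int_right_eq by (intro Bochner_Integration.integral_cong) (auto simp: rl_kernel_def)

lemma rl_kernel_convolution_right:
  assumes "0 < \<alpha>" "0 < \<beta>"
  shows "(\<integral>\<^sup>+r. ennreal (rl_kernel \<alpha> (r - p)) * ennreal (rl_kernel \<beta> (q - r)) \<partial>lborel) = ennreal (rl_kernel (\<alpha> + \<beta>) (q - p))"
proof -
  have "(\<integral>\<^sup>+r. ennreal (rl_kernel \<alpha> (r - p)) * ennreal (rl_kernel \<beta> (q - r)) \<partial>lborel)
    = (\<integral>\<^sup>+x. ennreal (rl_kernel \<beta> (q - p - x) * rl_kernel \<alpha> x) \<partial>lborel)"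
    using nn_integral_translate[of "\<lambda>x. ennreal (rl_kernel \<beta> (q - p - x) * rl_kernel \<alpha> x)" p] assms
    by (simp add: algebra_simps ennreal_mult' rl_kernel_nonneg)
  then show ?thesis using rl_kernel_convolution[OF assms(2,1)] by (simp add: add.commute)
qed

text \<open>Fractional integration by parts moves the order \<open>\<alpha>\<close> to the second factor, where it adds up
  to the order \<open>1\<close>. Everything converges absolutely, because the composition of the two
  kernels is bounded.\<close>

lemma rl_int_product:
  assumes \<alpha>: "0 < \<alpha>" "\<alpha> < 1" and \<phi>: "L1_on a b \<phi>" and \<psi>: "integrable lborel \<psi>"
  shows "(LINT r|lborel. rl_int \<alpha> \<phi> r * rl_int_right (1 - \<alpha>) \<psi> r)
      = (LINT p|lborel. \<phi> p * (LINT q|lborel. indicator {p<..} q * \<psi> q))" (is ?A)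
    and "integrable lborel (\<lambda>r. rl_int \<alpha> \<phi> r * rl_int_right (1 - \<alpha>) \<psi> r)" (is ?B)
    and "integrable lborel (\<lambda>p. \<phi> p * (LINT q|lborel. indicator {p<..} q * \<psi> q))" (is ?C)
proof -
  note \<phi>' = L1_onD[OF \<phi>]
  have [measurable]: "\<phi> \<in> borel_measurable borel" "\<psi> \<in> borel_measurable borel"
    using \<phi>' \<psi> by (auto dest: borel_measurable_integrable)
  define g where "g = rl_int_right (1 - \<alpha>) \<psi>"
  have [measurable]: "g \<in> borel_measurable borel" unfolding g_def by measurable
  define N where "N = (\<integral>\<^sup>+q. ennreal \<bar>\<psi> q\<bar> \<partial>lborel)"
  have N: "N < \<infinity>" using \<psi> by (simp add: N_def integrable_iff_bounded)
  have g_le: "ennreal \<bar>g r\<bar> \<le> (\<integral>\<^sup>+q. ennreal (rl_kernel (1 - \<alpha>) (q - r)) * ennreal \<bar>\<psi> q\<bar> \<partial>lborel)" for r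
  proof (cases "integrable lborel (\<lambda>q. rl_kernel (1 - \<alpha>) (q - r) * \<psi> q)")
    case True
    then show ?thesis unfolding g_def rl_int_right_eq
      using integral_norm_bound_ennreal[OF True] rl_kernel_nonneg[of "1 - \<alpha>"] \<alpha> by (simp add: abs_mult ennreal_mult')
  next
    case False then show ?thesis unfolding g_def rl_int_right_eq by (simp add: not_integrable_integral_eq)
  qed
  have inner: "(\<integral>\<^sup>+r. ennreal (rl_kernel \<alpha> (r - p)) * ennreal \<bar>g r\<bar> \<partial>lborel) \<le> N" for p
  proof -
    have "(\<integral>\<^sup>+r. ennreal (rl_kernel \<alpha> (r - p)) * ennreal \<bar>g r\<bar> \<partial>lborel)
      \<le> (\<integral>\<^sup>+r. \<integral>\<^sup>+q. ennreal (rl_kernel \<alpha> (r - p)) * (ennreal (rl_kernel (1 - \<alpha>) (q - r)) * ennreal \<bar>\<psi> q\<bar>) \<partial>lborel \<partial>lborel)"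
      by (subst nn_integral_cmult) (auto intro!: nn_integral_mono mult_left_mono g_le)
    also have "\<dots> = (\<integral>\<^sup>+q. (\<integral>\<^sup>+r. ennreal (rl_kernel \<alpha> (r - p)) * ennreal (rl_kernel (1 - \<alpha>) (q - r)) \<partial>lborel) * ennreal \<bar>\<psi> q\<bar> \<partial>lborel)"
      by (subst lborel_pair.Fubini') (auto simp: nn_integral_multc[symmetric] mult.assoc)
    also have "\<dots> \<le> N"
    proof -
      have "ennreal (rl_kernel 1 x) * ennreal \<bar>\<psi> q\<bar> \<le> 1 * ennreal \<bar>\<psi> q\<bar>" for x q
        by (intro mult_right_mono) (auto simp: rl_kernel_def)
      then show ?thesis
        unfolding N_def using rl_kernel_convolution_right[of \<alpha> "1 - \<alpha>"] \<alpha> by (intro nn_integral_mono) simp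
    qed
    finally show ?thesis .
  qed
  have fin: "(\<integral>\<^sup>+p. ennreal \<bar>\<phi> p\<bar> * (\<integral>\<^sup>+r. ennreal (rl_kernel \<alpha> (r - p)) * ennreal \<bar>g r\<bar> \<partial>lborel) \<partial>lborel) < \<infinity>"
  proof -
    have "(\<integral>\<^sup>+p. ennreal \<bar>\<phi> p\<bar> * (\<integral>\<^sup>+r. ennreal (rl_kernel \<alpha> (r - p)) * ennreal \<bar>g r\<bar> \<partial>lborel) \<partial>lborel)
      \<le> (\<integral>\<^sup>+p. ennreal \<bar>\<phi> p\<bar> * N \<partial>lborel)"
      by (intro nn_integral_mono mult_left_mono inner) auto
    also have "\<dots> < \<infinity>" using N \<phi>'(1)
      by (simp add: nn_integral_multc integrable_iff_bounded ennreal_mult_less_top)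
    finally show ?thesis .
  qed
  have semi: "rl_int_right \<alpha> g p = (LINT q|lborel. indicator {p<..} q * \<psi> q)" for p
  proof -
    have "integrable lborel (\<lambda>r. \<psi> (- r))" using \<psi> integrable_reflect_at[of \<psi> 0] by simp
    then have "integrable lborel (\<lambda>r. rl_kernel (\<alpha> + (1 - \<alpha>)) (- p - r) * \<psi> (- r))"
      by (rule Bochner_Integration.integrable_bound) (auto simp: rl_kernel_def)
    then have "rl_int \<alpha> (rl_int (1 - \<alpha>) (\<lambda>x. \<psi> (- x))) (- p) = rl_int 1 (\<lambda>x. \<psi> (- x)) (- p)"
      using rl_int_semigroup[of \<alpha> "1 - \<alpha>" "\<lambda>x. \<psi> (- x)" "- p"] \<alpha> by simp
    then show ?thesis
      unfolding rl_int_right_one[symmetric] by (simp add: g_def rl_int_right_def)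
  qed
  show ?A unfolding semi[symmetric] using rl_int_duality(1)[OF \<alpha>(1) _ _ fin] by (simp add: g_def)
  show ?B using rl_int_duality(2)[OF \<alpha>(1) _ _ fin] by (simp add: g_def)
  show ?C unfolding semi[symmetric] using rl_int_duality(3)[OF \<alpha>(1) _ _ fin] by simp
qed

text \<open>By \<open>rl_int_product\<close> the quotient equals minus the integral of \<open>\<phi> p\<close> times the mean of \<open>\<psi>\<close>
  over \<open>{p<..p + \<epsilon>}\<close>. In this expression the averaging is moved to \<open>\<phi>\<close>, whose averages
  converge in \<open>L\<^sup>1\<close>, while \<open>\<psi>\<close> is bounded.\<close>

theorem rl_int_difference_quotient:
  assumes \<alpha>: "0 < \<alpha>" "\<alpha> < 1" and \<phi>: "L1_on a b \<phi>" and \<psi>: "L1_on a b \<psi>" and B: "\<And>t. \<bar>\<psi> t\<bar> \<le> B"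
  shows "((\<lambda>\<epsilon>. (LINT r|lborel. rl_int \<alpha> \<phi> r * (rl_int_right (1 - \<alpha>) \<psi> (r + \<epsilon>) - rl_int_right (1 - \<alpha>) \<psi> r)) / \<epsilon>)
     \<longlongrightarrow> - (LINT t|lborel. \<phi> t * \<psi> t)) (at_right 0)"
proof -
  note \<phi>' = L1_onD[OF \<phi>] and \<psi>' = L1_onD[OF \<psi>]
  note [measurable] = \<phi>'(2) \<psi>'(2)
  define E where "E \<epsilon> = (LINT r|lborel. rl_int \<alpha> \<phi> r * (rl_int_right (1 - \<alpha>) \<psi> (r + \<epsilon>) - rl_int_right (1 - \<alpha>) \<psi> r)) / \<epsilon>" for \<epsilon>
  define K :: "real \<Rightarrow> real" where "K = indicator {0<..1}"
  have K: "integrable lborel K" "(LINT s|lborel. K s) = 1" unfolding K_def by auto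
  define D where "D \<epsilon> q = (LINT s|lborel. K s * \<phi> (q - \<epsilon> * s)) - \<phi> q" for \<epsilon> q
  have [measurable]: "D \<epsilon> \<in> borel_measurable borel" for \<epsilon> unfolding D_def K_def by measurable
  have B0: "0 \<le> B" using B[of 0] by linarith
  have eq: "E \<epsilon> = - (LINT q|lborel. \<psi> q * (LINT s|lborel. K s * \<phi> (q - \<epsilon> * s)))"
    and int: "integrable lborel (\<lambda>q. \<psi> q * (LINT s|lborel. K s * \<phi> (q - \<epsilon> * s)))" if \<epsilon>: "0 < \<epsilon>" for \<epsilon>
  proof -
    have \<psi>s: "integrable lborel (\<lambda>r. \<psi> (r + \<epsilon>))" using \<psi>'(1) integrable_translate[of \<psi> "-\<epsilon>"] by simp
    note P0 = rl_int_product[OF \<alpha> \<phi> \<psi>'(1)] and P1 = rl_int_product[OF \<alpha> \<phi> \<psi>s, unfolded rl_int_right_shift]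
    have sh: "(LINT q|lborel. indicator {p<..} q * \<psi> (q + \<epsilon>)) = (LINT q|lborel. indicator {p + \<epsilon><..} q * \<psi> q)" for p
      using integral_translate[of "\<lambda>q. indicator {p<..} q * \<psi> (q + \<epsilon>)" \<epsilon>]
      by (simp add: indicator_def algebra_simps)
    define F where "F p q = \<phi> p * (\<psi> q * indicator {p<..p + \<epsilon>} q)" for p q
    have [measurable]: "case_prod F \<in> borel_measurable (borel \<Otimes>\<^sub>M borel)" unfolding F_def
      by measurable (simp add: greaterThanAtMost_iff)
    have "(\<integral>\<^sup>+z. ennreal (norm (case_prod F z)) \<partial>(lborel \<Otimes>\<^sub>M lborel)) \<le> (\<integral>\<^sup>+p. \<integral>\<^sup>+q. ennreal \<bar>\<phi> p\<bar> * ennreal \<bar>\<psi> q\<bar> \<partial>lborel \<partial>lborel)"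
      by (subst lborel.nn_integral_fst[symmetric])
        (auto simp: F_def abs_mult ennreal_mult' intro!: nn_integral_mono split: split_indicator)
    also have "\<dots> < \<infinity>" using \<phi>'(1) \<psi>'(1)
      by (simp add: nn_integral_cmult nn_integral_multc integrable_iff_bounded ennreal_mult_less_top)
    finally have F: "integrable (lborel \<Otimes>\<^sub>M lborel) (case_prod F)" by (auto simp: integrable_iff_bounded)
    have ind_int: "integrable lborel (\<lambda>q. indicator {p<..} q * \<psi> q)" for p
      using \<psi>'(1) integrable_real_mult_indicator[of "{p<..}" lborel \<psi>] by (simp add: mult.commute)
    have diff: "(LINT q|lborel. indicator {p + \<epsilon><..} q * \<psi> q) - (LINT q|lborel. indicator {p<..} q * \<psi> q)
       = - (LINT q|lborel. \<psi> q * indicator {p<..p + \<epsilon>} q)" for p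
    proof -
      have e: "(\<lambda>q. indicator {p + \<epsilon><..} q * \<psi> q - indicator {p<..} q * \<psi> q) = (\<lambda>q. - (\<psi> q * indicator {p<..p + \<epsilon>} q))"
        using \<epsilon> by (auto split: split_indicator)
      show ?thesis
        unfolding Bochner_Integration.integral_diff[symmetric, OF ind_int ind_int] e by simp
    qed
    have Fp: "(LINT p|lborel. F p q) = \<epsilon> * (\<psi> q * (LINT s|lborel. K s * \<phi> (q - \<epsilon> * s)))" for q
    proof -
      have "(LINT p|lborel. F p q) = \<epsilon> * (LINT s|lborel. F (q + (- \<epsilon>) * s) q)"
        using \<epsilon> lborel_integral_real_affine[of "-\<epsilon>" "\<lambda>p. F p q" q] by simp
      also have "(\<lambda>s. F (q + (- \<epsilon>) * s) q) = (\<lambda>s. \<psi> q * (K s * \<phi> (q - \<epsilon> * s)))"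
        using \<epsilon> by (auto simp: F_def K_def fun_eq_iff zero_less_mult_iff split: split_indicator)
      finally show ?thesis by simp
    qed
    have "(LINT r|lborel. rl_int \<alpha> \<phi> r * (rl_int_right (1 - \<alpha>) \<psi> (r + \<epsilon>) - rl_int_right (1 - \<alpha>) \<psi> r))
      = (LINT p|lborel. \<phi> p * ((LINT q|lborel. indicator {p + \<epsilon><..} q * \<psi> q) - (LINT q|lborel. indicator {p<..} q * \<psi> q)))"
      using P0 P1 by (simp add: right_diff_distrib sh)
    also have "\<dots> = - (LINT p|lborel. LINT q|lborel. F p q)"
      unfolding diff F_def by simp
    also have "\<dots> = - (LINT q|lborel. LINT p|lborel. F p q)"
      using lborel_pair.Fubini_integral[OF F] by simp
    also have "\<dots> = - (\<epsilon> * (LINT q|lborel. \<psi> q * (LINT s|lborel. K s * \<phi> (q - \<epsilon> * s))))"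
      unfolding Fp by simp
    finally show "E \<epsilon> = - (LINT q|lborel. \<psi> q * (LINT s|lborel. K s * \<phi> (q - \<epsilon> * s)))"
      using \<epsilon> by (simp add: E_def)
    show "integrable lborel (\<lambda>q. \<psi> q * (LINT s|lborel. K s * \<phi> (q - \<epsilon> * s)))"
      using lborel_pair.integrable_snd[OF F] \<epsilon> unfolding Fp by simp
  qed
  have \<phi>\<psi>: "integrable lborel (\<lambda>t. \<phi> t * \<psi> t)"
    by (rule integral_mult_bounded(1)[OF \<phi>'(1)]) (use B in auto)
  have lim: "((\<lambda>\<epsilon>. ennreal B * (\<integral>\<^sup>+q. ennreal \<bar>D \<epsilon> q\<bar> \<partial>lborel)) \<longlongrightarrow> 0) (at_right 0)"
    using ennreal_tendsto_cmult[OF _ approximate_identity[OF K(1) \<phi>'(1)], of "ennreal B"] K(2)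
    by (simp add: D_def)
  have le: "ennreal \<bar>E \<epsilon> - (- (LINT t|lborel. \<phi> t * \<psi> t))\<bar> \<le> ennreal B * (\<integral>\<^sup>+q. ennreal \<bar>D \<epsilon> q\<bar> \<partial>lborel)" if \<epsilon>: "0 < \<epsilon>" for \<epsilon>
  proof -
    have i: "integrable lborel (\<lambda>q. \<psi> q * D \<epsilon> q)"
      unfolding D_def right_diff_distrib using int[OF \<epsilon>] \<phi>\<psi> by (simp add: mult.commute)
    have "E \<epsilon> - (- (LINT t|lborel. \<phi> t * \<psi> t)) = - (LINT q|lborel. \<psi> q * D \<epsilon> q)"
      unfolding eq[OF \<epsilon>] D_def right_diff_distrib using int[OF \<epsilon>] \<phi>\<psi> by (simp add: mult.commute)
    then have "ennreal \<bar>E \<epsilon> - (- (LINT t|lborel. \<phi> t * \<psi> t))\<bar> \<le> (\<integral>\<^sup>+q. ennreal (norm (\<psi> q * D \<epsilon> q)) \<partial>lborel)"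
      using integral_norm_bound_ennreal[OF i] by simp
    also have "\<dots> \<le> (\<integral>\<^sup>+q. ennreal B * ennreal \<bar>D \<epsilon> q\<bar> \<partial>lborel)"
      using B B0 by (intro nn_integral_mono)
        (auto simp: abs_mult simp flip: ennreal_mult' intro!: ennreal_leI mult_right_mono)
    also have "\<dots> = ennreal B * (\<integral>\<^sup>+q. ennreal \<bar>D \<epsilon> q\<bar> \<partial>lborel)"
      by (rule nn_integral_cmult) auto
    finally show ?thesis .
  qed
  have "((\<lambda>\<epsilon>. ennreal \<bar>E \<epsilon> - (- (LINT t|lborel. \<phi> t * \<psi> t))\<bar>) \<longlongrightarrow> ennreal 0) (at_right 0)"
    unfolding ennreal_0
    by (rule tendsto_sandwich[OF _ eventually_mono[OF eventually_at_right_less le] tendsto_const lim]) auto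
  then have "((\<lambda>\<epsilon>. \<bar>E \<epsilon> - (- (LINT t|lborel. \<phi> t * \<psi> t))\<bar>) \<longlongrightarrow> 0) (at_right 0)"
    by (rule tendsto_ennrealD) auto
  then show ?thesis unfolding E_def
    by (rule tendsto_rabs_zero_cancel[THEN Lim_null[THEN iffD2]])
qed

section \<open>Integration by parts under a mere integrability condition\<close>

lemma shifted_integral_tendsto:
  fixes f g :: "real \<Rightarrow> real"
  assumes f: "integrable lborel f" and g: "g \<in> borel_measurable borel" and B: "AE t in lborel. \<bar>g t\<bar> \<le> B"
  shows "((\<lambda>h. LINT t|lborel. f (t - h) * g t) \<longlongrightarrow> (LINT t|lborel. f t * g t)) (at 0)"
proof -
  have g': "g \<in> borel_measurable lborel" using g by simp
  note int = integral_mult_bounded[OF _ g' B]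
  have fh: "integrable lborel (\<lambda>t. f (t - h))" for h using f integrable_translate[of f h] by simp
  have le: "\<bar>(LINT t|lborel. f (t - h) * g t) - (LINT t|lborel. f t * g t)\<bar> \<le> B * translation_modulus f h" for h
    using int(2)[OF Bochner_Integration.integrable_diff[OF fh f], of h] int(1)[OF f] int(1)[OF fh]
    by (simp add: left_diff_distrib translation_modulus_def)
  have lim: "((\<lambda>h. B * translation_modulus f h) \<longlongrightarrow> 0) (at 0)"
    using tendsto_mult_left[OF translation_modulus_tendsto[OF f], of B] by simp
  have "((\<lambda>h. (LINT t|lborel. f (t - h) * g t) - (LINT t|lborel. f t * g t)) \<longlongrightarrow> 0) (at 0)"
    by (rule Lim_null_comparison[OF _ lim]) (simp add: le)
  then show ?thesis by (rule Lim_null[THEN iffD2])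
qed

text \<open>The double integral need not converge absolutely. After a shift of \<open>\<psi>\<close> by \<open>h\<close> it does for
  almost every \<open>h > 0\<close>, since averaging over \<open>h\<close> replaces \<open>\<psi>\<close> by its \<open>L\<^sup>1\<close> norm. Both sides
  are continuous as \<open>h\<close> decreases to \<open>0\<close>: on the left \<open>\<phi>\<close> is bounded and \<open>\<psi>\<close> is shifted, on
  the right the fractional integral of \<open>\<psi>\<close> is bounded and the shift is moved to \<open>u\<close>.\<close>

lemma bounded_integration_by_parts:
  assumes s: "0 < s" and u: "L1_on a b u" and \<phi>: "L1_on a b \<phi>" and n: "\<And>t. \<bar>\<phi> t\<bar> \<le> n"
    and eq: "AE t in lborel. t \<in> {a..b} \<longrightarrow> \<phi> t = rl_int s u t"
    and \<psi>: "L1_on a b \<psi>" and B: "AE t in lborel. t \<in> {a..b} \<longrightarrow> \<bar>rl_int_right s \<psi> t\<bar> \<le> B"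
  shows "(LINT t|lborel. \<phi> t * \<psi> t) = (LINT t|lborel. u t * rl_int_right s \<psi> t)"
proof -
  note u' = L1_onD[OF u] and \<phi>' = L1_onD[OF \<phi>] and \<psi>' = L1_onD[OF \<psi>]
  note [measurable] = u'(2) \<phi>'(2) \<psi>'(2)
  define w where "w t = indicator {a..} t * rl_int_right s \<psi> t" for t
  have [measurable]: "w \<in> borel_measurable borel" unfolding w_def by measurable
  have w_right: "rl_int_right s \<psi> t = 0" if "b \<le> t" for t
    using that \<psi>'(4) by (intro rl_int_right_zero[of b]) auto
  have wB: "AE t in lborel. \<bar>w t\<bar> \<le> max 0 B"
    using B
  proof eventually_elim
    case (elim t)
    then show ?case using w_right[of t] by (cases "t \<le> b") (auto simp: w_def split: split_indicator)
  qed
  define A where "A h = (LINT r|lborel. \<phi> r * \<psi> (r + h))" for h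
  define D where "D h = (LINT r|lborel. u r * w (r + h))" for h
  have A: "(A \<longlongrightarrow> A 0) (at_right 0)"
  proof -
    have "((\<lambda>h. LINT t|lborel. \<psi> (t - h) * \<phi> t) \<longlongrightarrow> (LINT t|lborel. \<psi> t * \<phi> t)) (at 0)"
      by (rule shifted_integral_tendsto[OF \<psi>'(1), where B=n]) (use n in auto)
    moreover have "filterlim (\<lambda>h::real. - h) (at 0) (at_right 0)"
      unfolding filterlim_at by (auto intro!: tendsto_eq_intros simp: eventually_at_filter)
    ultimately have "((\<lambda>h. LINT t|lborel. \<psi> (t - - h) * \<phi> t) \<longlongrightarrow> (LINT t|lborel. \<psi> t * \<phi> t)) (at_right 0)"
      by (rule filterlim_compose)
    then show ?thesis by (simp add: A_def[abs_def] mult.commute)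
  qed
  have Deq: "D h = (LINT t|lborel. u (t - h) * w t)" for h
    unfolding D_def using integral_translate[of "\<lambda>r. u r * w (r + h)" h] by simp
  have D: "(D \<longlongrightarrow> D 0) (at_right 0)"
  proof -
    have "((\<lambda>h. LINT t|lborel. u (t - h) * w t) \<longlongrightarrow> (LINT t|lborel. u t * w t)) (at 0)"
      by (rule shifted_integral_tendsto[OF u'(1) _ wB]) measurable
    then have "(D \<longlongrightarrow> D 0) (at 0)" by (simp add: Deq[abs_def])
    then show ?thesis by (rule filterlim_mono[OF _ order_refl at_le]) simp
  qed
  define N where "N = (\<integral>\<^sup>+r. ennreal \<bar>\<psi> r\<bar> \<partial>lborel)"
  define U where "U = (\<integral>\<^sup>+p. ennreal \<bar>u p\<bar> \<partial>lborel)"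
  define G where "G h p r = ennreal \<bar>u p\<bar> * (ennreal (rl_kernel s (r - p)) * ennreal \<bar>\<psi> (r + h)\<bar>)" for h p r
  have mass: "(\<integral>\<^sup>+r. ennreal (rl_kernel s (r - p)) * indicator {..b} r \<partial>lborel) \<le> ennreal (rl_kernel (s + 1) (b - a))"
    if "a \<le> p" for p
  proof -
    have "(\<integral>\<^sup>+r. ennreal (rl_kernel s (r - p)) * indicator {..b} r \<partial>lborel)
       = (\<integral>\<^sup>+x. ennreal (rl_kernel s x) * indicator {..b - p} x \<partial>lborel)"
      by (subst nn_integral_translate[of _ p, symmetric]) (auto intro!: nn_integral_cong split: split_indicator)
    also have "\<dots> = ennreal (rl_kernel (s + 1) (b - p))" by (rule rl_kernel_mass[OF s])
    also have "\<dots> \<le> ennreal (rl_kernel (s + 1) (b - a))"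
      using that by (intro ennreal_leI rl_kernel_mono_mass s) auto
    finally show ?thesis .
  qed
  have "(\<integral>\<^sup>+h\<in>{0<..}. (\<integral>\<^sup>+p. \<integral>\<^sup>+r. G h p r \<partial>lborel \<partial>lborel) \<partial>lborel)
     = (\<integral>\<^sup>+h. \<integral>\<^sup>+p. \<integral>\<^sup>+r. G h p r * indicator {0<..} h \<partial>lborel \<partial>lborel \<partial>lborel)"
    by (intro nn_integral_cong) (auto split: split_indicator)
  also have "\<dots> = (\<integral>\<^sup>+p. \<integral>\<^sup>+h. \<integral>\<^sup>+r. G h p r * indicator {0<..} h \<partial>lborel \<partial>lborel \<partial>lborel)"
    unfolding G_def by (rule lborel_pair.Fubini') measurable
  also have "\<dots> = (\<integral>\<^sup>+p. \<integral>\<^sup>+r. \<integral>\<^sup>+h. G h p r * indicator {0<..} h \<partial>lborel \<partial>lborel \<partial>lborel)"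
    unfolding G_def by (intro nn_integral_cong lborel_pair.Fubini') measurable
  also have "\<dots> \<le> (\<integral>\<^sup>+p. \<integral>\<^sup>+r. ennreal \<bar>u p\<bar> * (ennreal (rl_kernel s (r - p)) * indicator {..b} r * N) \<partial>lborel \<partial>lborel)"
  proof (intro nn_integral_mono)
    fix p r
    have "(\<integral>\<^sup>+h. G h p r * indicator {0<..} h \<partial>lborel)
      \<le> (\<integral>\<^sup>+h. ennreal \<bar>u p\<bar> * (ennreal (rl_kernel s (r - p)) * indicator {..b} r * ennreal \<bar>\<psi> (h + r)\<bar>) \<partial>lborel)"
      using \<psi>'(4) by (intro nn_integral_mono) (auto simp: G_def add.commute split: split_indicator)
    also have "\<dots> = ennreal \<bar>u p\<bar> * (ennreal (rl_kernel s (r - p)) * indicator {..b} r * (\<integral>\<^sup>+h. ennreal \<bar>\<psi> (h + r)\<bar> \<partial>lborel))"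
      by (simp add: nn_integral_cmult)
    also have "(\<integral>\<^sup>+h. ennreal \<bar>\<psi> (h + r)\<bar> \<partial>lborel) = N"
      unfolding N_def using nn_integral_translate[of "\<lambda>r. ennreal \<bar>\<psi> r\<bar>" "-r"] by simp
    finally show "(\<integral>\<^sup>+h. G h p r * indicator {0<..} h \<partial>lborel)
       \<le> ennreal \<bar>u p\<bar> * (ennreal (rl_kernel s (r - p)) * indicator {..b} r * N)" .
  qed
  also have "\<dots> = (\<integral>\<^sup>+p. ennreal \<bar>u p\<bar> * ((\<integral>\<^sup>+r. ennreal (rl_kernel s (r - p)) * indicator {..b} r \<partial>lborel) * N) \<partial>lborel)"
    by (simp add: nn_integral_cmult nn_integral_multc)
  also have "\<dots> \<le> (\<integral>\<^sup>+p. ennreal \<bar>u p\<bar> * (ennreal (rl_kernel (s + 1) (b - a)) * N) \<partial>lborel)"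
  proof (intro nn_integral_mono)
    fix p
    show "ennreal \<bar>u p\<bar> * ((\<integral>\<^sup>+r. ennreal (rl_kernel s (r - p)) * indicator {..b} r \<partial>lborel) * N)
      \<le> ennreal \<bar>u p\<bar> * (ennreal (rl_kernel (s + 1) (b - a)) * N)"
      using mass[of p] u'(3)[of p] by (cases "a \<le> p") (auto intro!: mult_left_mono mult_right_mono)
  qed
  also have "\<dots> = U * (ennreal (rl_kernel (s + 1) (b - a)) * N)"
    unfolding U_def by (rule nn_integral_multc) auto
  also have "\<dots> < \<infinity>"
    using u'(1) \<psi>'(1) by (simp add: U_def N_def ennreal_mult_less_top integrable_iff_bounded)
  finally have "AE h in lborel. (\<integral>\<^sup>+p. \<integral>\<^sup>+r. G h p r \<partial>lborel \<partial>lborel) * indicator {0<..} h \<noteq> \<infinity>"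
    unfolding G_def by (intro nn_integral_PInf_AE) auto
  then have AD: "AE h in lborel. 0 < h \<longrightarrow> A h = D h"
  proof eventually_elim
    case (elim h)
    show ?case
    proof
      assume h: "0 < h"
      have "(\<integral>\<^sup>+p. ennreal \<bar>u p\<bar> * (\<integral>\<^sup>+r. ennreal (rl_kernel s (r - p)) * ennreal \<bar>\<psi> (r + h)\<bar> \<partial>lborel) \<partial>lborel) < \<infinity>"
        using elim h by (simp add: G_def nn_integral_cmult less_top)
      then have "(LINT r|lborel. rl_int s u r * \<psi> (r + h)) = (LINT p|lborel. u p * rl_int_right s \<psi> (p + h))"
        using rl_int_duality(1)[OF s, of u "\<lambda>r. \<psi> (r + h)"] by (simp add: rl_int_right_shift)
      also have "\<dots> = D h"
        unfolding D_def using u'(3) h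
        by (intro Bochner_Integration.integral_cong refl) (auto simp: w_def split: split_indicator)
      also have "(LINT r|lborel. rl_int s u r * \<psi> (r + h)) = A h"
        unfolding A_def
      proof (rule integral_cong_AE)
        show "AE r in lborel. rl_int s u r * \<psi> (r + h) = \<phi> r * \<psi> (r + h)"
          using eq
        proof eventually_elim
          case (elim r)
          have "rl_int s u r = 0 \<and> \<phi> r = 0" if "r < a"
            using that rl_int_left_zero[of a u r] u'(3) \<phi>'(3) by auto
          then show ?case using elim \<psi>'(4)[of "r + h"] h by (cases "r \<in> {a..b}") auto
        qed
      qed auto
      finally show "A h = D h" .
    qed
  qed
  have "A 0 = D 0"
  proof (rule ccontr)
    assume "A 0 \<noteq> D 0"
    have "((\<lambda>h. A h - D h) \<longlongrightarrow> A 0 - D 0) (at_right 0)" by (intro tendsto_diff A D)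
    then have "\<forall>\<^sub>F h in at_right 0. A h - D h \<noteq> 0"
      using \<open>A 0 \<noteq> D 0\<close> by (intro tendsto_imp_eventually_ne) auto
    then obtain d where d: "0 < d" "\<And>h. 0 < h \<Longrightarrow> h < d \<Longrightarrow> A h \<noteq> D h"
      unfolding eventually_at_right_field by auto
    have "AE h in lborel. h \<notin> {0<..<d}" using AD by eventually_elim (use d in auto)
    then have "emeasure lborel {0<..<d} = 0"
      by (subst (asm) AE_iff_measurable[of "{0<..<d}"]) auto
    then show False using d by simp
  qed
  moreover have "D 0 = (LINT t|lborel. u t * rl_int_right s \<psi> t)"
    unfolding D_def using u'(3) by (intro Bochner_Integration.integral_cong refl) (auto simp: w_def split: split_indicator)
  ultimately show ?thesis by (simp add: A_def)
qed

text \<open>Truncate \<open>\<phi>\<close> at the level \<open>n\<close>. The excess \<open>v n\<close> has increments bounded by those of \<open>\<phi>\<close> and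
  vanishes pointwise for large \<open>n\<close>, so its energy tends to \<open>0\<close>. Hence \<open>v n\<close> is the
  fractional integral of some \<open>z n\<close> that tends to \<open>0\<close> in \<open>L\<^sup>1\<close>, and the truncation is the
  fractional integral of \<open>u - z n\<close>. The bounded case applies to it, and both sides converge:
  on the left the product \<open>\<phi> * \<psi>\<close> is an integrable majorant.\<close>

theorem integration_by_parts_integrable_product:
  assumes s: "0 < s" "s < 1" and u: "L1_on a b u" and \<phi>: "L1_on a b \<phi>"
    and eq: "AE t in lborel. t \<in> {a..b} \<longrightarrow> \<phi> t = rl_int s u t"
    and fin: "frac_energy s a b \<phi> < \<infinity>"
    and \<psi>: "L1_on a b \<psi>" and B: "AE t in lborel. t \<in> {a..b} \<longrightarrow> \<bar>rl_int_right s \<psi> t\<bar> \<le> B"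
    and int: "integrable lborel (\<lambda>t. \<phi> t * \<psi> t)"
  shows "(LINT t|lborel. \<phi> t * \<psi> t) = (LINT t|lborel. u t * rl_int_right s \<psi> t)"
proof -
  note u' = L1_onD[OF u] and \<phi>' = L1_onD[OF \<phi>] and \<psi>' = L1_onD[OF \<psi>]
  note [measurable] = u'(2) \<phi>'(2) \<psi>'(2)
  define w where "w = rl_int_right s \<psi>"
  have [measurable]: "w \<in> borel_measurable borel" unfolding w_def by measurable
  define \<tau> where "\<tau> n x = max (- real n) (min (real n) x)" for n x
  define v where "v n t = \<phi> t - \<tau> n (\<phi> t)" for n t
  have [measurable]: "v n \<in> borel_measurable borel" for n unfolding v_def \<tau>_def by measurable
  have \<tau>_bound: "\<bar>\<tau> n x\<bar> \<le> real n" "\<bar>\<tau> n x\<bar> \<le> \<bar>x\<bar>" "\<bar>x - \<tau> n x\<bar> \<le> \<bar>x\<bar>"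
    "\<bar>(x - \<tau> n x) - (y - \<tau> n y)\<bar> \<le> \<bar>x - y\<bar>" "\<bar>x\<bar> \<le> real n \<Longrightarrow> \<tau> n x = x" for n x y
    unfolding \<tau>_def by (auto simp: max_def min_def)
  have v: "L1_on a b (v n)" for n
    unfolding L1_on_def
  proof safe
    show "integrable lborel (v n)"
      by (rule Bochner_Integration.integrable_bound[OF \<phi>'(1)]) (auto simp: v_def \<tau>_bound)
    fix t assume "t \<notin> {a..b}"
    then have "\<phi> t = 0" using \<phi>'(3,4) by (cases "t < a") auto
    then show "v n t = 0" by (simp add: v_def \<tau>_def)
  qed
  have ev_v: "\<forall>\<^sub>F n in sequentially. v n t = 0" for t
    using eventually_ge_at_top[of "nat \<lceil>\<bar>\<phi> t\<bar>\<rceil>"]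
    by eventually_elim (auto simp: v_def intro!: \<tau>_bound(5)[symmetric])
  have energy_le: "frac_energy s a b (v n) \<le> frac_energy s a b \<phi>" for n
    unfolding frac_energy_def
    by (intro nn_integral_mono mult_right_mono ennreal_leI) (auto simp: v_def intro!: \<tau>_bound)
  have energy_lim: "(\<lambda>n. frac_energy s a b (v n)) \<longlonglongrightarrow> 0"
  proof -
    define d where "d f z = ennreal (\<bar>f (fst z) - f (fst z - snd z)\<bar> * snd z powr (- 1 - s))
       * indicator ({a..b} \<times> {0<..}) z" for f :: "real \<Rightarrow> real" and z
    have dm: "d f \<in> borel_measurable (lborel \<Otimes>\<^sub>M lborel)" if [measurable]: "f \<in> borel_measurable borel" for f
      unfolding d_def by measurable
    have en: "frac_energy s a b f = (\<integral>\<^sup>+z. d f z \<partial>(lborel \<Otimes>\<^sub>M lborel))" if [measurable]: "f \<in> borel_measurable borel" for f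
      unfolding frac_energy_def
      by (subst lborel.nn_integral_fst[OF dm[OF that], symmetric], subst nn_integral_multc[symmetric])
        (auto simp: d_def indicator_times intro!: nn_integral_cong split: split_indicator)
    have "(\<lambda>n. \<integral>\<^sup>+z. d (v n) z \<partial>(lborel \<Otimes>\<^sub>M lborel)) \<longlonglongrightarrow> integral\<^sup>N (lborel \<Otimes>\<^sub>M lborel) (\<lambda>z::real \<times> real. 0)"
    proof (rule nn_integral_dominated_convergence[where w="d \<phi>"])
      show "AE z in lborel \<Otimes>\<^sub>M lborel. d (v n) z \<le> d \<phi> z" for n
        unfolding d_def v_def by (intro AE_I2 mult_right_mono ennreal_leI \<tau>_bound) auto
      show "AE z in lborel \<Otimes>\<^sub>M lborel. (\<lambda>n. d (v n) z) \<longlonglongrightarrow> 0"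
      proof (rule AE_I2)
        fix z :: "real \<times> real"
        have "\<forall>\<^sub>F n in sequentially. d (v n) z = 0"
          using ev_v[of "fst z"] ev_v[of "fst z - snd z"] by eventually_elim (simp add: d_def)
        then show "(\<lambda>n. d (v n) z) \<longlonglongrightarrow> 0" by (rule tendsto_eventually)
      qed
      show "(\<integral>\<^sup>+z. d \<phi> z \<partial>(lborel \<Otimes>\<^sub>M lborel)) < \<infinity>" using fin en[of \<phi>] by simp
    qed (auto intro: dm)
    then show ?thesis by (simp add: en)
  qed
  define z where "z n t = indicator {a..b} t * marchaud s (v n) t" for n t
  have fin_v: "frac_energy s a b (v n) < \<infinity>" for n using energy_le fin by (rule le_less_trans)
  have z: "L1_on a b (z n)" for n unfolding z_def by (rule marchaud_L1[OF s v fin_v])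
  note z' = L1_onD[OF z]
  note [measurable] = z'(2)
  have parts: "(LINT t|lborel. \<tau> n (\<phi> t) * \<psi> t) = (LINT t|lborel. (u t - z n t) * w t)" for n
    unfolding w_def
  proof (rule bounded_integration_by_parts[OF s(1) _ _ _ _ \<psi> B])
    show "L1_on a b (\<lambda>t. u t - z n t)" using u z[of n] by (auto simp: L1_on_def)
    have "L1_on a b (\<lambda>t. \<phi> t - v n t)" using \<phi> v[of n] by (auto simp: L1_on_def)
    then show "L1_on a b (\<lambda>t. \<tau> n (\<phi> t))" by (simp add: v_def)
    show "AE t in lborel. t \<in> {a..b} \<longrightarrow> \<tau> n (\<phi> t) = rl_int s (\<lambda>t. u t - z n t) t"
      using eq rl_int_marchaud[OF s v fin_v, of n, folded z_def] L1_on_rl_int_integrable[OF s(1) u, of b]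
         L1_on_rl_int_integrable[OF s(1) z[of n], of b]
    proof eventually_elim
      case (elim t)
      show ?case
      proof
        assume t: "t \<in> {a..b}"
        then have "rl_int s (\<lambda>t. u t - z n t) t = rl_int s u t - rl_int s (z n) t"
          using elim by (simp add: rl_int_def right_diff_distrib)
        also have "\<dots> = \<phi> t - v n t" using elim t by simp
        finally show "\<tau> n (\<phi> t) = rl_int s (\<lambda>t. u t - z n t) t" by (simp add: v_def)
      qed
    qed
  qed (rule \<tau>_bound)
  have L: "(\<lambda>n. LINT t|lborel. \<tau> n (\<phi> t) * \<psi> t) \<longlonglongrightarrow> (LINT t|lborel. \<phi> t * \<psi> t)"
  proof (rule integral_dominated_convergence[where w="\<lambda>t. \<bar>\<phi> t * \<psi> t\<bar>"])
    show "AE t in lborel. (\<lambda>n. \<tau> n (\<phi> t) * \<psi> t) \<longlonglongrightarrow> \<phi> t * \<psi> t"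
    proof (rule AE_I2)
      fix t
      have "\<forall>\<^sub>F n in sequentially. \<tau> n (\<phi> t) * \<psi> t = \<phi> t * \<psi> t"
        using ev_v[of t] by eventually_elim (simp add: v_def)
      then show "(\<lambda>n. \<tau> n (\<phi> t) * \<psi> t) \<longlonglongrightarrow> \<phi> t * \<psi> t" by (rule tendsto_eventually)
    qed
    show "(\<lambda>t. \<tau> n (\<phi> t) * \<psi> t) \<in> borel_measurable lborel" for n unfolding \<tau>_def by measurable
    show "AE t in lborel. norm (\<tau> n (\<phi> t) * \<psi> t) \<le> \<bar>\<phi> t * \<psi> t\<bar>" for n
      by (auto simp: abs_mult intro!: mult_right_mono \<tau>_bound)
    show "integrable lborel (\<lambda>t. \<bar>\<phi> t * \<psi> t\<bar>)" by (rule integrable_abs[OF int])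
  qed auto
  have wint: "integrable lborel (\<lambda>t. f t * w t)" "\<bar>LINT t|lborel. f t * w t\<bar> \<le> max 0 B * (LINT t|lborel. \<bar>f t\<bar>)"
    if f: "L1_on a b f" for f
  proof -
    have ae: "AE t in lborel. \<bar>f t * w t\<bar> \<le> max 0 B * \<bar>f t\<bar>"
      using B
    proof eventually_elim
      case (elim t)
      have "f t = 0 \<or> \<bar>w t\<bar> \<le> max 0 B"
        using elim L1_onD(3,4)[OF f, of t] by (cases "t \<in> {a..b}") (auto simp: w_def)
      then have "\<bar>f t\<bar> * \<bar>w t\<bar> \<le> \<bar>f t\<bar> * max 0 B" by (metis abs_ge_zero abs_zero mult_left_mono mult_zero_left order_refl)
      then show ?case by (simp add: abs_mult mult.commute)
    qed
    note [measurable] = L1_onD(2)[OF f]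
    show i: "integrable lborel (\<lambda>t. f t * w t)"
      by (rule Bochner_Integration.integrable_bound[OF integrable_mult_right[OF integrable_abs[OF L1_onD(1)[OF f]], of "max 0 B"]])
        (use ae in \<open>auto elim!: eventually_mono simp: abs_mult\<close>)
    have "\<bar>LINT t|lborel. f t * w t\<bar> \<le> (LINT t|lborel. \<bar>f t * w t\<bar>)" by (rule integral_abs_bound)
    also have "\<dots> \<le> (LINT t|lborel. max 0 B * \<bar>f t\<bar>)"
      by (rule integral_mono_AE[OF integrable_abs[OF i] _ ae]) (use L1_onD(1)[OF f] in auto)
    finally show "\<bar>LINT t|lborel. f t * w t\<bar> \<le> max 0 B * (LINT t|lborel. \<bar>f t\<bar>)" by simp
  qed
  have zlim: "(\<lambda>n. LINT t|lborel. \<bar>z n t\<bar>) \<longlonglongrightarrow> 0"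
  proof -
    have e: "(\<integral>\<^sup>+t. ennreal \<bar>z n t\<bar> \<partial>lborel) = ennreal (LINT t|lborel. \<bar>z n t\<bar>)" for n
      using z'(1)[of n] by (intro nn_integral_eq_integral) auto
    have le: "ennreal (LINT t|lborel. \<bar>z n t\<bar>) \<le> ennreal (s / Gamma (1 - s)) * frac_energy s a b (v n)" for n
      unfolding e[symmetric] unfolding z_def by (rule marchaud_L1(2)[OF s v fin_v])
    have lim: "(\<lambda>n. ennreal (s / Gamma (1 - s)) * frac_energy s a b (v n)) \<longlonglongrightarrow> 0"
      using ennreal_tendsto_cmult[OF _ energy_lim, of "ennreal (s / Gamma (1 - s))"] by simp
    have "(\<lambda>n. ennreal (LINT t|lborel. \<bar>z n t\<bar>)) \<longlonglongrightarrow> ennreal 0"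
      unfolding ennreal_0 by (rule tendsto_sandwich[OF _ always_eventually tendsto_const lim]) (auto simp: le)
    then show ?thesis by (rule tendsto_ennrealD) auto
  qed
  have R: "(\<lambda>n. LINT t|lborel. (u t - z n t) * w t) \<longlonglongrightarrow> (LINT t|lborel. u t * w t)"
  proof (rule Lim_transform2)
    have e: "(LINT t|lborel. u t * w t) - (LINT t|lborel. (u t - z n t) * w t) = (LINT t|lborel. z n t * w t)" for n
      using wint(1)[OF u] wint(1)[OF z[of n]] by (simp add: left_diff_distrib)
    have le: "\<bar>(LINT t|lborel. u t * w t) - (LINT t|lborel. (u t - z n t) * w t)\<bar> \<le> max 0 B * (LINT t|lborel. \<bar>z n t\<bar>)" for n
      unfolding e by (rule wint(2)[OF z])
    have lim: "(\<lambda>n. max 0 B * (LINT t|lborel. \<bar>z n t\<bar>)) \<longlonglongrightarrow> 0"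
      using tendsto_mult_left[OF zlim, of "max 0 B"] by simp
    show "(\<lambda>n. (LINT t|lborel. u t * w t) - (LINT t|lborel. (u t - z n t) * w t)) \<longlonglongrightarrow> 0"
      by (rule Lim_null_comparison[OF _ lim]) (simp add: le)
  qed simp
  show ?thesis using LIMSEQ_unique[OF L R[folded parts]] by (simp add: w_def)
qed

section \<open>The fractional calculus on an interval\<close>

text \<open>The measurability on the completed line is weaker than Borel measurability, which the
  convolutions above require; a Borel version repairs this.\<close>

lemma lebesgue_L1_on_version:
  assumes "set_integrable lebesgue {a..b} \<phi>"
  obtains u where "L1_on a b u" "AE t in lebesgue. t \<in> {a..b} \<longrightarrow> \<phi> t = u t"
proof -
  define g where "g t = indicator {a..b} t * \<phi> t" for t
  have g: "integrable lebesgue g" using assms by (simp add: set_integrable_def g_def[abs_def])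
  then obtain u0 where u0[measurable]: "u0 \<in> borel_measurable lborel" and ae: "AE t in lborel. g t = u0 t"
    using completion_ex_borel_measurable_real[of g lborel] by (auto dest: borel_measurable_integrable)
  define u where "u t = indicator {a..b} t * u0 t" for t
  have [measurable]: "u \<in> borel_measurable lborel" unfolding u_def by measurable
  have eq: "AE t in lebesgue. g t = u t"
    using AE_completion[OF ae] by eventually_elim (auto simp: u_def g_def split: split_indicator_asm)
  have um: "u \<in> borel_measurable lebesgue" by (rule measurable_completion) measurable
  have "integrable lebesgue u"
    by (rule integrable_cong_AE[THEN iffD1, OF borel_measurable_integrable[OF g] um eq g])
  then have "L1_on a b u" unfolding L1_on_def by (auto simp: integrable_completion) (auto simp: u_def)
  moreover have "AE t in lebesgue. t \<in> {a..b} \<longrightarrow> \<phi> t = u t"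
    using eq by eventually_elim (auto simp: g_def)
  ultimately show ?thesis by (rule that)
qed

lemma frac_int_left_eq_rl_int:
  assumes \<alpha>: "0 < \<alpha>" and u: "L1_on a b u" and \<phi>: "set_integrable lebesgue {a..b} \<phi>"
    and ae: "AE t in lebesgue. t \<in> {a..b} \<longrightarrow> \<phi> t = u t" and t: "t \<in> {a..b}"
  shows "frac_int_left \<alpha> a \<phi> t = rl_int \<alpha> u t"
proof -
  have [measurable]: "u \<in> borel_measurable borel" by (rule L1_onD(2)[OF u])
  have ga: "Gamma \<alpha> \<noteq> 0" using less_imp_neq[OF Gamma_real_pos[OF \<alpha>]] by simp
  have g: "(\<lambda>r. indicator {a..b} r * \<phi> r) \<in> borel_measurable lebesgue"
    using \<phi> unfolding set_integrable_def by (auto dest: borel_measurable_integrable)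
  have k: "(\<lambda>r. indicator {a..t} r * (t - r) powr (\<alpha> - 1)) \<in> borel_measurable lebesgue"
    by (rule measurable_completion) measurable
  have "(\<lambda>r. indicator {a..t} r *\<^sub>R ((t - r) powr (\<alpha> - 1) * \<phi> r)) \<in> borel_measurable lebesgue"
  proof -
    have "(\<lambda>r. indicator {a..t} r *\<^sub>R ((t - r) powr (\<alpha> - 1) * \<phi> r))
       = (\<lambda>r. indicator {a..t} r * (t - r) powr (\<alpha> - 1) * (indicator {a..b} r * \<phi> r))"
      using t by (auto simp: fun_eq_iff split: split_indicator)
    then show ?thesis using borel_measurable_times[OF k g] by (simp only:)
  qed
  moreover have "(\<lambda>r. Gamma \<alpha> * (rl_kernel \<alpha> (t - r) * u r)) \<in> borel_measurable lebesgue"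
    by (rule measurable_completion) measurable
  moreover have "AE r in lebesgue. indicator {a..t} r *\<^sub>R ((t - r) powr (\<alpha> - 1) * \<phi> r) = Gamma \<alpha> * (rl_kernel \<alpha> (t - r) * u r)"
    using AE_completion[OF AE_lborel_singleton[of t]] ae
  proof eventually_elim
    case (elim r)
    then show ?case using t ga L1_onD(3)[OF u, of r]
      by (cases "r < a") (auto simp: rl_kernel_def split: split_indicator)
  qed
  ultimately have "(LINT r:{a..t}|lebesgue. (t - r) powr (\<alpha> - 1) * \<phi> r) = (LINT r|lebesgue. Gamma \<alpha> * (rl_kernel \<alpha> (t - r) * u r))"
    unfolding set_lebesgue_integral_def by (intro integral_cong_AE) auto
  also have "(LINT r|lebesgue. Gamma \<alpha> * (rl_kernel \<alpha> (t - r) * u r)) = Gamma \<alpha> * rl_int \<alpha> u t"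
    unfolding rl_int_def by (subst integral_completion) auto
  finally show ?thesis
    unfolding frac_int_left_def using ga by simp
qed

lemma L1_on_set_integrable:
  assumes "L1_on a b u"
  shows "set_integrable lebesgue {a..b} u"
proof -
  have "(\<lambda>t. indicator {a..b} t *\<^sub>R u t) = u"
    using L1_onD(3,4)[OF assms] by (auto simp: fun_eq_iff not_le split: split_indicator)
  then show ?thesis
    using L1_onD(1,2)[OF assms] unfolding set_integrable_def by (simp add: integrable_completion)
qed

lemma frac_image_left_iff:
  assumes \<alpha>: "0 < \<alpha>"
  shows "f \<in> frac_image_left \<alpha> a b \<longleftrightarrow>
     (\<exists>u. L1_on a b u \<and> (AE t in lebesgue. t \<in> {a..b} \<longrightarrow> f t = rl_int \<alpha> u t))"
proof
  assume "f \<in> frac_image_left \<alpha> a b"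
  then obtain \<phi> where \<phi>: "set_integrable lebesgue {a..b} \<phi>" "AE t in lebesgue. t \<in> {a..b} \<longrightarrow> f t = frac_int_left \<alpha> a \<phi> t"
    unfolding frac_image_left_def by auto
  obtain u where u: "L1_on a b u" "AE t in lebesgue. t \<in> {a..b} \<longrightarrow> \<phi> t = u t"
    using lebesgue_L1_on_version[OF \<phi>(1)] .
  have "AE t in lebesgue. t \<in> {a..b} \<longrightarrow> f t = rl_int \<alpha> u t"
    using \<phi>(2) by eventually_elim (auto simp: frac_int_left_eq_rl_int[OF \<alpha> u(1) \<phi>(1) u(2)])
  then show "\<exists>u. L1_on a b u \<and> (AE t in lebesgue. t \<in> {a..b} \<longrightarrow> f t = rl_int \<alpha> u t)" using u(1) by blast
next
  assume "\<exists>u. L1_on a b u \<and> (AE t in lebesgue. t \<in> {a..b} \<longrightarrow> f t = rl_int \<alpha> u t)"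
  then obtain u where u: "L1_on a b u" "AE t in lebesgue. t \<in> {a..b} \<longrightarrow> f t = rl_int \<alpha> u t" by blast
  have "AE t in lebesgue. t \<in> {a..b} \<longrightarrow> f t = frac_int_left \<alpha> a u t"
    using u(2) by eventually_elim (auto simp: frac_int_left_eq_rl_int[OF \<alpha> u(1) L1_on_set_integrable[OF u(1)]])
  then show "f \<in> frac_image_left \<alpha> a b"
    unfolding frac_image_left_def using L1_on_set_integrable[OF u(1)] by blast
qed

lemma L1_on_reflect: "L1_on (- b) (- a) (\<lambda>x. u (- x)) \<longleftrightarrow> L1_on a b u"
proof -
  have "integrable lborel (\<lambda>x. u (- x)) \<longleftrightarrow> integrable lborel u" using integrable_reflect_at[of u 0] by simp
  moreover have "(\<forall>t. t \<notin> {-b..-a} \<longrightarrow> u (- t) = 0) \<longleftrightarrow> (\<forall>t. t \<notin> {a..b} \<longrightarrow> u t = 0)"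
  proof (intro iffI allI impI)
    fix t assume "\<forall>t. t \<notin> {-b..-a} \<longrightarrow> u (- t) = 0" "t \<notin> {a..b}"
    then show "u t = 0" using spec[of "\<lambda>t. t \<notin> {-b..-a} \<longrightarrow> u (- t) = 0" "-t"] by auto
  next
    fix t assume "\<forall>t. t \<notin> {a..b} \<longrightarrow> u t = 0" "t \<notin> {-b..-a}"
    then show "u (- t) = 0" using spec[of "\<lambda>t. t \<notin> {a..b} \<longrightarrow> u t = 0" "-t"] by auto
  qed
  ultimately show ?thesis unfolding L1_on_def by simp
qed

lemma AE_lebesgue_reflect:
  assumes "AE t in lebesgue. P t"
  shows "AE t in lebesgue. P (- t :: real)"
proof -
  have "AE t in lborel. P t" using assms by (simp add: AE_completion_iff)
  then obtain N where N: "\<And>x. x \<in> space lborel - N \<Longrightarrow> P x" "N \<in> null_sets lborel"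
    using AE_E3 by metis
  have [measurable]: "N \<in> sets borel" using N(2) by auto
  have "AE x in lborel. x \<notin> N" using N(2) by (rule AE_not_in)
  then have "AE x in lborel. 0 + (-1) * x \<notin> N" by (intro AE_borel_affine) auto
  then have "AE x in lborel. P (- x)" by (rule eventually_mono) (use N(1) in auto)
  then show ?thesis by (simp add: AE_completion_iff)
qed

lemma AE_interval_reflect:
  "(AE t in lebesgue. t \<in> {-b..-a} \<longrightarrow> P (- t)) \<longleftrightarrow> (AE t in lebesgue. t \<in> {a..b} \<longrightarrow> P (t::real))"
proof
  assume "AE t in lebesgue. t \<in> {-b..-a} \<longrightarrow> P (- t)"
  from AE_lebesgue_reflect[OF this] show "AE t in lebesgue. t \<in> {a..b} \<longrightarrow> P t"
    by (rule eventually_mono) auto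
next
  assume "AE t in lebesgue. t \<in> {a..b} \<longrightarrow> P t"
  from AE_lebesgue_reflect[OF this] show "AE t in lebesgue. t \<in> {-b..-a} \<longrightarrow> P (- t)"
    by (rule eventually_mono) auto
qed

lemma frac_int_right_reflect: "frac_int_right \<alpha> b f t = frac_int_left \<alpha> (- b) (\<lambda>x. f (- x)) (- t)"
proof -
  have "(LINT r:{t..b}|lebesgue. (r - t) powr (\<alpha> - 1) * f r) = (LINT r|lebesgue. indicator {t..b} (- r) *\<^sub>R ((- r - t) powr (\<alpha> - 1) * f (- r)))"
    unfolding set_lebesgue_integral_def
    using lebesgue_integral_real_affine[of "-1" "\<lambda>r. indicator {t..b} r *\<^sub>R ((r - t) powr (\<alpha> - 1) * f r)" 0] by simp
  also have "\<dots> = (LINT r:{-b..-t}|lebesgue. (- t - r) powr (\<alpha> - 1) * f (- r))"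
    unfolding set_lebesgue_integral_def
    by (intro Bochner_Integration.integral_cong refl) (auto simp: minus_diff_commute split: split_indicator)
  finally show ?thesis unfolding frac_int_left_def frac_int_right_def by simp
qed

lemma set_integrable_lebesgue_reflect:
  fixes \<phi> :: "real \<Rightarrow> real"
  shows "set_integrable lebesgue {-b..-a} (\<lambda>x. \<phi> (- x)) \<longleftrightarrow> set_integrable lebesgue {a..b} \<phi>"
proof -
  have "(\<lambda>x. indicator {-b..-a} x *\<^sub>R \<phi> (- x)) = (\<lambda>x. indicator {a..b} (0 + (-1) * x) *\<^sub>R \<phi> (0 + (-1) * x))"
    by (auto simp: fun_eq_iff split: split_indicator)
  then show ?thesis
    unfolding set_integrable_def
    using lebesgue_integrable_real_affine_iff[of "-1" "\<lambda>x. indicator {a..b} x *\<^sub>R \<phi> x" 0] by simp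
qed

lemma frac_image_right_reflect:
  "f \<in> frac_image_right \<alpha> a b \<longleftrightarrow> (\<lambda>x. f (- x)) \<in> frac_image_left \<alpha> (- b) (- a)"
proof
  assume "f \<in> frac_image_right \<alpha> a b"
  then obtain \<phi> where \<phi>: "set_integrable lebesgue {a..b} \<phi>" "AE t in lebesgue. t \<in> {a..b} \<longrightarrow> f t = frac_int_right \<alpha> b \<phi> t"
    unfolding frac_image_right_def by auto
  have "AE t in lebesgue. t \<in> {-b..-a} \<longrightarrow> f (- t) = frac_int_left \<alpha> (- b) (\<lambda>x. \<phi> (- x)) t"
    using \<phi>(2)[folded AE_interval_reflect[of b a "\<lambda>t. f t = frac_int_right \<alpha> b \<phi> t"]]
    by (simp add: frac_int_right_reflect)
  then show "(\<lambda>x. f (- x)) \<in> frac_image_left \<alpha> (- b) (- a)"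
    unfolding frac_image_left_def using \<phi>(1) set_integrable_lebesgue_reflect[of b a \<phi>] by blast
next
  assume "(\<lambda>x. f (- x)) \<in> frac_image_left \<alpha> (- b) (- a)"
  then obtain \<phi> where \<phi>: "set_integrable lebesgue {-b..-a} \<phi>" "AE t in lebesgue. t \<in> {-b..-a} \<longrightarrow> f (- t) = frac_int_left \<alpha> (- b) \<phi> t"
    unfolding frac_image_left_def by auto
  have "AE t in lebesgue. t \<in> {a..b} \<longrightarrow> f t = frac_int_right \<alpha> b (\<lambda>x. \<phi> (- x)) t"
    unfolding AE_interval_reflect[of b a "\<lambda>t. f t = frac_int_right \<alpha> b (\<lambda>x. \<phi> (- x)) t", symmetric]
    using \<phi>(2) by (simp add: frac_int_right_reflect)
  then show "f \<in> frac_image_right \<alpha> a b"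
    unfolding frac_image_right_def using \<phi>(1) set_integrable_lebesgue_reflect[of b a "\<lambda>x. \<phi> (- x)"] by auto
qed

lemma frac_image_right_iff:
  assumes \<alpha>: "0 < \<alpha>"
  shows "f \<in> frac_image_right \<alpha> a b \<longleftrightarrow>
     (\<exists>u. L1_on a b u \<and> (AE t in lebesgue. t \<in> {a..b} \<longrightarrow> f t = rl_int_right \<alpha> u t))"
proof -
  have "(\<exists>u. L1_on (- b) (- a) u \<and> (AE t in lebesgue. t \<in> {- b..- a} \<longrightarrow> f (- t) = rl_int \<alpha> u t))
    \<longleftrightarrow> (\<exists>u. L1_on a b u \<and> (AE t in lebesgue. t \<in> {- b..- a} \<longrightarrow> f (- t) = rl_int \<alpha> (\<lambda>x. u (- x)) t))"
  proof safe
    fix u assume "L1_on (- b) (- a) u" "AE t in lebesgue. t \<in> {- b..- a} \<longrightarrow> f (- t) = rl_int \<alpha> u t"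
    then show "\<exists>u. L1_on a b u \<and> (AE t in lebesgue. t \<in> {- b..- a} \<longrightarrow> f (- t) = rl_int \<alpha> (\<lambda>x. u (- x)) t)"
      using L1_on_reflect[of b a "\<lambda>x. u (- x)"] by (intro exI[of _ "\<lambda>x. u (- x)"]) auto
  next
    fix u assume "L1_on a b u" "AE t in lebesgue. t \<in> {- b..- a} \<longrightarrow> f (- t) = rl_int \<alpha> (\<lambda>x. u (- x)) t"
    then show "\<exists>u. L1_on (- b) (- a) u \<and> (AE t in lebesgue. t \<in> {- b..- a} \<longrightarrow> f (- t) = rl_int \<alpha> u t)"
      using L1_on_reflect[of b a u] by (intro exI[of _ "\<lambda>x. u (- x)"]) auto
  qed
  then show ?thesis
    unfolding frac_image_right_reflect frac_image_left_iff[OF \<alpha>]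
    using AE_interval_reflect[of b a "\<lambda>t. f t = rl_int_right \<alpha> _ t"] by (simp add: rl_int_right_def)
qed

text \<open>For \<open>t - \<epsilon> < a\<close> the oriented integral of the extension by \<open>0\<close> is taken backwards over
  \<open>(t - \<epsilon>, a)\<close>, where only \<open>f t\<close> remains. It turns the boundary term into
  \<open>f t * \<epsilon> powr (- \<alpha>)\<close>, in agreement with the other case.\<close>

lemma trunc_left_eq_marchaud_trunc:
  assumes \<alpha>: "0 < \<alpha>" "\<alpha> < 1" and \<epsilon>: "0 < \<epsilon>" and t: "a < t" "t \<le> b"
    and f: "integrable lborel (\<lambda>r. indicator {a..b} r * f r)"
  shows "\<alpha> * trunc_left \<alpha> a b f \<epsilon> t
    = Gamma (1 - \<alpha>) * marchaud_trunc \<alpha> \<epsilon> (\<lambda>r. indicator {a..b} r * f r) t - f t / (t - a) powr \<alpha>"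
proof -
  define F where "F r = indicator {a..b} r * f r" for r
  have F: "integrable lborel F" using f by (simp add: F_def[abs_def])
  then have [measurable]: "F \<in> borel_measurable borel" by (auto dest: borel_measurable_integrable)
  have Ft: "F t = f t" using t by (simp add: F_def)
  have G: "Gamma (1 - \<alpha>) \<noteq> 0" using less_imp_neq[OF Gamma_real_pos[of "1 - \<alpha>"]] \<alpha> by simp
  have tail_F: "integrable lborel (\<lambda>r. marchaud_tail \<alpha> \<epsilon> (t - r) * F r)"
    by (rule marchaud_tail_mult_integrable[OF \<alpha>(1) \<epsilon> F]) measurable
  have power: "integrable lborel (\<lambda>r. indicator {t - u..t - l} r * (\<alpha> * (t - r) powr (- 1 - \<alpha>)))"
      "(LINT r|lborel. indicator {t - u..t - l} r * (\<alpha> * (t - r) powr (- 1 - \<alpha>))) = l powr (- \<alpha>) - u powr (- \<alpha>)"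
    if "0 < l" "l \<le> u" for l u
  proof -
    have e: "(\<lambda>r. indicator {t - u..t - l} r * (\<alpha> * (t - r) powr (- 1 - \<alpha>)))
       = (\<lambda>r. indicator {l..u} (t - r) * (\<alpha> * (t - r) powr (- 1 - \<alpha>)))"
      by (auto simp: fun_eq_iff split: split_indicator)
    show "integrable lborel (\<lambda>r. indicator {t - u..t - l} r * (\<alpha> * (t - r) powr (- 1 - \<alpha>)))"
      unfolding e using powr_tail_integral(1)[OF \<alpha>(1) that]
        integrable_reflect_at[of "\<lambda>h. indicator {l..u} h * (\<alpha> * h powr (- 1 - \<alpha>))" t] by simp
    show "(LINT r|lborel. indicator {t - u..t - l} r * (\<alpha> * (t - r) powr (- 1 - \<alpha>))) = l powr (- \<alpha>) - u powr (- \<alpha>)"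
      unfolding e using powr_tail_integral(2)[OF \<alpha>(1) that]
        integral_reflect_at[of "\<lambda>h. indicator {l..u} h * (\<alpha> * h powr (- 1 - \<alpha>))" t] by simp
  qed
  have inv: "\<alpha> * (c / (t - r) powr (1 + \<alpha>)) = c * (\<alpha> * (t - r) powr (- 1 - \<alpha>))" for r c
    using powr_minus_divide[of "t - r" "1 + \<alpha>"] by simp
  have to_lborel: "\<alpha> * (LINT r:{l<..<u}|lebesgue. (f t - F r) / (t - r) powr (1 + \<alpha>))
     = (LINT r|lborel. indicator {l<..<u} r * ((f t - F r) * (\<alpha> * (t - r) powr (- 1 - \<alpha>))))" for l u
  proof -
    have "\<alpha> * (LINT r:{l<..<u}|lebesgue. (f t - F r) / (t - r) powr (1 + \<alpha>))
      = (LINT r|lebesgue. indicator {l<..<u} r * ((f t - F r) * (\<alpha> * (t - r) powr (- 1 - \<alpha>))))"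
      unfolding set_lebesgue_integral_def inv[symmetric]
      by (subst integral_mult_right_zero[symmetric]) (simp add: mult_ac)
    also have "\<dots> = (LINT r|lborel. indicator {l<..<u} r * ((f t - F r) * (\<alpha> * (t - r) powr (- 1 - \<alpha>))))"
      by (rule integral_completion) measurable
    finally show ?thesis .
  qed
  have main: "\<alpha> * trunc_left \<alpha> a b f \<epsilon> t
     = (\<epsilon> powr (- \<alpha>) - (t - a) powr (- \<alpha>)) * f t - (LINT r|lborel. marchaud_tail \<alpha> \<epsilon> (t - r) * F r)"
  proof (cases "a \<le> t - \<epsilon>")
    case True
    have "\<alpha> * trunc_left \<alpha> a b f \<epsilon> t = \<alpha> * (LINT r:{a<..<t - \<epsilon>}|lebesgue. (f t - F r) / (t - r) powr (1 + \<alpha>))"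
      using True by (simp add: trunc_left_def interval_lebesgue_integral_def F_def)
    also have "\<dots> = (LINT r|lborel. f t * (indicator {t - (t - a)..t - \<epsilon>} r * (\<alpha> * (t - r) powr (- 1 - \<alpha>)))
         - marchaud_tail \<alpha> \<epsilon> (t - r) * F r)"
      unfolding to_lborel
    proof (rule integral_cong_AE)
      show "AE r in lborel. indicator {a<..<t - \<epsilon>} r * ((f t - F r) * (\<alpha> * (t - r) powr (- 1 - \<alpha>)))
         = f t * (indicator {t - (t - a)..t - \<epsilon>} r * (\<alpha> * (t - r) powr (- 1 - \<alpha>))) - marchaud_tail \<alpha> \<epsilon> (t - r) * F r"
        using AE_lborel_singleton[of a] AE_lborel_singleton[of "t - \<epsilon>"]
      proof eventually_elim
        case (elim r)
        then show ?case
          by (cases "r < a") (auto simp: F_def marchaud_tail_def algebra_simps split: split_indicator)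
      qed
    qed auto
    also have "\<dots> = f t * (\<epsilon> powr (- \<alpha>) - (t - a) powr (- \<alpha>)) - (LINT r|lborel. marchaud_tail \<alpha> \<epsilon> (t - r) * F r)"
      using power[of \<epsilon> "t - a"] True \<epsilon> tail_F by (subst Bochner_Integration.integral_diff) auto
    finally show ?thesis by (simp add: mult.commute)
  next
    case False
    have "\<alpha> * trunc_left \<alpha> a b f \<epsilon> t = - (\<alpha> * (LINT r:{t - \<epsilon><..<a}|lebesgue. (f t - F r) / (t - r) powr (1 + \<alpha>)))"
      using False by (simp add: trunc_left_def interval_lebesgue_integral_def F_def)
    also have "\<dots> = - (LINT r|lborel. f t * (indicator {t - \<epsilon>..t - (t - a)} r * (\<alpha> * (t - r) powr (- 1 - \<alpha>))))"
      unfolding to_lborel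
    proof (intro arg_cong[where f=uminus] integral_cong_AE)
      show "AE r in lborel. indicator {t - \<epsilon><..<a} r * ((f t - F r) * (\<alpha> * (t - r) powr (- 1 - \<alpha>)))
         = f t * (indicator {t - \<epsilon>..t - (t - a)} r * (\<alpha> * (t - r) powr (- 1 - \<alpha>)))"
        using AE_lborel_singleton[of a] AE_lborel_singleton[of "t - \<epsilon>"]
        by eventually_elim (auto simp: F_def split: split_indicator)
    qed auto
    also have "\<dots> = - (f t * ((t - a) powr (- \<alpha>) - \<epsilon> powr (- \<alpha>)))"
      using power[of "t - a" \<epsilon>] False t by simp
    also have "(LINT r|lborel. marchaud_tail \<alpha> \<epsilon> (t - r) * F r) = (LINT r::real|lborel. 0)"
      using False by (intro Bochner_Integration.integral_cong refl) (auto simp: marchaud_tail_def F_def)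
    ultimately show ?thesis by (simp add: algebra_simps)
  qed
  have mt: "Gamma (1 - \<alpha>) * marchaud_trunc \<alpha> \<epsilon> F t
      = \<epsilon> powr (- \<alpha>) * f t - (LINT r|lborel. marchaud_tail \<alpha> \<epsilon> (t - r) * F r)"
    using G by (simp add: marchaud_trunc_def Ft)
  have "f t / (t - a) powr \<alpha> = (t - a) powr (- \<alpha>) * f t"
    using powr_minus_divide[of "t - a" \<alpha>] by simp
  then show ?thesis
    unfolding main F_def[symmetric] mt by (simp add: algebra_simps)
qed

lemma trunc_right_reflect:
  "trunc_right \<alpha> a b f \<epsilon> t = trunc_left \<alpha> (- b) (- a) (\<lambda>x. f (- x)) \<epsilon> (- t)"
proof -
  have refl: "(LINT r:{l<..<u}|lebesgue. (f t - indicator {a..b} r * f r) / (r - t) powr (1 + \<alpha>))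
     = (LINT r:{-u<..<-l}|lebesgue. (f (- (- t)) - indicator {-b..-a} r * f (- r)) / (- t - r) powr (1 + \<alpha>))" for l u
  proof -
    have "(LINT r:{l<..<u}|lebesgue. (f t - indicator {a..b} r * f r) / (r - t) powr (1 + \<alpha>))
      = (LINT r|lebesgue. indicator {l<..<u} (- r) *\<^sub>R ((f t - indicator {a..b} (- r) * f (- r)) / (- r - t) powr (1 + \<alpha>)))"
      unfolding set_lebesgue_integral_def
      using lebesgue_integral_real_affine[of "-1" "\<lambda>r. indicator {l<..<u} r *\<^sub>R ((f t - indicator {a..b} r * f r) / (r - t) powr (1 + \<alpha>))" 0] by simp
    also have "\<dots> = (LINT r:{-u<..<-l}|lebesgue. (f (- (- t)) - indicator {-b..-a} r * f (- r)) / (- t - r) powr (1 + \<alpha>))"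
      unfolding set_lebesgue_integral_def
      by (intro Bochner_Integration.integral_cong refl) (auto simp: minus_diff_commute split: split_indicator)
    finally show ?thesis .
  qed
  show ?thesis
    unfolding trunc_right_def trunc_left_def interval_lebesgue_integral_def
    using refl[of "t + \<epsilon>" b] refl[of b "t + \<epsilon>"] by auto
qed

text \<open>The chosen function is some limit, and limits in \<open>L\<^sup>1\<close> are unique almost everywhere. The
  form \<open>k * m \<epsilon> t - q t\<close> separates the convergent truncated derivative from the boundary
  term \<open>q\<close>, which need not be integrable.\<close>

lemma chosen_L1_limit:
  assumes k: "0 < k" and [measurable]: "\<And>\<epsilon>. m \<epsilon> \<in> borel_measurable borel" "q \<in> borel_measurable borel" "u \<in> borel_measurable borel"
    and F: "\<And>\<epsilon>. 0 < \<epsilon> \<Longrightarrow> AE t in lborel. t \<in> {a..b} \<longrightarrow> F \<epsilon> t = k * m \<epsilon> t - q t"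
    and lim: "((\<lambda>\<epsilon>. L1_dist a b (m \<epsilon>) u) \<longlongrightarrow> 0) (at_right 0)"
  shows "AE t in lborel. t \<in> {a..b} \<longrightarrow> (SOME J. L1_limit a b F J) t = k * u t - q t"
proof -
  define J0 where "J0 t = k * u t - q t" for t
  define G where "G \<epsilon> t = k * m \<epsilon> t - q t" for \<epsilon> t
  have [measurable]: "J0 \<in> borel_measurable borel" unfolding J0_def by measurable
  have Gm[measurable]: "G \<epsilon> \<in> borel_measurable borel" for \<epsilon> unfolding G_def by measurable
  have "L1_dist a b (G \<epsilon>) J0 = ennreal k * L1_dist a b (m \<epsilon>) u" for \<epsilon>
  proof -
    have "\<bar>G \<epsilon> t - J0 t\<bar> = k * \<bar>m \<epsilon> t - u t\<bar>" for t
      using k by (simp add: G_def J0_def abs_mult flip: right_diff_distrib)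
    then show ?thesis unfolding L1_dist_def using k
      by (subst nn_integral_cmult[symmetric]) (auto simp: ennreal_mult' mult.assoc)
  qed
  then have limG: "((\<lambda>\<epsilon>. L1_dist a b (G \<epsilon>) J0) \<longlongrightarrow> 0) (at_right 0)"
    using ennreal_tendsto_cmult[OF _ lim, of "ennreal k"] by simp
  have FG: "(\<integral>\<^sup>+ t\<in>{a..b}. ennreal \<bar>F \<epsilon> t - J t\<bar> \<partial>lebesgue) = L1_dist a b (G \<epsilon>) J'"
    if "0 < \<epsilon>" "AE t in lborel. t \<in> {a..b} \<longrightarrow> J t = J' t" for \<epsilon> J J'
    unfolding nn_integral_completion L1_dist_def using F[OF that(1)] that(2)
    by (intro nn_integral_cong_AE, eventually_elim) (auto simp: G_def split: split_indicator)
  have FG_lim: "((\<lambda>\<epsilon>. \<integral>\<^sup>+ t\<in>{a..b}. ennreal \<bar>F \<epsilon> t - J t\<bar> \<partial>lebesgue) \<longlongrightarrow> 0) (at_right 0)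
      \<longleftrightarrow> ((\<lambda>\<epsilon>. L1_dist a b (G \<epsilon>) J') \<longlongrightarrow> 0) (at_right 0)"
    if "AE t in lborel. t \<in> {a..b} \<longrightarrow> J t = J' t" for J J'
    by (intro filterlim_cong refl eventually_mono[OF eventually_at_right_less FG[OF _ that]])
  have "L1_limit a b F J0"
    unfolding L1_limit_def set_borel_measurable_def
  proof
    show "(\<lambda>x. indicator {a..b} x *\<^sub>R J0 x) \<in> borel_measurable lebesgue"
      by (rule measurable_completion) measurable
    show "((\<lambda>\<epsilon>. \<integral>\<^sup>+ t\<in>{a..b}. ennreal \<bar>F \<epsilon> t - J0 t\<bar> \<partial>lebesgue) \<longlongrightarrow> 0) (at_right 0)"
      using FG_lim[of J0 J0] limG by simp
  qed
  then have J: "L1_limit a b F (SOME J. L1_limit a b F J)" by (rule someI[of "L1_limit a b F"])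
  define J where "J = (SOME J. L1_limit a b F J)"
  obtain J' where J'[measurable]: "J' \<in> borel_measurable lborel" and "AE t in lborel. indicator {a..b} t *\<^sub>R J t = J' t"
    using completion_ex_borel_measurable_real[of "\<lambda>x. indicator {a..b} x *\<^sub>R J x" lborel] J
    unfolding L1_limit_def set_borel_measurable_def J_def by blast
  then have JJ': "AE t in lborel. t \<in> {a..b} \<longrightarrow> J t = J' t" by (auto elim!: eventually_mono)
  have "((\<lambda>\<epsilon>. L1_dist a b (G \<epsilon>) J') \<longlongrightarrow> 0) (at_right 0)"
    using FG_lim[OF JJ'] J unfolding L1_limit_def J_def by blast
  then have "AE t in lborel. t \<in> {a..b} \<longrightarrow> J' t = J0 t"
    using limG by (intro L1_dist_limit_unique[where F=G]) auto
  with JJ' show ?thesis unfolding J_def[symmetric] J0_def by eventually_elim auto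
qed

lemma marchaud_cancel:
  fixes x v g \<alpha> :: real
  assumes "0 < \<alpha>" "0 < g"
  shows "1 / g * (x + \<alpha> * (g / \<alpha> * v - x / \<alpha>)) = v"
  using assms by (simp add: field_simps)

lemma frac_deriv_left_AE:
  assumes \<alpha>: "0 < \<alpha>" "\<alpha> < 1" and f: "integrable lborel (\<lambda>r. indicator {a..b} r * f r)"
    and u: "L1_on a b u" and eq: "AE t in lborel. t \<in> {a..b} \<longrightarrow> f t = rl_int \<alpha> u t"
  shows "AE t in lborel. t \<in> {a..b} \<longrightarrow> frac_deriv_left \<alpha> a b f t = u t"
proof -
  define F where "F r = indicator {a..b} r * f r" for r
  have [measurable]: "F \<in> borel_measurable borel" using f by (auto simp: F_def[abs_def] dest: borel_measurable_integrable)
  note [measurable] = L1_onD(2)[OF u]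
  have G: "0 < Gamma (1 - \<alpha>)" using Gamma_real_pos[of "1 - \<alpha>"] \<alpha> by simp
  have "AE t in lborel. t \<in> {a..b} \<longrightarrow> (SOME J. L1_limit a b (trunc_left \<alpha> a b f) J) t
      = Gamma (1 - \<alpha>) / \<alpha> * u t - F t / (t - a) powr \<alpha> / \<alpha>"
  proof (rule chosen_L1_limit[where m="\<lambda>\<epsilon>. marchaud_trunc \<alpha> \<epsilon> F"])
    show "((\<lambda>\<epsilon>. L1_dist a b (marchaud_trunc \<alpha> \<epsilon> F) u) \<longlongrightarrow> 0) (at_right 0)"
      by (rule marchaud_trunc_rl_int_tendsto[OF \<alpha> u])
        (use eq in \<open>auto simp: F_def elim!: eventually_mono\<close>)
    fix \<epsilon> :: real assume \<epsilon>: "0 < \<epsilon>"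
    show "AE t in lborel. t \<in> {a..b} \<longrightarrow> trunc_left \<alpha> a b f \<epsilon> t
       = Gamma (1 - \<alpha>) / \<alpha> * marchaud_trunc \<alpha> \<epsilon> F t - F t / (t - a) powr \<alpha> / \<alpha>"
      using AE_lborel_singleton[of a]
    proof eventually_elim
      case (elim t)
      show ?case
      proof
        assume t: "t \<in> {a..b}"
        then have "\<alpha> * trunc_left \<alpha> a b f \<epsilon> t = Gamma (1 - \<alpha>) * marchaud_trunc \<alpha> \<epsilon> F t - F t / (t - a) powr \<alpha>"
          using trunc_left_eq_marchaud_trunc[OF \<alpha> \<epsilon> _ _ f, of t] elim by (simp add: F_def[abs_def])
        then have "trunc_left \<alpha> a b f \<epsilon> t = (Gamma (1 - \<alpha>) * marchaud_trunc \<alpha> \<epsilon> F t - F t / (t - a) powr \<alpha>) / \<alpha>"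
          using \<alpha> by (simp add: nonzero_eq_divide_eq mult.commute)
        then show "trunc_left \<alpha> a b f \<epsilon> t
          = Gamma (1 - \<alpha>) / \<alpha> * marchaud_trunc \<alpha> \<epsilon> F t - F t / (t - a) powr \<alpha> / \<alpha>"
          by (simp add: diff_divide_distrib)
      qed
    qed
  qed (use \<alpha> G in auto)
  then show ?thesis
  proof eventually_elim
    case (elim t)
    show ?case
    proof
      assume t: "t \<in> {a..b}"
      have Ft: "F t = f t" using t by (simp add: F_def)
      note J = mp[OF elim t, unfolded Ft]
      show "frac_deriv_left \<alpha> a b f t = u t"
        unfolding frac_deriv_left_def J by (rule marchaud_cancel[OF \<alpha>(1) G])
    qed
  qed
qed

lemma AE_lborel_reflect:
  "(AE t in lborel. t \<in> {-b..-a} \<longrightarrow> P (- t)) \<longleftrightarrow> (AE t in lborel. t \<in> {a..b} \<longrightarrow> P (t::real))"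
  using AE_interval_reflect[of b a P] by (simp add: AE_completion_iff)

lemma frac_deriv_right_AE:
  assumes \<alpha>: "0 < \<alpha>" "\<alpha> < 1" and f: "integrable lborel (\<lambda>r. indicator {a..b} r * f r)"
    and u: "L1_on a b u" and eq: "AE t in lborel. t \<in> {a..b} \<longrightarrow> f t = rl_int_right \<alpha> u t"
  shows "AE t in lborel. t \<in> {a..b} \<longrightarrow> frac_deriv_right \<alpha> a b f t = u t"
proof -
  define F where "F r = indicator {-b..-a} r * f (- r)" for r
  have f': "integrable lborel F"
  proof -
    have "F = (\<lambda>r. indicator {a..b} (0 - r) * f (0 - r))" by (auto simp: F_def fun_eq_iff split: split_indicator)
    then show ?thesis using f integrable_reflect_at[of "\<lambda>r. indicator {a..b} r * f r" 0] by simp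
  qed
  then have [measurable]: "F \<in> borel_measurable borel" by (auto dest: borel_measurable_integrable)
  have F_left: "F t = 0" if "t < - b" for t using that by (simp add: F_def)
  note [measurable] = L1_onD(2)[OF u]
  have G: "0 < Gamma (1 - \<alpha>)" using Gamma_real_pos[of "1 - \<alpha>"] \<alpha> by simp
  have u': "L1_on (- b) (- a) (\<lambda>x. u (- x))" using u by (simp add: L1_on_reflect)
  have eq': "AE t in lborel. t \<in> {-b..-a} \<longrightarrow> F t = rl_int \<alpha> (\<lambda>x. u (- x)) t"
    using eq[folded AE_lborel_reflect[of b a "\<lambda>t. f t = rl_int_right \<alpha> u t"]]
    by eventually_elim (auto simp: F_def rl_int_right_def)
  have "AE t in lborel. t \<in> {a..b} \<longrightarrow> (SOME J. L1_limit a b (trunc_right \<alpha> a b f) J) t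
      = Gamma (1 - \<alpha>) / \<alpha> * u t - F (- t) / (b - t) powr \<alpha> / \<alpha>"
  proof (rule chosen_L1_limit[where m="\<lambda>\<epsilon> t. marchaud_trunc \<alpha> \<epsilon> F (- t)"])
    have "L1_dist a b (\<lambda>t. marchaud_trunc \<alpha> \<epsilon> F (- t)) u = L1_dist (- b) (- a) (marchaud_trunc \<alpha> \<epsilon> F) (\<lambda>x. u (- x))" for \<epsilon>
    proof -
      have "L1_dist a b (\<lambda>t. marchaud_trunc \<alpha> \<epsilon> F (- t)) u
        = (\<integral>\<^sup>+t. ennreal \<bar>marchaud_trunc \<alpha> \<epsilon> F (- (0 - t)) - u (0 - t)\<bar> * indicator {a..b} (0 - t) \<partial>lborel)"
        unfolding L1_dist_def by (rule nn_integral_reflect[symmetric]) measurable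
      also have "\<dots> = L1_dist (- b) (- a) (marchaud_trunc \<alpha> \<epsilon> F) (\<lambda>x. u (- x))"
        unfolding L1_dist_def by (intro nn_integral_cong) (auto split: split_indicator)
      finally show ?thesis .
    qed
    then show "((\<lambda>\<epsilon>. L1_dist a b (\<lambda>t. marchaud_trunc \<alpha> \<epsilon> F (- t)) u) \<longlongrightarrow> 0) (at_right 0)"
      using marchaud_trunc_rl_int_tendsto[OF \<alpha> u' _ F_left eq'] by simp
    fix \<epsilon> :: real assume \<epsilon>: "0 < \<epsilon>"
    show "AE t in lborel. t \<in> {a..b} \<longrightarrow> trunc_right \<alpha> a b f \<epsilon> t
       = Gamma (1 - \<alpha>) / \<alpha> * marchaud_trunc \<alpha> \<epsilon> F (- t) - F (- t) / (b - t) powr \<alpha> / \<alpha>"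
      using AE_lborel_singleton[of b]
    proof eventually_elim
      case (elim t)
      show ?case
      proof
        assume t: "t \<in> {a..b}"
        then have "\<alpha> * trunc_right \<alpha> a b f \<epsilon> t = Gamma (1 - \<alpha>) * marchaud_trunc \<alpha> \<epsilon> F (- t) - F (- t) / (b - t) powr \<alpha>"
          using trunc_left_eq_marchaud_trunc[OF \<alpha> \<epsilon> _ _ f'[unfolded F_def[abs_def]], of "- t"] elim
          by (simp add: F_def[abs_def] trunc_right_reflect)
        then have "trunc_right \<alpha> a b f \<epsilon> t = (Gamma (1 - \<alpha>) * marchaud_trunc \<alpha> \<epsilon> F (- t) - F (- t) / (b - t) powr \<alpha>) / \<alpha>"
          using \<alpha> by (simp add: nonzero_eq_divide_eq mult.commute)
        then show "trunc_right \<alpha> a b f \<epsilon> t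
          = Gamma (1 - \<alpha>) / \<alpha> * marchaud_trunc \<alpha> \<epsilon> F (- t) - F (- t) / (b - t) powr \<alpha> / \<alpha>"
          by (simp add: diff_divide_distrib)
      qed
    qed
  qed (use \<alpha> G in auto)
  then show ?thesis
  proof eventually_elim
    case (elim t)
    show ?case
    proof
      assume t: "t \<in> {a..b}"
      have Ft: "F (- t) = f t" using t by (simp add: F_def)
      note J = mp[OF elim t, unfolded Ft]
      show "frac_deriv_right \<alpha> a b f t = u t"
        unfolding frac_deriv_right_def J by (rule marchaud_cancel[OF \<alpha>(1) G])
    qed
  qed
qed

section \<open>The fractional integral against a Hoelder path\<close>

text \<open>The integrals of \<open>f\<close> against the difference quotients of \<open>g\<close>, where \<open>g\<close> is extended beyond
  \<open>b\<close> by its value at \<open>b\<close>. Their limit identifies the fractional integral for every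
  admissible exponent.\<close>

definition difference_quotient :: "real \<Rightarrow> real \<Rightarrow> (real \<Rightarrow> real) \<Rightarrow> (real \<Rightarrow> real) \<Rightarrow> real \<Rightarrow> real" where
  "difference_quotient a b f g \<epsilon> = (LINT r|lborel. indicator {a..b} r * f r * (g (min (r + \<epsilon>) b) - g r)) / \<epsilon>"

lemma continuous_on_ext:
  fixes f :: "real \<Rightarrow> real"
  assumes "continuous_on {a..b} f"
  shows "integrable lborel (\<lambda>r. indicator {a..b} r * f r)"
    and "(\<lambda>r. indicator {a..b} r * f r) \<in> borel_measurable borel"
proof -
  show "integrable lborel (\<lambda>r. indicator {a..b} r * f r)"
    using borel_integrable_compact[OF compact_Icc assms] by (simp add: mult.commute)
  then show "(\<lambda>r. indicator {a..b} r * f r) \<in> borel_measurable borel"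
    by (auto dest: borel_measurable_integrable)
qed

lemma L1_on_ext:
  assumes "continuous_on {a..b} f"
  shows "L1_on a b (\<lambda>r. indicator {a..b} r * f r)"
  using continuous_on_ext(1)[OF assms] by (simp add: L1_on_def)

text \<open>The bound on Marchaud's derivative of order \<open>s\<close> for Hoelder paths of order \<open>\<gamma>\<close> with
  constant \<open>1\<close> on an interval of length \<open>1\<close>; see \<open>holder_rl_int_right\<close>.\<close>

definition holder_const :: "real \<Rightarrow> real \<Rightarrow> real" where
  "holder_const s \<gamma> = s / Gamma (1 - s) * (1 / (\<gamma> - s) + 1 / s)"

text \<open>Reflection turns \<open>g - g b\<close> into a function that vanishes at the left endpoint. Its
  extension by \<open>0\<close> is therefore Hoelder up to the right endpoint, and Marchaud's integral
  converges absolutely with a uniform bound.\<close>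

lemma holder_rl_int_right:
  fixes g :: "real \<Rightarrow> real"
  assumes ab: "a < b" and s: "0 < s" "s < \<gamma>" "s < 1" and H: "0 \<le> H"
    and hol: "\<And>r t. r \<in> {a..b} \<Longrightarrow> t \<in> {a..b} \<Longrightarrow> \<bar>g t - g r\<bar> \<le> H * \<bar>t - r\<bar> powr \<gamma>"
    and cont: "continuous_on {a..b} g"
  shows "\<exists>\<psi>. L1_on a b \<psi> \<and> (\<forall>t. \<bar>\<psi> t\<bar> \<le> holder_const s \<gamma> * H * (b - a) powr (\<gamma> - s)) \<and>
     (AE t in lborel. t \<in> {a..b} \<longrightarrow> g t - g b = rl_int_right s \<psi> t)"
proof -
  define L where "L = b - a"
  have L: "0 < L" using ab by (simp add: L_def)
  define F where "F t = indicator {-b..-a} t * (g (- t) - g b)" for t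
  have "continuous_on {-b..-a} (\<lambda>t. g (- t) - g b)"
    using cont by (intro continuous_intros continuous_on_compose2[OF cont]) auto
  then have F: "L1_on (- b) (- a) F" unfolding F_def[abs_def] by (rule L1_on_ext)
  note [measurable] = L1_onD(2)[OF F]
  have F_diff: "\<bar>F t - F (t - h)\<bar> \<le> H * min h L powr \<gamma>" if t: "t \<in> {-b..-a}" and h: "0 < h" for t h
  proof (cases "- b \<le> t - h")
    case True
    then have "min h L = h" using t by (auto simp: L_def min_def)
    moreover have "F t - F (t - h) = g (- t) - g (h - t)" using True t h by (simp add: F_def)
    ultimately show ?thesis using hol[of "h - t" "- t"] True t h by simp
  next
    case False
    then have "F t - F (t - h) = g (- t) - g b" using t by (simp add: F_def)
    also have "\<bar>\<dots>\<bar> \<le> H * \<bar>- t - b\<bar> powr \<gamma>" using hol[of b "- t"] t by auto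
    also have "\<dots> \<le> H * min h L powr \<gamma>"
      using False t h H s by (intro mult_left_mono powr_mono2) (auto simp: L_def)
    finally show ?thesis .
  qed
  define K where "K = H * (L powr (\<gamma> - s) * (1 / (\<gamma> - s) + 1 / s))"
  have inner: "(\<integral>\<^sup>+h\<in>{0<..}. ennreal (\<bar>F t - F (t - h)\<bar> * h powr (- 1 - s)) \<partial>lborel) \<le> ennreal K"
    if t: "t \<in> {-b..-a}" for t
  proof -
    have "(\<integral>\<^sup>+h\<in>{0<..}. ennreal (\<bar>F t - F (t - h)\<bar> * h powr (- 1 - s)) \<partial>lborel)
       \<le> (\<integral>\<^sup>+h. ennreal H * (ennreal (min h L powr \<gamma> * h powr (- 1 - s)) * indicator {0<..} h) \<partial>lborel)"
      using F_diff[OF t] H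
      by (intro nn_integral_mono)
        (auto simp: ennreal_mult'[symmetric] mult.assoc[symmetric] intro!: ennreal_leI mult_right_mono split: split_indicator)
    also have "\<dots> = ennreal H * (\<integral>\<^sup>+h\<in>{0<..}. ennreal (min h L powr \<gamma> * h powr (- 1 - s)) \<partial>lborel)"
      by (rule nn_integral_cmult) measurable
    also have "\<dots> \<le> ennreal H * ennreal (L powr (\<gamma> - s) * (1 / (\<gamma> - s) + 1 / s))"
      by (intro mult_left_mono min_powr_integral s L) auto
    also have "\<dots> = ennreal K" using H by (simp add: K_def ennreal_mult')
    finally show ?thesis .
  qed
  have "frac_energy s (- b) (- a) F \<le> (\<integral>\<^sup>+t\<in>{-b..-a}. ennreal K \<partial>lborel)"
    unfolding frac_energy_def by (intro nn_integral_mono) (auto split: split_indicator simp: inner)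
  also have "\<dots> < \<infinity>"
    using emeasure_lborel_Icc_eq[of "-b" "-a"] by (simp add: nn_integral_cmult_indicator ennreal_mult_less_top)
  finally have fin: "frac_energy s (- b) (- a) F < \<infinity>" .
  define \<psi>' where "\<psi>' t = indicator {-b..-a} t * marchaud s F t" for t
  have \<psi>': "L1_on (- b) (- a) \<psi>'" unfolding \<psi>'_def by (rule marchaud_L1[OF s(1,3) F fin])
  have G: "0 < Gamma (1 - s)" using s by (intro Gamma_real_pos) auto
  have K0: "0 \<le> K" using H s L by (simp add: K_def)
  have bound: "\<bar>\<psi>' t\<bar> \<le> s / Gamma (1 - s) * K" for t
  proof (cases "t \<in> {-b..-a}")
    case True
    have "ennreal \<bar>marchaud s F t\<bar> \<le> ennreal (s / Gamma (1 - s)) * ennreal K"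
      by (rule order_trans[OF marchaud_bound[OF _ s(1,3)] mult_left_mono[OF inner[OF True]]]) auto
    also have "\<dots> = ennreal (s / Gamma (1 - s) * K)" using s G by (intro ennreal_mult'[symmetric]) auto
    finally show ?thesis using True s G K0 by (simp add: \<psi>'_def ennreal_le_iff)
  next
    case False then show ?thesis using s G K0 by (simp add: \<psi>'_def)
  qed
  define \<psi> where "\<psi> t = \<psi>' (- t)" for t
  have "L1_on a b \<psi>" using \<psi>' L1_on_reflect[of b a \<psi>] by (simp add: \<psi>_def)
  moreover have "\<bar>\<psi> t\<bar> \<le> holder_const s \<gamma> * H * (b - a) powr (\<gamma> - s)" for t
    using bound[of "- t"] by (simp add: \<psi>_def K_def holder_const_def L_def mult_ac)
  moreover have "AE t in lborel. t \<in> {a..b} \<longrightarrow> g t - g b = rl_int_right s \<psi> t"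
  proof -
    have "AE t in lborel. t \<in> {-b..-a} \<longrightarrow> g (- t) - g b = rl_int_right s \<psi> (- t)"
      using rl_int_marchaud[OF s(1,3) F fin, folded \<psi>'_def]
      by eventually_elim (auto simp: F_def rl_int_right_def \<psi>_def)
    then show ?thesis using AE_lborel_reflect[of b a "\<lambda>t. g t - g b = rl_int_right s \<psi> t"] by simp
  qed
  ultimately show ?thesis by blast
qed

lemma rl_int_right_unique:
  assumes "0 < \<alpha>" "\<alpha> < 1" "L1_on a b \<phi>" "L1_on a b \<psi>"
    and eq: "AE t in lborel. t \<in> {a..b} \<longrightarrow> rl_int_right \<alpha> \<phi> t = rl_int_right \<alpha> \<psi> t"
  shows "AE t in lborel. t \<in> {a..b} \<longrightarrow> \<phi> t = \<psi> t"
proof -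
  have "AE t in lborel. t \<in> {-b..-a} \<longrightarrow> \<phi> (- t) = \<psi> (- t)"
  proof (rule rl_int_unique[OF assms(1,2)])
    show "AE t in lborel. t \<in> {-b..-a} \<longrightarrow> rl_int \<alpha> (\<lambda>t. \<phi> (- t)) t = rl_int \<alpha> (\<lambda>t. \<psi> (- t)) t"
      using eq[folded AE_lborel_reflect[of b a "\<lambda>t. rl_int_right \<alpha> \<phi> t = rl_int_right \<alpha> \<psi> t"]]
      by (simp add: rl_int_right_def)
  qed (use assms in \<open>auto simp: L1_on_reflect\<close>)
  then show ?thesis using AE_lborel_reflect[of b a "\<lambda>t. \<phi> t = \<psi> t"] by simp
qed

lemma difference_quotient_tendsto:
  assumes ab: "a < b" and \<alpha>: "0 < \<alpha>" "\<alpha> < 1" and \<phi>: "L1_on a b \<phi>" and \<psi>: "L1_on a b \<psi>"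
    and B: "\<And>t. \<bar>\<psi> t\<bar> \<le> B" and f: "continuous_on {a..b} f" and g: "continuous_on {a..b} g"
    and f_eq: "AE t in lborel. t \<in> {a..b} \<longrightarrow> f t = rl_int \<alpha> \<phi> t"
    and g_eq: "AE t in lborel. t \<in> {a..b} \<longrightarrow> g t - g b = rl_int_right (1 - \<alpha>) \<psi> t"
  shows "(difference_quotient a b f g \<longlongrightarrow> - (LINT t|lborel. \<phi> t * \<psi> t)) (at_right 0)"
proof -
  define F where "F t = indicator {a..b} t * f t" for t
  define G where "G t = indicator {a..b} t * (g t - g b)" for t
  have [measurable]: "F \<in> borel_measurable borel" using continuous_on_ext(2)[OF f] by (simp add: F_def[abs_def])
  have "continuous_on {a..b} (\<lambda>t. g t - g b)" by (intro continuous_intros g)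
  from continuous_on_ext(2)[OF this] have [measurable]: "G \<in> borel_measurable borel" by (simp add: G_def[abs_def])
  note [measurable] = L1_onD(2)[OF \<phi>] L1_onD(2)[OF \<psi>]
  have F_eq: "AE t in lborel. t \<le> b \<longrightarrow> F t = rl_int \<alpha> \<phi> t"
    using f_eq
  proof eventually_elim
    case (elim t)
    have "rl_int \<alpha> \<phi> t = 0" if "t < a" using that L1_onD(3)[OF \<phi>] by (intro rl_int_left_zero[of a]) auto
    then show ?case using elim by (cases "t < a") (auto simp: F_def)
  qed
  have R0: "rl_int_right (1 - \<alpha>) \<psi> t = 0" if "b \<le> t" for t
    using that L1_onD(4)[OF \<psi>] by (intro rl_int_right_zero[of b]) auto
  have G_eq: "AE t in lborel. a \<le> t \<longrightarrow> G t = rl_int_right (1 - \<alpha>) \<psi> t"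
    using g_eq by eventually_elim (use R0 in \<open>auto simp: G_def not_le split: split_indicator\<close>)
  have "difference_quotient a b f g \<epsilon>
    = (LINT r|lborel. rl_int \<alpha> \<phi> r * (rl_int_right (1 - \<alpha>) \<psi> (r + \<epsilon>) - rl_int_right (1 - \<alpha>) \<psi> r)) / \<epsilon>" if \<epsilon>: "0 < \<epsilon>" for \<epsilon>
  proof -
    have "AE r in lborel. a \<le> \<epsilon> + 1 * r \<longrightarrow> G (\<epsilon> + 1 * r) = rl_int_right (1 - \<alpha>) \<psi> (\<epsilon> + 1 * r)"
      by (rule AE_borel_affine[OF _ _ G_eq]) auto
    then have ae: "AE r in lborel. F r * (G (r + \<epsilon>) - G r)
       = rl_int \<alpha> \<phi> r * (rl_int_right (1 - \<alpha>) \<psi> (r + \<epsilon>) - rl_int_right (1 - \<alpha>) \<psi> r)"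
      using F_eq G_eq
    proof eventually_elim
      case (elim r)
      consider "r < a" | "r \<in> {a..b}" | "b < r" by fastforce
      then show ?case
      proof cases
        case 1
        then have "rl_int \<alpha> \<phi> r = 0" using L1_onD(3)[OF \<phi>] by (intro rl_int_left_zero[of a]) auto
        then show ?thesis using 1 by (simp add: F_def)
      next
        case 2
        then show ?thesis using elim \<epsilon> by (simp add: add.commute)
      next
        case 3
        then show ?thesis using R0[of r] R0[of "r + \<epsilon>"] \<epsilon> by (simp add: F_def)
      qed
    qed
    have "difference_quotient a b f g \<epsilon> = (LINT r|lborel. F r * (G (r + \<epsilon>) - G r)) / \<epsilon>"
      unfolding difference_quotient_def using \<epsilon>
      by (intro arg_cong2[where f="(/)"] Bochner_Integration.integral_cong refl)
        (auto simp: F_def G_def min_def split: split_indicator)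
    also have "(LINT r|lborel. F r * (G (r + \<epsilon>) - G r))
       = (LINT r|lborel. rl_int \<alpha> \<phi> r * (rl_int_right (1 - \<alpha>) \<psi> (r + \<epsilon>) - rl_int_right (1 - \<alpha>) \<psi> r))"
      by (rule integral_cong_AE[OF _ _ ae]) measurable
    finally show ?thesis .
  qed
  then have "\<forall>\<^sub>F \<epsilon> in at_right 0. (LINT r|lborel. rl_int \<alpha> \<phi> r * (rl_int_right (1 - \<alpha>) \<psi> (r + \<epsilon>) - rl_int_right (1 - \<alpha>) \<psi> r)) / \<epsilon>
     = difference_quotient a b f g \<epsilon>"
    by (intro eventually_mono[OF eventually_at_right_less]) simp
  with rl_int_difference_quotient[OF \<alpha> \<phi> \<psi> B] show ?thesis
    by (rule Lim_transform_eventually)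
qed

lemma left_centred_eq:
  fixes g :: "real \<Rightarrow> real"
  assumes "a < b" "continuous_on {a..b} g"
  shows "left_centred b g = (\<lambda>r. g r - g b)"
proof -
  have "(g \<longlongrightarrow> g b) (at b within {a..b})" using assms by (simp add: continuous_on_def)
  then have "(g \<longlongrightarrow> g b) (at_left b)" using assms(1) by (simp add: at_within_Icc_at_left)
  then have "Lim (at_left b) g = g b" by (intro tendsto_Lim) auto
  then show ?thesis by (simp add: left_centred_def fun_eq_iff)
qed

lemma frac_derivs:
  assumes ab: "a < b" and f: "continuous_on {a..b} f" and g: "continuous_on {a..b} g" and \<alpha>: "0 < \<alpha>" "\<alpha> < 1"
    and \<phi>: "L1_on a b \<phi>" and \<psi>: "L1_on a b \<psi>"
    and f_eq: "AE t in lborel. t \<in> {a..b} \<longrightarrow> f t = rl_int \<alpha> \<phi> t"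
    and g_eq: "AE t in lborel. t \<in> {a..b} \<longrightarrow> g t - g b = rl_int_right (1 - \<alpha>) \<psi> t"
  shows "AE t in lborel. indicator {a..b} t *\<^sub>R (frac_deriv_left \<alpha> a b f t * frac_deriv_right (1 - \<alpha>) a b (left_centred b g) t) = \<phi> t * \<psi> t"
proof -
  have c: "continuous_on {a..b} (\<lambda>r. g r - g b)" by (intro continuous_intros g)
  have "AE t in lborel. t \<in> {a..b} \<longrightarrow> frac_deriv_left \<alpha> a b f t = \<phi> t"
    by (rule frac_deriv_left_AE[OF \<alpha> continuous_on_ext(1)[OF f] \<phi> f_eq])
  moreover have "AE t in lborel. t \<in> {a..b} \<longrightarrow> frac_deriv_right (1 - \<alpha>) a b (left_centred b g) t = \<psi> t"
    unfolding left_centred_eq[OF ab g]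
    by (rule frac_deriv_right_AE[OF _ _ continuous_on_ext(1)[OF c] \<psi> g_eq]) (use \<alpha> in auto)
  ultimately show ?thesis
    by eventually_elim (use L1_onD(3,4)[OF \<phi>] in \<open>auto simp: not_le split: split_indicator\<close>)
qed

lemma lebesgue_measurable_AE:
  assumes f: "f \<in> borel_measurable lebesgue" and ae: "AE x in lebesgue. f x = g x"
  shows "g \<in> borel_measurable lebesgue"
proof (rule measurableI)
  fix A :: "'b set" assume "A \<in> sets borel"
  then have "f -` A \<inter> space lebesgue \<in> sets lebesgue" using f by (rule measurable_sets[rotated])
  moreover have "AE x in lebesgue. x \<in> f -` A \<inter> space lebesgue \<longleftrightarrow> x \<in> g -` A \<inter> space lebesgue"
    using ae by eventually_elim simp
  ultimately show "g -` A \<inter> space lebesgue \<in> sets lebesgue"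
    using completion.in_sets_AE by blast
qed simp

lemma frac_integrable_expI:
  assumes ab: "a < b" and f: "continuous_on {a..b} f" and g: "continuous_on {a..b} g" and \<alpha>: "0 < \<alpha>" "\<alpha> < 1"
    and \<phi>: "L1_on a b \<phi>" and \<psi>: "L1_on a b \<psi>" and int: "integrable lborel (\<lambda>t. \<phi> t * \<psi> t)"
    and f_eq: "AE t in lborel. t \<in> {a..b} \<longrightarrow> f t = rl_int \<alpha> \<phi> t"
    and g_eq: "AE t in lborel. t \<in> {a..b} \<longrightarrow> g t - g b = rl_int_right (1 - \<alpha>) \<psi> t"
  shows "frac_integrable_exp \<alpha> a b f g"
  unfolding frac_integrable_exp_def
proof (intro conjI \<alpha>)
  have AEl: "(AE t in lebesgue. P t) \<longleftrightarrow> (AE t in lborel. P t)" for P :: "real \<Rightarrow> bool" by (rule AE_completion_iff)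
  show "f \<in> frac_image_left \<alpha> a b" unfolding frac_image_left_iff[OF \<alpha>(1)] AEl using \<phi> f_eq by blast
  have "0 < 1 - \<alpha>" using \<alpha> by simp
  then show "left_centred b g \<in> frac_image_right (1 - \<alpha>) a b"
    using frac_image_right_iff[of "1 - \<alpha>"] unfolding left_centred_eq[OF ab g] AEl using \<psi> g_eq by blast
  let ?p = "\<lambda>t. indicator {a..b} t *\<^sub>R (frac_deriv_left \<alpha> a b f t * frac_deriv_right (1 - \<alpha>) a b (left_centred b g) t)"
  have ae: "AE t in lebesgue. ?p t = \<phi> t * \<psi> t"
    unfolding AEl by (rule frac_derivs[OF ab f g \<alpha> \<phi> \<psi> f_eq g_eq])
  have il: "integrable lebesgue (\<lambda>t. \<phi> t * \<psi> t)"
    using int by (subst integrable_completion) (auto dest: borel_measurable_integrable)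
  have "?p \<in> borel_measurable lebesgue"
    using lebesgue_measurable_AE[OF borel_measurable_integrable[OF il], of ?p] ae by (simp add: eq_commute)
  then show "set_integrable lebesgue {a..b} (\<lambda>t. frac_deriv_left \<alpha> a b f t * frac_deriv_right (1 - \<alpha>) a b (left_centred b g) t)"
    unfolding set_integrable_def
    using integrable_cong_AE[OF _ borel_measurable_integrable[OF il] ae] il by blast
qed

text \<open>The fractional integral for an admissible exponent is minus the integral of the product of
  the two densities, whatever limits in \<open>L\<^sup>1\<close> the derivatives are represented by.\<close>

lemma frac_integrable_expD:
  assumes ab: "a < b" and f: "continuous_on {a..b} f" and g: "continuous_on {a..b} g"
    and exp: "frac_integrable_exp \<alpha> a b f g"
  obtains \<phi> \<psi> where "L1_on a b \<phi>" "L1_on a b \<psi>" "integrable lborel (\<lambda>t. \<phi> t * \<psi> t)"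
    "AE t in lborel. t \<in> {a..b} \<longrightarrow> f t = rl_int \<alpha> \<phi> t"
    "AE t in lborel. t \<in> {a..b} \<longrightarrow> g t - g b = rl_int_right (1 - \<alpha>) \<psi> t"
    "(LINT r:{a..b}|lebesgue. frac_deriv_left \<alpha> a b f r * frac_deriv_right (1 - \<alpha>) a b (left_centred b g) r)
      = (LINT t|lborel. \<phi> t * \<psi> t)"
proof -
  have AEl: "(AE t in lebesgue. P t) \<longleftrightarrow> (AE t in lborel. P t)" for P :: "real \<Rightarrow> bool" by (rule AE_completion_iff)
  have \<alpha>: "0 < \<alpha>" "\<alpha> < 1" "0 < 1 - \<alpha>" using exp by (auto simp: frac_integrable_exp_def)
  obtain \<phi> where \<phi>: "L1_on a b \<phi>" "AE t in lborel. t \<in> {a..b} \<longrightarrow> f t = rl_int \<alpha> \<phi> t"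
    using exp unfolding frac_integrable_exp_def frac_image_left_iff[OF \<alpha>(1)] AEl by blast
  obtain \<psi> where \<psi>: "L1_on a b \<psi>" "AE t in lborel. t \<in> {a..b} \<longrightarrow> g t - g b = rl_int_right (1 - \<alpha>) \<psi> t"
    using exp unfolding frac_integrable_exp_def frac_image_right_iff[OF \<alpha>(3)] AEl left_centred_eq[OF ab g] by blast
  let ?p = "\<lambda>t. indicator {a..b} t *\<^sub>R (frac_deriv_left \<alpha> a b f t * frac_deriv_right (1 - \<alpha>) a b (left_centred b g) t)"
  have ae: "AE t in lebesgue. ?p t = \<phi> t * \<psi> t"
    unfolding AEl by (rule frac_derivs[OF ab f g \<alpha>(1,2) \<phi>(1) \<psi>(1) \<phi>(2) \<psi>(2)])
  have int: "integrable lebesgue ?p" using exp by (simp add: frac_integrable_exp_def set_integrable_def)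
  have m: "(\<lambda>t. \<phi> t * \<psi> t) \<in> borel_measurable lborel" using L1_onD(2)[OF \<phi>(1)] L1_onD(2)[OF \<psi>(1)] by simp
  have ml: "(\<lambda>t. \<phi> t * \<psi> t) \<in> borel_measurable lebesgue" by (rule measurable_completion[OF m])
  have "integrable lebesgue (\<lambda>t. \<phi> t * \<psi> t)"
    using integrable_cong_AE[OF borel_measurable_integrable[OF int] ml ae] int by blast
  then have "integrable lborel (\<lambda>t. \<phi> t * \<psi> t)" using integrable_completion[OF m] by blast
  moreover have "(LINT r:{a..b}|lebesgue. frac_deriv_left \<alpha> a b f r * frac_deriv_right (1 - \<alpha>) a b (left_centred b g) r)
      = (LINT t|lborel. \<phi> t * \<psi> t)"
    unfolding set_lebesgue_integral_def
    using integral_cong_AE[OF borel_measurable_integrable[OF int] ml ae] integral_completion[OF m] by simp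
  ultimately show ?thesis using that \<phi> \<psi> by blast
qed

lemma rl_int_semigroup_AE:
  assumes "0 < \<alpha>" "0 < \<beta>" and u: "L1_on a b u"
  shows "AE t in lborel. t \<in> {a..b} \<longrightarrow> rl_int \<alpha> (\<lambda>t. indicator {a..b} t * rl_int \<beta> u t) t = rl_int (\<alpha> + \<beta>) u t"
proof -
  have "0 < \<alpha> + \<beta>" using assms by simp
  from L1_on_rl_int_integrable[OF this u, of b] show ?thesis
  proof eventually_elim
    case (elim t)
    show ?case
    proof
      assume t: "t \<in> {a..b}"
      have "rl_int \<alpha> (\<lambda>t. indicator {a..b} t * rl_int \<beta> u t) t = rl_int \<alpha> (rl_int \<beta> u) t"
        unfolding rl_int_def[of \<alpha>] using t rl_int_left_zero[of a u _ \<beta>] L1_onD(3)[OF u]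
        by (intro Bochner_Integration.integral_cong refl) (auto simp: rl_kernel_def not_le split: split_indicator)
      also have "\<dots> = rl_int (\<alpha> + \<beta>) u t"
        using elim t by (intro rl_int_semigroup assms L1_onD(2)[OF u]) auto
      finally show "rl_int \<alpha> (\<lambda>t. indicator {a..b} t * rl_int \<beta> u t) t = rl_int (\<alpha> + \<beta>) u t" .
    qed
  qed
qed

lemma rl_int_right_L1_on:
  assumes "0 < \<alpha>" "L1_on a b u"
  shows "L1_on a b (\<lambda>t. indicator {a..b} t * rl_int_right \<alpha> u t)"
proof -
  have "L1_on (- b) (- a) (\<lambda>t. indicator {-b..-a} t * rl_int \<alpha> (\<lambda>x. u (- x)) t)"
    using assms by (intro rl_int_L1_on) (auto simp: L1_on_reflect)
  moreover have "(\<lambda>t. indicator {-b..-a} t * rl_int \<alpha> (\<lambda>x. u (- x)) t) = (\<lambda>x. indicator {a..b} (- x) * rl_int_right \<alpha> u (- x))"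
    by (auto simp: rl_int_right_def fun_eq_iff split: split_indicator)
  ultimately show ?thesis using L1_on_reflect[of b a "\<lambda>t. indicator {a..b} t * rl_int_right \<alpha> u t"] by simp
qed

lemma rl_int_right_semigroup_AE:
  assumes "0 < \<alpha>" "0 < \<beta>" and u: "L1_on a b u"
  shows "AE t in lborel. t \<in> {a..b} \<longrightarrow>
     rl_int_right \<alpha> (\<lambda>t. indicator {a..b} t * rl_int_right \<beta> u t) t = rl_int_right (\<alpha> + \<beta>) u t"
proof -
  have e: "(\<lambda>x. indicator {a..b} (- x) * rl_int_right \<beta> u (- x)) = (\<lambda>t. indicator {-b..-a} t * rl_int \<beta> (\<lambda>x. u (- x)) t)"
    by (auto simp: rl_int_right_def fun_eq_iff split: split_indicator)
  have "AE t in lborel. t \<in> {-b..-a} \<longrightarrow>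
     rl_int_right \<alpha> (\<lambda>t. indicator {a..b} t * rl_int_right \<beta> u t) (- t) = rl_int_right (\<alpha> + \<beta>) u (- t)"
    using rl_int_semigroup_AE[OF assms(1,2), of "-b" "-a" "\<lambda>x. u (- x)"] u
    unfolding rl_int_right_def[of \<alpha>] rl_int_right_def[of "\<alpha> + \<beta>"] e by (simp add: L1_on_reflect)
  then show ?thesis
    using AE_lborel_reflect[of b a "\<lambda>t. rl_int_right \<alpha> (\<lambda>t. indicator {a..b} t * rl_int_right \<beta> u t) t = rl_int_right (\<alpha> + \<beta>) u t"]
    by simp
qed

lemma integral_mult_cong_AE:
  assumes "L1_on a b f" "L1_on a b f'" "L1_on a b g" "L1_on a b g'"
    "AE t in lborel. t \<in> {a..b} \<longrightarrow> f t = f' t" "AE t in lborel. t \<in> {a..b} \<longrightarrow> g t = g' t"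
  shows "AE t in lborel. f t * g t = f' t * g' t" "(LINT t|lborel. f t * g t) = (LINT t|lborel. f' t * g' t)"
proof -
  show ae: "AE t in lborel. f t * g t = f' t * g' t"
    using assms(5,6)
  proof eventually_elim
    case (elim t)
    then show ?case using L1_onD(3,4)[OF assms(1), of t] L1_onD(3,4)[OF assms(2), of t]
      by (cases "t \<in> {a..b}") auto
  qed
  show "(LINT t|lborel. f t * g t) = (LINT t|lborel. f' t * g' t)"
    using assms(1-4)[THEN L1_onD(2)] ae by (intro integral_cong_AE) auto
qed

context
  fixes a b \<gamma> \<beta>' H :: real and f g :: "real \<Rightarrow> real"
  assumes ab: "a < b" and \<gamma>: "0 < \<gamma>" "\<gamma> < 1" and f: "continuous_on {a..b} f" and g: "continuous_on {a..b} g"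
    and H: "0 \<le> H" "\<And>r t. r \<in> {a..b} \<Longrightarrow> t \<in> {a..b} \<Longrightarrow> \<bar>g t - g r\<bar> \<le> H * \<bar>t - r\<bar> powr \<gamma>"
    and \<beta>': "1 - \<gamma> < \<beta>'" "\<beta>' < 1"
    and fin: "frac_energy \<beta>' a b (\<lambda>t. indicator {a..b} t * f t) < \<infinity>"
begin

private definition "u' t = indicator {a..b} t * marchaud \<beta>' (\<lambda>t. indicator {a..b} t * f t) t"

private lemma u': "L1_on a b u'" "AE t in lborel. t \<in> {a..b} \<longrightarrow> f t = rl_int \<beta>' u' t"
    "(\<integral>\<^sup>+t. ennreal \<bar>u' t\<bar> \<partial>lborel) \<le> ennreal (\<beta>' / Gamma (1 - \<beta>')) * frac_energy \<beta>' a b (\<lambda>t. indicator {a..b} t * f t)"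
proof -
  have p: "0 < \<beta>'" using \<gamma> \<beta>' by simp
  show "L1_on a b u'" unfolding u'_def[abs_def] by (rule marchaud_L1(1)[OF p \<beta>'(2) L1_on_ext[OF f] fin])
  show "AE t in lborel. t \<in> {a..b} \<longrightarrow> f t = rl_int \<beta>' u' t"
    using rl_int_marchaud[OF p \<beta>'(2) L1_on_ext[OF f] fin] unfolding u'_def[abs_def]
    by eventually_elim auto
  show "(\<integral>\<^sup>+t. ennreal \<bar>u' t\<bar> \<partial>lborel) \<le> ennreal (\<beta>' / Gamma (1 - \<beta>')) * frac_energy \<beta>' a b (\<lambda>t. indicator {a..b} t * f t)"
    unfolding u'_def by (rule marchaud_L1(2)[OF p \<beta>'(2) L1_on_ext[OF f] fin])
qed

text \<open>For \<open>\<alpha> > 1 - \<gamma>\<close> the right-sided density agrees almost everywhere with the bounded one of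
  \<open>holder_rl_int_right\<close>. Otherwise an exponent \<open>\<beta>\<close> strictly between \<open>1 - \<gamma>\<close> and \<open>\<beta>'\<close> is
  used: the gap below \<open>\<beta>'\<close> gives the left-sided density of order \<open>\<alpha>\<close> a finite energy of
  order \<open>\<beta> - \<alpha>\<close>, as integration by parts requires.\<close>

lemma frac_integrable_exp_limit:
  assumes exp: "frac_integrable_exp \<alpha> a b f g"
  shows "(difference_quotient a b f g \<longlongrightarrow>
    - (LINT r:{a..b}|lebesgue. frac_deriv_left \<alpha> a b f r * frac_deriv_right (1 - \<alpha>) a b (left_centred b g) r)) (at_right 0)"
proof -
  obtain \<phi> \<psi> where \<phi>: "L1_on a b \<phi>" and \<psi>: "L1_on a b \<psi>" and int: "integrable lborel (\<lambda>t. \<phi> t * \<psi> t)"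
    and f_eq: "AE t in lborel. t \<in> {a..b} \<longrightarrow> f t = rl_int \<alpha> \<phi> t"
    and g_eq: "AE t in lborel. t \<in> {a..b} \<longrightarrow> g t - g b = rl_int_right (1 - \<alpha>) \<psi> t"
    and val: "(LINT r:{a..b}|lebesgue. frac_deriv_left \<alpha> a b f r * frac_deriv_right (1 - \<alpha>) a b (left_centred b g) r)
      = (LINT t|lborel. \<phi> t * \<psi> t)"
    using frac_integrable_expD[OF ab f g exp] by blast
  have \<alpha>: "0 < \<alpha>" "\<alpha> < 1" using exp by (auto simp: frac_integrable_exp_def)
  show ?thesis unfolding val
  proof (cases "1 - \<gamma> < \<alpha>")
    case True
    obtain \<psi>' where \<psi>': "L1_on a b \<psi>'" "\<And>t. \<bar>\<psi>' t\<bar> \<le> holder_const (1 - \<alpha>) \<gamma> * H * (b - a) powr (\<gamma> - (1 - \<alpha>))"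
      "AE t in lborel. t \<in> {a..b} \<longrightarrow> g t - g b = rl_int_right (1 - \<alpha>) \<psi>' t"
      using holder_rl_int_right[OF ab _ _ _ H g, of "1 - \<alpha>"] True \<alpha> by auto
    have "AE t in lborel. t \<in> {a..b} \<longrightarrow> \<psi> t = \<psi>' t"
      by (rule rl_int_right_unique[of "1 - \<alpha>"]) (use \<alpha> \<psi> \<psi>' g_eq in auto)
    then have "(LINT t|lborel. \<phi> t * \<psi> t) = (LINT t|lborel. \<phi> t * \<psi>' t)"
      by (intro integral_mult_cong_AE(2)[OF \<phi> \<phi> \<psi> \<psi>'(1)]) auto
    then show "(difference_quotient a b f g \<longlongrightarrow> - (LINT t|lborel. \<phi> t * \<psi> t)) (at_right 0)"
      using difference_quotient_tendsto[OF ab \<alpha> \<phi> \<psi>'(1,2) f g f_eq \<psi>'(3)] by simp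
  next
    case False
    define \<beta> where "\<beta> = (1 - \<gamma> + \<beta>') / 2"
    define s where "s = \<beta> - \<alpha>"
    have \<beta>: "1 - \<gamma> < \<beta>" "\<beta> < \<beta>'" "\<beta> < 1" "0 < \<beta>" using \<beta>' \<gamma> by (auto simp: \<beta>_def)
    have s: "0 < s" "s < 1" "s < \<beta>' - \<alpha>" "\<beta>' - \<alpha> < 1" using False \<beta> \<alpha> \<beta>' by (auto simp: s_def)
    \<comment> \<open>The left-sided densities of \<open>f\<close> for the orders \<open>\<alpha>\<close> and \<open>\<beta>\<close>.\<close>
    define \<phi>' where "\<phi>' t = indicator {a..b} t * rl_int (\<beta>' - \<alpha>) u' t" for t
    define u where "u t = indicator {a..b} t * rl_int (\<beta>' - \<beta>) u' t" for t
    have \<phi>': "L1_on a b \<phi>'" unfolding \<phi>'_def[abs_def] using s by (intro rl_int_L1_on u'(1)) auto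
    have u: "L1_on a b u" unfolding u_def[abs_def] using \<beta> by (intro rl_int_L1_on u'(1)) auto
    have "AE t in lborel. t \<in> {a..b} \<longrightarrow> rl_int \<alpha> \<phi> t = rl_int \<alpha> \<phi>' t"
      using f_eq u'(2) rl_int_semigroup_AE[OF \<alpha>(1) _ u'(1), of "\<beta>' - \<alpha>"] s unfolding \<phi>'_def[abs_def]
      by (auto elim!: eventually_elim2)
    then have \<phi>_eq: "AE t in lborel. t \<in> {a..b} \<longrightarrow> \<phi> t = \<phi>' t" by (rule rl_int_unique[OF \<alpha> \<phi> \<phi>'])
    have u_eq: "AE t in lborel. t \<in> {a..b} \<longrightarrow> \<phi>' t = rl_int s u t"
      using rl_int_semigroup_AE[OF s(1) _ u'(1), of "\<beta>' - \<beta>"] \<beta> unfolding u_def[abs_def]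
      by (auto elim!: eventually_mono simp: \<phi>'_def s_def)
    have fu: "AE t in lborel. t \<in> {a..b} \<longrightarrow> f t = rl_int \<beta> u t"
      using u'(2) rl_int_semigroup_AE[OF \<beta>(4) _ u'(1), of "\<beta>' - \<beta>"] \<beta> unfolding u_def[abs_def]
      by (auto elim!: eventually_elim2)
    obtain \<psi>' where \<psi>': "L1_on a b \<psi>'" "\<And>t. \<bar>\<psi>' t\<bar> \<le> holder_const (1 - \<beta>) \<gamma> * H * (b - a) powr (\<gamma> - (1 - \<beta>))"
      "AE t in lborel. t \<in> {a..b} \<longrightarrow> g t - g b = rl_int_right (1 - \<beta>) \<psi>' t"
      using holder_rl_int_right[OF ab _ _ _ H g, of "1 - \<beta>"] \<beta> by auto
    \<comment> \<open>The right-sided density of order \<open>1 - \<beta>\<close>, which agrees with the bounded \<open>\<psi>'\<close>.\<close>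
    define w where "w t = indicator {a..b} t * rl_int_right s \<psi> t" for t
    have w: "L1_on a b w" unfolding w_def[abs_def] by (rule rl_int_right_L1_on[OF s(1) \<psi>])
    have "AE t in lborel. t \<in> {a..b} \<longrightarrow> rl_int_right (1 - \<beta>) w t = rl_int_right (1 - \<beta>) \<psi>' t"
      using g_eq \<psi>'(3) rl_int_right_semigroup_AE[OF _ s(1) \<psi>, of "1 - \<beta>"] \<beta> unfolding w_def[abs_def]
      by (auto elim!: eventually_elim2 simp: s_def)
    then have "AE t in lborel. t \<in> {a..b} \<longrightarrow> w t = \<psi>' t"
      using \<beta> by (intro rl_int_right_unique[OF _ _ w \<psi>'(1)]) auto
    then have w_eq: "AE t in lborel. t \<in> {a..b} \<longrightarrow> rl_int_right s \<psi> t = \<psi>' t"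
      by eventually_elim (auto simp: w_def)
    have "(LINT t|lborel. \<phi> t * \<psi> t) = (LINT t|lborel. \<phi>' t * \<psi> t)"
      using \<phi>_eq by (intro integral_mult_cong_AE(2)[OF \<phi> \<phi>' \<psi> \<psi>]) auto
    also have "\<dots> = (LINT t|lborel. u t * rl_int_right s \<psi> t)"
    proof (rule integration_by_parts_integrable_product[OF s(1,2) u \<phi>' u_eq _ \<psi>])
      show "frac_energy s a b \<phi>' < \<infinity>"
        unfolding \<phi>'_def[abs_def] by (rule rl_int_frac_energy[OF s(1,3,4) u'(1)])
      show "AE t in lborel. t \<in> {a..b} \<longrightarrow> \<bar>rl_int_right s \<psi> t\<bar> \<le> holder_const (1 - \<beta>) \<gamma> * H * (b - a) powr (\<gamma> - (1 - \<beta>))"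
        using w_eq by eventually_elim (use \<psi>'(2) in auto)
      show "integrable lborel (\<lambda>t. \<phi>' t * \<psi> t)"
        using integrable_cong_AE[OF _ _ integral_mult_cong_AE(1)[OF \<phi> \<phi>' \<psi> \<psi> \<phi>_eq]] int
          L1_onD(2)[OF \<phi>] L1_onD(2)[OF \<phi>'] L1_onD(2)[OF \<psi>] by auto
    qed
    also have "\<dots> = (LINT t|lborel. u t * \<psi>' t)"
    proof (rule integral_cong_AE)
      show "AE t in lborel. u t * rl_int_right s \<psi> t = u t * \<psi>' t"
        using w_eq by eventually_elim (auto simp: u_def split: split_indicator_asm)
    qed (use L1_onD(2)[OF u] L1_onD(2)[OF \<psi>] L1_onD(2)[OF \<psi>'(1)] in auto)
    finally show "(difference_quotient a b f g \<longlongrightarrow> - (LINT t|lborel. \<phi> t * \<psi> t)) (at_right 0)"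
      using difference_quotient_tendsto[OF ab \<beta>(4,3) u \<psi>'(1,2) f g fu \<psi>'(3)] by simp
  qed
qed

text \<open>The exponent \<open>\<beta>'\<close> is admissible and yields the bound. The integral is defined with some
  admissible exponent, but all of them give the limit of the same difference quotients.\<close>

theorem frac_integral_holder:
  shows "frac_integrable a b f g"
    and "(difference_quotient a b f g \<longlongrightarrow> frac_integral a b f g) (at_right 0)"
    and "\<bar>frac_integral a b f g\<bar> \<le> holder_const (1 - \<beta>') \<gamma> * H * (b - a) powr (\<gamma> - (1 - \<beta>')) *
      (\<beta>' / Gamma (1 - \<beta>') * enn2real (frac_energy \<beta>' a b (\<lambda>t. indicator {a..b} t * f t)))"
proof -
  define B where "B = holder_const (1 - \<beta>') \<gamma> * H * (b - a) powr (\<gamma> - (1 - \<beta>'))"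
  have p: "0 < \<beta>'" using \<gamma> \<beta>' by simp
  obtain \<psi> where \<psi>: "L1_on a b \<psi>" "\<And>t. \<bar>\<psi> t\<bar> \<le> B"
      "AE t in lborel. t \<in> {a..b} \<longrightarrow> g t - g b = rl_int_right (1 - \<beta>') \<psi> t"
    using holder_rl_int_right[OF ab _ _ _ H g, of "1 - \<beta>'"] p \<beta>' unfolding B_def by auto
  have B0: "0 \<le> B" using \<psi>(2)[of 0] by linarith
  have int: "integrable lborel (\<lambda>t. u' t * \<psi> t)"
    using integral_mult_bounded(1)[OF L1_onD(1)[OF u'(1)], of \<psi> B] L1_onD(2)[OF \<psi>(1)] \<psi>(2) by auto
  have exp: "frac_integrable_exp \<beta>' a b f g"
    by (rule frac_integrable_expI[OF ab f g p \<beta>'(2) u'(1) \<psi>(1) int u'(2) \<psi>(3)])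
  then show "frac_integrable a b f g" unfolding frac_integrable_def by blast
  have "frac_integrable_exp (SOME \<alpha>. frac_integrable_exp \<alpha> a b f g) a b f g" using exp by (rule someI)
  from frac_integrable_exp_limit[OF this]
  show lim: "(difference_quotient a b f g \<longlongrightarrow> frac_integral a b f g) (at_right 0)"
    using ab by (simp add: frac_integral_def Let_def)
  have "(difference_quotient a b f g \<longlongrightarrow> - (LINT t|lborel. u' t * \<psi> t)) (at_right 0)"
    by (rule difference_quotient_tendsto[OF ab p \<beta>'(2) u'(1) \<psi>(1,2) f g u'(2) \<psi>(3)])
  then have "frac_integral a b f g = - (LINT t|lborel. u' t * \<psi> t)"
    using lim tendsto_unique trivial_limit_at_right_real by blast
  then have "\<bar>frac_integral a b f g\<bar> \<le> B * (LINT t|lborel. \<bar>u' t\<bar>)"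
    using integral_mult_bounded(2)[OF L1_onD(1)[OF u'(1)], of \<psi> B] L1_onD(2)[OF \<psi>(1)] \<psi>(2) by auto
  also have "\<dots> \<le> B * (\<beta>' / Gamma (1 - \<beta>') * enn2real (frac_energy \<beta>' a b (\<lambda>t. indicator {a..b} t * f t)))"
  proof (rule mult_left_mono[OF _ B0])
    have G: "0 < Gamma (1 - \<beta>')" using \<beta>' by (intro Gamma_real_pos) auto
    have "ennreal (LINT t|lborel. \<bar>u' t\<bar>) = (\<integral>\<^sup>+t. ennreal \<bar>u' t\<bar> \<partial>lborel)"
      using L1_onD(1)[OF u'(1)] by (intro nn_integral_eq_integral[symmetric]) auto
    also have "\<dots> \<le> ennreal (\<beta>' / Gamma (1 - \<beta>')) * ennreal (enn2real (frac_energy \<beta>' a b (\<lambda>t. indicator {a..b} t * f t)))"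
      using u'(3) fin by (simp add: less_top)
    also have "\<dots> = ennreal (\<beta>' / Gamma (1 - \<beta>') * enn2real (frac_energy \<beta>' a b (\<lambda>t. indicator {a..b} t * f t)))"
      using p G by (intro ennreal_mult'[symmetric]) auto
    finally show "(LINT t|lborel. \<bar>u' t\<bar>) \<le> \<beta>' / Gamma (1 - \<beta>') * enn2real (frac_energy \<beta>' a b (\<lambda>t. indicator {a..b} t * f t))"
      using p G by (simp add: ennreal_le_iff)
  qed
  finally show "\<bar>frac_integral a b f g\<bar> \<le> holder_const (1 - \<beta>') \<gamma> * H * (b - a) powr (\<gamma> - (1 - \<beta>')) *
      (\<beta>' / Gamma (1 - \<beta>') * enn2real (frac_energy \<beta>' a b (\<lambda>t. indicator {a..b} t * f t)))"
    by (simp add: B_def)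
qed

end

section \<open>Power type coefficients along a Hoelder path\<close>

text \<open>Put \<open>z = l / M\<close> for the smaller argument \<open>l\<close> and the larger one \<open>M\<close>. Since the exponents
  are at most \<open>1\<close>, \<open>1 - z powr \<kappa> \<le> 1 - z \<le> (1 - z) powr (\<kappa> + \<eta>)\<close>; this is multiplied by
  \<open>M powr \<kappa>\<close>.\<close>

lemma powr_diff_le:
  fixes x y \<kappa> \<eta> :: real
  assumes "0 < x" "0 \<le> y" "0 < \<kappa>" "\<kappa> < 1" "0 < \<eta>" "\<kappa> + \<eta> \<le> 1"
  shows "\<bar>x powr \<kappa> - y powr \<kappa>\<bar> \<le> \<bar>x - y\<bar> powr (\<kappa> + \<eta>) * x powr (- \<eta>)"
proof -
  have main: "M powr \<kappa> - l powr \<kappa> \<le> (M - l) powr (\<kappa> + \<eta>) * M powr (- \<eta>)" if "0 < M" "0 \<le> l" "l \<le> M" for M l :: real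
  proof -
    define z where "z = l / M"
    have z: "0 \<le> z" "z \<le> 1" "l = M * z" using that by (auto simp: z_def)
    have "z \<le> z powr \<kappa>" using powr_mono'[of \<kappa> 1 z] z assms by simp
    then have "1 - z powr \<kappa> \<le> (1 - z) powr 1" using z by simp
    also have "\<dots> \<le> (1 - z) powr (\<kappa> + \<eta>)" using z assms by (intro powr_mono') auto
    finally have le: "1 - z powr \<kappa> \<le> (1 - z) powr (\<kappa> + \<eta>)" .
    have "M powr \<kappa> - l powr \<kappa> = M powr \<kappa> * (1 - z powr \<kappa>)"
      using that z by (simp add: powr_mult right_diff_distrib)
    also have "\<dots> \<le> M powr \<kappa> * (1 - z) powr (\<kappa> + \<eta>)" using le by (intro mult_left_mono) auto
    also have "M powr \<kappa> * (1 - z) powr (\<kappa> + \<eta>) = (M * (1 - z)) powr (\<kappa> + \<eta>) * M powr (- \<eta>)"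
      using that z powr_add[of M "\<kappa> + \<eta>" "- \<eta>"] by (simp add: powr_mult)
    also have "M * (1 - z) = M - l" using z by (simp add: algebra_simps)
    finally show ?thesis .
  qed
  show ?thesis
  proof (cases "y \<le> x")
    case True
    then have "y powr \<kappa> \<le> x powr \<kappa>" using assms by (intro powr_mono2) auto
    then show ?thesis using main[of x y] True assms by simp
  next
    case False
    then have "x powr \<kappa> \<le> y powr \<kappa>" using assms by (intro powr_mono2) auto
    then have "\<bar>x powr \<kappa> - y powr \<kappa>\<bar> \<le> \<bar>x - y\<bar> powr (\<kappa> + \<eta>) * y powr (- \<eta>)"
      using main[of y x] False assms by simp
    also have "\<dots> \<le> \<bar>x - y\<bar> powr (\<kappa> + \<eta>) * x powr (- \<eta>)"
      using False assms by (intro mult_left_mono powr_mono2') auto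
    finally show ?thesis .
  qed
qed

text \<open>In the extended nonnegative reals the bound also holds at the zeros of \<open>y\<close>, where the last
  factor is \<open>\<infinity>\<close>: if the first factor is \<open>0\<close> there, then so is the increment.\<close>

lemma power_type_increment:
  fixes f :: "real \<Rightarrow> real" and y :: "real \<Rightarrow> 'a::real_normed_vector"
  assumes par: "0 < \<kappa>" "\<kappa> < 1" "0 < \<eta>" "\<kappa> + \<eta> \<le> 1" and N: "0 \<le> N" and Y: "0 \<le> Y"
    and f: "\<bar>f t - f r\<bar> \<le> N * \<bar>norm (y t) powr \<kappa> - norm (y r) powr \<kappa>\<bar>"
    and y: "norm (y t - y r) \<le> Y * \<bar>t - r\<bar> powr \<gamma>"
  shows "ennreal \<bar>f t - f r\<bar>
     \<le> ennreal (N * Y powr (\<kappa> + \<eta>) * \<bar>t - r\<bar> powr (\<gamma> * (\<kappa> + \<eta>))) * inverse (ennreal (norm (y t) powr \<eta>))"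
proof (cases "y t = 0")
  case True
  show ?thesis
  proof (cases "N * Y powr (\<kappa> + \<eta>) * \<bar>t - r\<bar> powr (\<gamma> * (\<kappa> + \<eta>)) = 0")
    case z: True
    then have "N = 0 \<or> y t = y r" using y by auto
    then have "f t - f r = 0" using f by auto
    then show ?thesis by simp
  next
    case False
    then have "0 < N * Y powr (\<kappa> + \<eta>) * \<bar>t - r\<bar> powr (\<gamma> * (\<kappa> + \<eta>))" using N by (simp add: less_le)
    moreover have "inverse (ennreal (norm (y t) powr \<eta>)) = top" using True by simp
    ultimately show ?thesis by (metis ennreal_eq_0_iff ennreal_mult_eq_top_iff not_le top_greatest)
  qed
next
  case False
  have "\<bar>norm (y t) powr \<kappa> - norm (y r) powr \<kappa>\<bar> \<le> \<bar>norm (y t) - norm (y r)\<bar> powr (\<kappa> + \<eta>) * norm (y t) powr (- \<eta>)"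
    using False par by (intro powr_diff_le) auto
  also have "\<dots> \<le> (Y * \<bar>t - r\<bar> powr \<gamma>) powr (\<kappa> + \<eta>) * norm (y t) powr (- \<eta>)"
    using y par by (intro mult_right_mono powr_mono2) (auto intro: order_trans[OF norm_triangle_ineq3])
  also have "(Y * \<bar>t - r\<bar> powr \<gamma>) powr (\<kappa> + \<eta>) = Y powr (\<kappa> + \<eta>) * \<bar>t - r\<bar> powr (\<gamma> * (\<kappa> + \<eta>))"
    using Y by (simp add: powr_mult powr_powr)
  finally have "N * \<bar>norm (y t) powr \<kappa> - norm (y r) powr \<kappa>\<bar>
     \<le> N * (Y powr (\<kappa> + \<eta>) * \<bar>t - r\<bar> powr (\<gamma> * (\<kappa> + \<eta>)) * norm (y t) powr (- \<eta>))"
    using N by (rule mult_left_mono)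
  then have "\<bar>f t - f r\<bar> \<le> N * Y powr (\<kappa> + \<eta>) * \<bar>t - r\<bar> powr (\<gamma> * (\<kappa> + \<eta>)) * norm (y t) powr (- \<eta>)"
    using f by (simp add: mult_ac)
  then have "ennreal \<bar>f t - f r\<bar> \<le> ennreal (N * Y powr (\<kappa> + \<eta>) * \<bar>t - r\<bar> powr (\<gamma> * (\<kappa> + \<eta>)) * norm (y t) powr (- \<eta>))"
    by (rule ennreal_leI)
  also have "\<dots> = ennreal (N * Y powr (\<kappa> + \<eta>) * \<bar>t - r\<bar> powr (\<gamma> * (\<kappa> + \<eta>))) * ennreal (norm (y t) powr (- \<eta>))"
    using N by (intro ennreal_mult) auto
  also have "ennreal (norm (y t) powr (- \<eta>)) = inverse (ennreal (norm (y t) powr \<eta>))"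
    using False by (simp add: inverse_ennreal powr_minus)
  finally show ?thesis .
qed

text \<open>For \<open>h > t - a\<close> the increment of the extension by \<open>0\<close> is \<open>f t\<close>, which is bounded by \<open>M\<close>;
  shorter increments are controlled by the hypothesis.\<close>

lemma frac_energy_increment_bound:
  fixes f :: "real \<Rightarrow> real" and w :: "real \<Rightarrow> ennreal"
  assumes ab: "a < b" and \<beta>: "0 < \<beta>" "\<beta> < \<beta>0" "\<beta> < 1" and M: "0 \<le> M" "\<And>t. t \<in> {a..b} \<Longrightarrow> \<bar>f t\<bar> \<le> M" and K: "0 \<le> K"
    and inc: "\<And>t r. t \<in> {a..b} \<Longrightarrow> r \<in> {a..b} \<Longrightarrow> ennreal \<bar>f t - f r\<bar> \<le> ennreal (K * \<bar>t - r\<bar> powr \<beta>0) * w t"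
    and w: "(\<lambda>t. w t * indicator {a..b} t) \<in> borel_measurable borel"
  shows "frac_energy \<beta> a b (\<lambda>t. indicator {a..b} t * f t)
    \<le> ennreal (M * (b - a) powr (1 - \<beta>) / (\<beta> * (1 - \<beta>)))
      + ennreal (K * (b - a) powr (\<beta>0 - \<beta>) / (\<beta>0 - \<beta>)) * (\<integral>\<^sup>+t\<in>{a..b}. w t \<partial>lborel)"
proof -
  define F where "F t = indicator {a..b} t * f t" for t
  have inner: "(\<integral>\<^sup>+h\<in>{0<..}. ennreal (\<bar>F t - F (t - h)\<bar> * h powr (- 1 - \<beta>)) \<partial>lborel)
     \<le> ennreal (M / \<beta> * (t - a) powr (- \<beta>)) + ennreal (K * (b - a) powr (\<beta>0 - \<beta>) / (\<beta>0 - \<beta>)) * w t"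
    if t: "t \<in> {a<..b}" for t
  proof -
    have i1: "((\<lambda>h. h powr (\<beta>0 - 1 - \<beta>)) has_integral ((t - a) powr (\<beta>0 - 1 - \<beta> + 1) / (\<beta>0 - 1 - \<beta> + 1))) {0..t - a}"
      using \<beta> t by (intro has_integral_powr_from_0) auto
    have i2: "((\<lambda>h. h powr (- 1 - \<beta>)) has_integral (- ((t - a) powr (- 1 - \<beta> + 1)) / (- 1 - \<beta> + 1))) {t - a..}"
      using \<beta> t by (intro has_integral_powr_to_inf) auto
    have pt: "ennreal (\<bar>F t - F (t - h)\<bar> * h powr (- 1 - \<beta>)) * indicator {0<..} h
       \<le> ennreal M * ennreal (indicator {t - a..} h * h powr (- 1 - \<beta>))
        + (ennreal K * w t) * ennreal (indicator {0..t - a} h * h powr (\<beta>0 - 1 - \<beta>))" for h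
    proof (cases "0 < h")
      case True
      show ?thesis
      proof (cases "h \<le> t - a")
        case le: True
        have e: "h powr \<beta>0 * h powr (- 1 - \<beta>) = h powr (\<beta>0 - 1 - \<beta>)"
          using powr_add[of h \<beta>0 "- 1 - \<beta>"] by (simp add: algebra_simps)
        have "ennreal (\<bar>F t - F (t - h)\<bar> * h powr (- 1 - \<beta>)) = ennreal \<bar>f t - f (t - h)\<bar> * ennreal (h powr (- 1 - \<beta>))"
          using t le True by (simp add: F_def ennreal_mult')
        also have "\<dots> \<le> (ennreal (K * h powr \<beta>0) * w t) * ennreal (h powr (- 1 - \<beta>))"
          using inc[of t "t - h"] t le True by (intro mult_right_mono) auto
        also have "\<dots> = (ennreal K * w t) * ennreal (h powr \<beta>0 * h powr (- 1 - \<beta>))"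
          using K by (simp add: ennreal_mult' mult_ac)
        finally show ?thesis unfolding e using True le by (simp add: add_increasing)
      next
        case gt: False
        have "\<bar>F t - F (t - h)\<bar> \<le> M" using gt t M(2)[of t] by (simp add: F_def)
        then have "ennreal (\<bar>F t - F (t - h)\<bar> * h powr (- 1 - \<beta>)) \<le> ennreal M * ennreal (h powr (- 1 - \<beta>))"
          using M by (subst ennreal_mult'[symmetric]) (auto intro!: ennreal_leI mult_right_mono)
        then show ?thesis using True gt by simp
      qed
    qed simp
    have "(\<integral>\<^sup>+h\<in>{0<..}. ennreal (\<bar>F t - F (t - h)\<bar> * h powr (- 1 - \<beta>)) \<partial>lborel)
      \<le> (\<integral>\<^sup>+h. ennreal M * ennreal (indicator {t - a..} h * h powr (- 1 - \<beta>))
        + (ennreal K * w t) * ennreal (indicator {0..t - a} h * h powr (\<beta>0 - 1 - \<beta>)) \<partial>lborel)"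
      by (intro nn_integral_mono pt)
    also have "\<dots> = ennreal M * (\<integral>\<^sup>+h. ennreal (indicator {t - a..} h * h powr (- 1 - \<beta>)) \<partial>lborel)
       + (ennreal K * w t) * (\<integral>\<^sup>+h. ennreal (indicator {0..t - a} h * h powr (\<beta>0 - 1 - \<beta>)) \<partial>lborel)"
      by (subst nn_integral_add, measurable, subst (1 2) nn_integral_cmult, measurable)
    also have "\<dots> = ennreal M * ennreal ((t - a) powr (- \<beta>) / \<beta>) + (ennreal K * w t) * ennreal ((t - a) powr (\<beta>0 - \<beta>) / (\<beta>0 - \<beta>))"
      unfolding nn_integral_has_integral_lebesgue[OF powr_ge_zero i1] nn_integral_has_integral_lebesgue[OF powr_ge_zero i2]
      by simp
    also have "\<dots> \<le> ennreal M * ennreal ((t - a) powr (- \<beta>) / \<beta>) + (ennreal K * w t) * ennreal ((b - a) powr (\<beta>0 - \<beta>) / (\<beta>0 - \<beta>))"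
      using t \<beta> by (intro add_left_mono mult_left_mono ennreal_leI divide_right_mono powr_mono2) auto
    also have "\<dots> = ennreal (M / \<beta> * (t - a) powr (- \<beta>)) + ennreal (K * (b - a) powr (\<beta>0 - \<beta>) / (\<beta>0 - \<beta>)) * w t"
    proof -
      have "ennreal M * ennreal ((t - a) powr (- \<beta>) / \<beta>) = ennreal (M / \<beta> * (t - a) powr (- \<beta>))"
        using M by (subst ennreal_mult'[symmetric]) (auto simp: mult_ac)
      moreover have "ennreal K * ennreal ((b - a) powr (\<beta>0 - \<beta>) / (\<beta>0 - \<beta>)) = ennreal (K * (b - a) powr (\<beta>0 - \<beta>) / (\<beta>0 - \<beta>))"
        using K by (subst ennreal_mult'[symmetric]) auto
      moreover have "(ennreal K * w t) * ennreal ((b - a) powr (\<beta>0 - \<beta>) / (\<beta>0 - \<beta>))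
          = (ennreal K * ennreal ((b - a) powr (\<beta>0 - \<beta>) / (\<beta>0 - \<beta>))) * w t" by (simp only: mult_ac)
      ultimately show ?thesis by (simp only:)
    qed
    finally show ?thesis .
  qed
  define c where "c = ennreal (K * (b - a) powr (\<beta>0 - \<beta>) / (\<beta>0 - \<beta>))"
  have mass: "(\<integral>\<^sup>+t\<in>{a..b}. ennreal (M / \<beta> * (t - a) powr (- \<beta>)) \<partial>lborel) = ennreal (M * (b - a) powr (1 - \<beta>) / (\<beta> * (1 - \<beta>)))"
  proof -
    have i: "((\<lambda>h. h powr (- \<beta>)) has_integral ((b - a) powr (- \<beta> + 1) / (- \<beta> + 1))) {0..b - a}"
      using \<beta> ab by (intro has_integral_powr_from_0) auto
    have "(\<integral>\<^sup>+t\<in>{a..b}. ennreal (M / \<beta> * (t - a) powr (- \<beta>)) \<partial>lborel)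
      = (\<integral>\<^sup>+t. ennreal (M / \<beta>) * ennreal (indicator {0..b - a} (t - a) * (t - a) powr (- \<beta>)) \<partial>lborel)"
      using M \<beta> by (intro nn_integral_cong) (auto simp: ennreal_mult'[symmetric] split: split_indicator)
    also have "\<dots> = (\<integral>\<^sup>+h. ennreal (M / \<beta>) * ennreal (indicator {0..b - a} h * h powr (- \<beta>)) \<partial>lborel)"
      by (rule nn_integral_translate) measurable
    also have "\<dots> = ennreal (M / \<beta>) * ennreal ((b - a) powr (- \<beta> + 1) / (- \<beta> + 1))"
      by (subst nn_integral_cmult, measurable) (simp only: nn_integral_has_integral_lebesgue[OF powr_ge_zero i])
    also have "\<dots> = ennreal (M * (b - a) powr (1 - \<beta>) / (\<beta> * (1 - \<beta>)))"
      using M \<beta> by (subst ennreal_mult'[symmetric]) auto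
    finally show ?thesis .
  qed
  have "frac_energy \<beta> a b F \<le> (\<integral>\<^sup>+t. ennreal (M / \<beta> * (t - a) powr (- \<beta>)) * indicator {a..b} t + c * (w t * indicator {a..b} t) \<partial>lborel)"
    unfolding frac_energy_def using AE_lborel_singleton[of a]
    by (intro nn_integral_mono_AE, eventually_elim) (use inner in \<open>auto simp: c_def split: split_indicator\<close>)
  also have "\<dots> = (\<integral>\<^sup>+t\<in>{a..b}. ennreal (M / \<beta> * (t - a) powr (- \<beta>)) \<partial>lborel) + c * (\<integral>\<^sup>+t\<in>{a..b}. w t \<partial>lborel)"
    using w by (subst nn_integral_add) (auto simp: nn_integral_cmult)
  finally show ?thesis unfolding mass F_def[abs_def] c_def .
qed

text \<open>Hoelder's inequality for the exponents \<open>1 / p\<close> and \<open>1 / (1 - p)\<close>, up to the factor \<open>2\<close>. It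
  follows from \<open>Z powr p \<le> c powr (p - 1) * Z + c powr p\<close>, where the first term suffices for
  \<open>Z > c\<close> and the second one for \<open>Z \<le> c\<close>; the level \<open>c = m / (b - a)\<close> makes both
  contributions equal.\<close>

lemma nn_integral_powr_le:
  fixes X :: "real \<Rightarrow> real"
  assumes ab: "a < b" and p: "0 < p" "p < 1" and X: "\<And>t. 0 \<le> X t"
    and m: "0 < m" "(\<integral>\<^sup>+t\<in>{a..b}. inverse (ennreal (X t powr (\<eta> / p))) \<partial>lborel) \<le> ennreal m"
    and [measurable]: "(\<lambda>t. inverse (ennreal (X t powr (\<eta> / p))) * indicator {a..b} t) \<in> borel_measurable borel"
  shows "(\<integral>\<^sup>+t\<in>{a..b}. inverse (ennreal (X t powr \<eta>)) \<partial>lborel) \<le> ennreal (2 * (m powr p * (b - a) powr (1 - p)))"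
proof -
  define c where "c = m / (b - a)"
  have c: "0 < c" using m ab by (simp add: c_def)
  have pt: "inverse (ennreal (X t powr \<eta>)) \<le> ennreal (c powr (p - 1)) * inverse (ennreal (X t powr (\<eta> / p))) + ennreal (c powr p)" for t
  proof (cases "X t = 0")
    case True
    then show ?thesis using c by (simp add: ennreal_mult_top)
  next
    case False
    then have pos: "0 < X t" using X[of t] by simp
    define Z where "Z = inverse (X t powr (\<eta> / p))"
    have Z: "0 < Z" using pos by (simp add: Z_def)
    have "inverse (X t powr \<eta>) = Z powr p"
      using pos p by (simp add: Z_def powr_powr flip: powr_minus)
    also have "\<dots> \<le> c powr (p - 1) * Z + c powr p"
    proof (cases "Z \<le> c")
      case True
      then have "Z powr p \<le> c powr p" using Z p by (intro powr_mono2) auto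
      then show ?thesis using Z by (simp add: add_increasing)
    next
      case False
      have "Z powr p = Z powr (p - 1) * Z" using Z powr_add[of Z "p - 1" 1] by simp
      also have "\<dots> \<le> c powr (p - 1) * Z" using False Z p c by (intro mult_right_mono powr_mono2') auto
      finally show ?thesis by (simp add: add_increasing2)
    qed
    finally have "ennreal (inverse (X t powr \<eta>)) \<le> ennreal (c powr (p - 1)) * ennreal Z + ennreal (c powr p)"
      using Z by (simp add: ennreal_mult'[symmetric] ennreal_plus[symmetric] ennreal_leI del: ennreal_plus)
    then show ?thesis using pos by (simp add: inverse_ennreal Z_def)
  qed
  have "(\<integral>\<^sup>+t\<in>{a..b}. inverse (ennreal (X t powr \<eta>)) \<partial>lborel)
     \<le> (\<integral>\<^sup>+t. ennreal (c powr (p - 1)) * (inverse (ennreal (X t powr (\<eta> / p))) * indicator {a..b} t) + ennreal (c powr p) * indicator {a..b} t \<partial>lborel)"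
    using pt by (intro nn_integral_mono) (auto split: split_indicator)
  also have "\<dots> = ennreal (c powr (p - 1)) * (\<integral>\<^sup>+t\<in>{a..b}. inverse (ennreal (X t powr (\<eta> / p))) \<partial>lborel) + ennreal (c powr p) * ennreal (b - a)"
    using ab by (subst nn_integral_add) (auto simp: nn_integral_cmult nn_integral_cmult_indicator)
  also have "\<dots> \<le> ennreal (c powr (p - 1)) * ennreal m + ennreal (c powr p) * ennreal (b - a)"
    using m by (intro add_right_mono mult_left_mono) auto
  also have "\<dots> = ennreal (c powr (p - 1) * m + c powr p * (b - a))"
    using m ab by (simp add: ennreal_mult' ennreal_plus)
  also have "c powr (p - 1) * m + c powr p * (b - a) = 2 * (m powr p * (b - a) powr (1 - p))"
  proof -
    have "c powr p * (b - a) = m powr p * ((b - a) / (b - a) powr p)"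
      using m ab by (simp add: c_def powr_divide)
    also have "(b - a) / (b - a) powr p = (b - a) powr (1 - p)" using ab by (simp add: powr_diff)
    finally have 1: "c powr p * (b - a) = m powr p * (b - a) powr (1 - p)" .
    have "c powr (p - 1) * m = c powr p / c * m" using c by (simp add: powr_diff)
    also have "\<dots> = c powr p * (b - a)" using m ab by (simp add: c_def)
    finally show ?thesis using 1 by simp
  qed
  finally show ?thesis .
qed

text \<open>The quotients over \<open>[a, b]\<close> and over the two parts differ only for \<open>r\<close> in \<open>[c - \<epsilon>, c]\<close>,
  where \<open>g\<close> is cut off at \<open>c\<close> instead of \<open>b\<close>. This contributes at most \<open>M * H * \<epsilon> powr \<gamma>\<close>.\<close>

lemma difference_quotient_additive:
  assumes ord: "a < c" "c < b" and \<gamma>: "0 < \<gamma>" and f: "continuous_on {a..b} f" and g: "continuous_on {a..b} g" and H: "0 \<le> H"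
    and hol: "\<And>r t. r \<in> {a..b} \<Longrightarrow> t \<in> {a..b} \<Longrightarrow> \<bar>g t - g r\<bar> \<le> H * \<bar>t - r\<bar> powr \<gamma>"
    and M: "\<And>t. t \<in> {a..b} \<Longrightarrow> \<bar>f t\<bar> \<le> M"
    and lims: "(difference_quotient a b f g \<longlongrightarrow> V) (at_right 0)" "(difference_quotient a c f g \<longlongrightarrow> V1) (at_right 0)"
      "(difference_quotient c b f g \<longlongrightarrow> V2) (at_right 0)"
  shows "V = V1 + V2"
proof -
  have M0: "0 \<le> M" using M[of a] ord by auto
  have cont: "integrable lborel (\<lambda>r. indicator {l..u} r * f r * (g (min (r + \<epsilon>) v) - g r))"
    if "a \<le> l" "l \<le> u" "u \<le> v" "v \<le> b" "0 < \<epsilon>" for l u v \<epsilon>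
  proof -
    have "continuous_on {l..u} (\<lambda>r. f r * (g (min (r + \<epsilon>) v) - g r))"
      using that by (intro continuous_intros continuous_on_subset[OF f] continuous_on_subset[OF g] continuous_on_compose2[OF g]) auto
    from continuous_on_ext(1)[OF this] show ?thesis by (simp add: mult.assoc)
  qed
  have bound: "\<bar>difference_quotient a b f g \<epsilon> - (difference_quotient a c f g \<epsilon> + difference_quotient c b f g \<epsilon>)\<bar> \<le> M * H * \<epsilon> powr \<gamma>"
    if \<epsilon>: "0 < \<epsilon>" "\<epsilon> < b - c" for \<epsilon>
  proof -
    have i: "integrable lborel (\<lambda>r. indicator {a..b} r * f r * (g (min (r + \<epsilon>) b) - g r))"
      "integrable lborel (\<lambda>r. indicator {a..c} r * f r * (g (min (r + \<epsilon>) c) - g r))"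
      "integrable lborel (\<lambda>r. indicator {c..b} r * f r * (g (min (r + \<epsilon>) b) - g r))"
      using ord \<epsilon> by (auto intro!: cont)
    define D where "D r = indicator {a..b} r * f r * (g (min (r + \<epsilon>) b) - g r)
      - (indicator {a..c} r * f r * (g (min (r + \<epsilon>) c) - g r) + indicator {c..b} r * f r * (g (min (r + \<epsilon>) b) - g r))" for r
    have "AE r in lborel. \<bar>D r\<bar> \<le> indicator {c - \<epsilon>..c} r * (M * (H * \<epsilon> powr \<gamma>))"
      using AE_lborel_singleton[of c]
    proof eventually_elim
      case (elim r)
      consider "r < a" | "a \<le> r" "r < c - \<epsilon>" | "a \<le> r" "c - \<epsilon> \<le> r" "r < c" | "c < r" using elim by linarith
      then show ?case
      proof cases
        case 3
        then have "D r = f r * (g (r + \<epsilon>) - g c)" using ord \<epsilon> by (simp add: D_def min_def algebra_simps)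
        moreover have "\<bar>g (r + \<epsilon>) - g c\<bar> \<le> H * \<epsilon> powr \<gamma>"
        proof -
          have "\<bar>g (r + \<epsilon>) - g c\<bar> \<le> H * \<bar>r + \<epsilon> - c\<bar> powr \<gamma>" using 3 ord \<epsilon> by (intro hol) auto
          also have "\<dots> \<le> H * \<epsilon> powr \<gamma>" using 3 H \<gamma> \<epsilon> by (intro mult_left_mono powr_mono2) auto
          finally show ?thesis .
        qed
        ultimately show ?thesis using 3 M[of r] M0 ord by (auto simp: abs_mult intro!: mult_mono)
      qed (use ord \<epsilon> M0 H in \<open>auto simp: D_def split: split_indicator\<close>)
    qed
    moreover have iD: "integrable lborel D" unfolding D_def using i by auto
    ultimately have "(LINT r|lborel. \<bar>D r\<bar>) \<le> (LINT r|lborel. indicator {c - \<epsilon>..c} r * (M * (H * \<epsilon> powr \<gamma>)))"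
      by (intro integral_mono_AE integrable_abs integrable_mult_left integrable_real_indicator)
        (use \<epsilon> in auto)
    also have "\<dots> = \<epsilon> * (M * (H * \<epsilon> powr \<gamma>))" using \<epsilon> by simp
    finally have "\<bar>LINT r|lborel. D r\<bar> \<le> \<epsilon> * (M * (H * \<epsilon> powr \<gamma>))"
      using integral_abs_bound[of lborel D] by linarith
    moreover have "difference_quotient a b f g \<epsilon> - (difference_quotient a c f g \<epsilon> + difference_quotient c b f g \<epsilon>) = (LINT r|lborel. D r) / \<epsilon>"
      unfolding D_def difference_quotient_def using i by (simp add: diff_divide_distrib add_divide_distrib)
    ultimately show ?thesis using \<epsilon> by (simp add: abs_divide divide_le_eq mult_ac)
  qed
  have "((\<lambda>\<epsilon>. M * H * \<epsilon> powr \<gamma>) \<longlongrightarrow> 0) (at_right 0)"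
    using \<gamma> by (auto intro!: tendsto_eq_intros simp: eventually_at_filter)
  moreover have "\<forall>\<^sub>F \<epsilon> in at_right 0. norm (difference_quotient a b f g \<epsilon> - (difference_quotient a c f g \<epsilon> + difference_quotient c b f g \<epsilon>)) \<le> M * H * \<epsilon> powr \<gamma>"
    using eventually_at_right_real[of 0 "b - c"] ord by (auto elim!: eventually_mono intro!: bound)
  ultimately have "((\<lambda>\<epsilon>. difference_quotient a b f g \<epsilon> - (difference_quotient a c f g \<epsilon> + difference_quotient c b f g \<epsilon>)) \<longlongrightarrow> 0) (at_right 0)"
    by (rule Lim_null_comparison[rotated])
  moreover have "((\<lambda>\<epsilon>. difference_quotient a b f g \<epsilon> - (difference_quotient a c f g \<epsilon> + difference_quotient c b f g \<epsilon>)) \<longlongrightarrow> V - (V1 + V2)) (at_right 0)"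
    by (intro tendsto_diff tendsto_add lims)
  ultimately have "V - (V1 + V2) = 0" using tendsto_unique trivial_limit_at_right_real by blast
  then show ?thesis by simp
qed

section \<open>The integral of a power type coefficient\<close>

lemma inverse_moment_measurable:
  fixes y :: "real \<Rightarrow> 'a::real_normed_vector"
  assumes y: "continuous_on {a..b} y"
  shows "(\<lambda>t. inverse (ennreal (norm (y t) powr e)) * indicator {a..b} t) \<in> borel_measurable borel"
proof -
  have "continuous_on {a..b} (\<lambda>t. norm (y t))" by (intro continuous_intros y)
  from continuous_on_ext(2)[OF this]
  have [measurable]: "(\<lambda>t. indicator {a..b} t * norm (y t)) \<in> borel_measurable borel" .
  have eq: "(\<lambda>t. inverse (ennreal (norm (y t) powr e)) * indicator {a..b} t)
     = (\<lambda>t. inverse (ennreal ((indicator {a..b} t * norm (y t)) powr e)) * indicator {a..b} t)"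
    by (auto simp: fun_eq_iff split: split_indicator)
  show ?thesis unfolding eq by measurable
qed

context
  fixes T \<gamma> \<kappa> \<eta> H N Y M a b :: real and x f :: "real \<Rightarrow> real" and y :: "real \<Rightarrow> 'a::real_normed_vector"
  assumes par: "0 < \<gamma>" "\<gamma> < 1" "0 < \<kappa>" "\<kappa> < 1" "0 < \<eta>" "\<kappa> + \<eta> < 1" "1 - \<gamma> < \<gamma> * (\<kappa> + \<eta>)"
    and ab: "0 \<le> a" "a < b" "b \<le> T"
    and x: "continuous_on {0..T} x" "0 \<le> H"
      "\<And>r t. r \<in> {0..T} \<Longrightarrow> t \<in> {0..T} \<Longrightarrow> \<bar>x t - x r\<bar> \<le> H * \<bar>t - r\<bar> powr \<gamma>"
    and y: "continuous_on {0..T} y" "0 \<le> Y"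
      "\<And>r t. r \<in> {0..T} \<Longrightarrow> t \<in> {0..T} \<Longrightarrow> norm (y t - y r) \<le> Y * \<bar>t - r\<bar> powr \<gamma>"
    and f: "continuous_on {0..T} f" "0 \<le> N"
      "\<And>r t. r \<in> {0..T} \<Longrightarrow> t \<in> {0..T} \<Longrightarrow> \<bar>f t - f r\<bar> \<le> N * \<bar>norm (y t) powr \<kappa> - norm (y r) powr \<kappa>\<bar>"
      "0 \<le> M" "\<And>t. t \<in> {0..T} \<Longrightarrow> \<bar>f t\<bar> \<le> M"
begin

private lemma sub: "{a..b} \<subseteq> {0..T}" using ab by auto

text \<open>\<open>\<beta>0\<close> is the Hoelder exponent of the increments of \<open>f\<close>, and \<open>\<beta>\<close> the order of
  differentiation, halfway between \<open>1 - \<gamma>\<close> and \<open>\<beta>0\<close>.\<close>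

private definition "\<beta>0 = \<gamma> * (\<kappa> + \<eta>)"
private definition "\<beta> = (1 - \<gamma> + \<beta>0) / 2"

private lemma \<beta>: "1 - \<gamma> < \<beta>" "\<beta> < \<beta>0" "\<beta> < 1" "0 < \<beta>" "\<beta>0 < 1" "0 < \<beta>0"
proof -
  have "\<beta>0 < \<gamma> * 1" unfolding \<beta>0_def using par by (intro mult_strict_left_mono) auto
  moreover have "1 - \<gamma> < \<beta>0" using par by (simp add: \<beta>0_def)
  ultimately show "1 - \<gamma> < \<beta>" "\<beta> < \<beta>0" "\<beta> < 1" "0 < \<beta>" "\<beta>0 < 1" "0 < \<beta>0"
    using par(1,2) by (auto simp: \<beta>_def)
qed

private definition "I = (\<integral>\<^sup>+t\<in>{a..b}. inverse (ennreal (norm (y t) powr \<eta>)) \<partial>lborel)"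

private lemma energy:
  "frac_energy \<beta> a b (\<lambda>t. indicator {a..b} t * f t)
    \<le> ennreal (M * (b - a) powr (1 - \<beta>) / (\<beta> * (1 - \<beta>)))
      + ennreal (N * Y powr (\<kappa> + \<eta>) * (b - a) powr (\<beta>0 - \<beta>) / (\<beta>0 - \<beta>)) * I"
  unfolding I_def
proof (rule frac_energy_increment_bound[OF ab(2) \<beta>(4,2,3) f(4)])
  fix t r assume "t \<in> {a..b}" "r \<in> {a..b}"
  then show "ennreal \<bar>f t - f r\<bar>
    \<le> ennreal (N * Y powr (\<kappa> + \<eta>) * \<bar>t - r\<bar> powr \<beta>0) * inverse (ennreal (norm (y t) powr \<eta>))"
    unfolding \<beta>0_def using sub par by (intro power_type_increment[OF par(3,4,5) _ f(2) y(2)] f(3) y(3)) auto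
qed (use f(2,5) sub inverse_moment_measurable[OF continuous_on_subset[OF y(1) sub], of \<eta>] in auto)

lemma power_type_frac_integrable:
  assumes "(\<integral>\<^sup>+t\<in>{a..b}. inverse (ennreal (norm (y t) powr \<eta>)) \<partial>lborel) < \<infinity>"
  shows "frac_integrable a b f x"
    and "(difference_quotient a b f x \<longlongrightarrow> frac_integral a b f x) (at_right 0)"
    and "\<bar>frac_integral a b f x\<bar> \<le> holder_const (1 - \<beta>) \<gamma> * H * (b - a) powr (\<gamma> - (1 - \<beta>)) *
      (\<beta> / Gamma (1 - \<beta>) * enn2real (frac_energy \<beta> a b (\<lambda>t. indicator {a..b} t * f t)))"
proof -
  have "frac_energy \<beta> a b (\<lambda>t. indicator {a..b} t * f t) < \<infinity>"
    by (rule le_less_trans[OF energy]) (use assms in \<open>simp add: I_def ennreal_mult_less_top\<close>)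
  moreover have "\<bar>x t - x r\<bar> \<le> H * \<bar>t - r\<bar> powr \<gamma>" if "r \<in> {a..b}" "t \<in> {a..b}" for r t
    using that sub by (intro x(3)) auto
  ultimately have *: "frac_integrable a b f x"
    "(difference_quotient a b f x \<longlongrightarrow> frac_integral a b f x) (at_right 0)"
    "\<bar>frac_integral a b f x\<bar> \<le> holder_const (1 - \<beta>) \<gamma> * H * (b - a) powr (\<gamma> - (1 - \<beta>)) *
      (\<beta> / Gamma (1 - \<beta>) * enn2real (frac_energy \<beta> a b (\<lambda>t. indicator {a..b} t * f t)))"
    by (intro frac_integral_holder[OF ab(2) par(1,2) continuous_on_subset[OF f(1) sub] continuous_on_subset[OF x(1) sub] x(2) _ \<beta>(1,3)]; blast)+
  show "frac_integrable a b f x"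
    "(difference_quotient a b f x \<longlongrightarrow> frac_integral a b f x) (at_right 0)"
    "\<bar>frac_integral a b f x\<bar> \<le> holder_const (1 - \<beta>) \<gamma> * H * (b - a) powr (\<gamma> - (1 - \<beta>)) *
      (\<beta> / Gamma (1 - \<beta>) * enn2real (frac_energy \<beta> a b (\<lambda>t. indicator {a..b} t * f t)))"
    by (fact *)+
qed

lemma power_type_moment:
  assumes m: "0 < m" "(\<integral>\<^sup>+t\<in>{a..b}. inverse (ennreal (norm (y t) powr (\<eta> / (\<gamma> * (\<kappa> + \<eta>))))) \<partial>lborel) \<le> ennreal m"
  shows "(\<integral>\<^sup>+t\<in>{a..b}. inverse (ennreal (norm (y t) powr \<eta>)) \<partial>lborel)
    \<le> ennreal (2 * (m powr (\<gamma> * (\<kappa> + \<eta>)) * (b - a) powr (1 - \<gamma> * (\<kappa> + \<eta>))))"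
  using nn_integral_powr_le[OF ab(2) \<beta>(6,5), of "\<lambda>t. norm (y t)" m \<eta>] m inverse_moment_measurable[OF continuous_on_subset[OF y(1) sub]]
  unfolding \<beta>0_def by auto

text \<open>The hypotheses on \<open>b1\<close> and \<open>C\<close> spell out the order of differentiation and the resulting
  constant, which involve neither the interval nor the paths. The powers of \<open>b - a\<close> are
  \<open>1 - \<beta>\<close> from the energy and \<open>\<gamma> - (1 - \<beta>)\<close> from \<open>x\<close>.\<close>

lemma power_type_integral_bound:
  assumes m: "0 < m" "(\<integral>\<^sup>+t\<in>{a..b}. inverse (ennreal (norm (y t) powr (\<eta> / (\<gamma> * (\<kappa> + \<eta>))))) \<partial>lborel) \<le> ennreal m"
    and b: "b1 = (1 - \<gamma> + \<gamma> * (\<kappa> + \<eta>)) / 2"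
    and C: "C = holder_const (1 - b1) \<gamma> * (b1 / Gamma (1 - b1)) * max (1 / (b1 * (1 - b1))) (2 / (\<gamma> * (\<kappa> + \<eta>) - b1))"
  shows "\<bar>frac_integral a b f x\<bar>
    \<le> C * H * (M + N * Y powr (\<kappa> + \<eta>) * m powr (\<gamma> * (\<kappa> + \<eta>))) * (b - a) powr \<gamma>"
proof -
  define L where "L = b - a"
  have L: "0 < L" using ab by (simp add: L_def)
  define c where "c = max (1 / (\<beta> * (1 - \<beta>))) (2 / (\<beta>0 - \<beta>))"
  have c0: "0 \<le> c" unfolding c_def using \<beta> by (intro max.coboundedI1) auto
  define S where "S = M + N * Y powr (\<kappa> + \<eta>) * m powr \<beta>0"
  have S0: "0 \<le> S" using f(2,4) by (simp add: S_def)
  have G: "0 < Gamma (1 - \<beta>)" using \<beta> by (intro Gamma_real_pos) auto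
  have hc: "0 \<le> holder_const (1 - \<beta>) \<gamma>"
    unfolding holder_const_def using \<beta> by (intro mult_nonneg_nonneg add_nonneg_nonneg divide_nonneg_nonneg less_imp_le[OF Gamma_real_pos]) auto
  have I: "I \<le> ennreal (2 * (m powr \<beta>0 * L powr (1 - \<beta>0)))"
    using power_type_moment[OF m] by (simp add: I_def \<beta>0_def L_def)
  define K where "K = N * Y powr (\<kappa> + \<eta>)"
  have K0: "0 \<le> K" using f(2) by (simp add: K_def)
  have "frac_energy \<beta> a b (\<lambda>t. indicator {a..b} t * f t)
     \<le> ennreal (M * L powr (1 - \<beta>) / (\<beta> * (1 - \<beta>))) + ennreal (K * L powr (\<beta>0 - \<beta>) / (\<beta>0 - \<beta>)) * ennreal (2 * (m powr \<beta>0 * L powr (1 - \<beta>0)))"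
    using energy unfolding L_def[symmetric] K_def[symmetric]
    by (rule order_trans) (intro add_left_mono mult_left_mono I zero_le)
  also have "\<dots> = ennreal (M * L powr (1 - \<beta>) / (\<beta> * (1 - \<beta>)) + K * L powr (\<beta>0 - \<beta>) / (\<beta>0 - \<beta>) * (2 * (m powr \<beta>0 * L powr (1 - \<beta>0))))"
    using f(4) \<beta> K0 by (subst ennreal_mult'[symmetric], simp, subst ennreal_plus[symmetric]) auto
  also have "\<dots> \<le> ennreal (c * S * L powr (1 - \<beta>))"
  proof (rule ennreal_leI)
    have "M * L powr (1 - \<beta>) / (\<beta> * (1 - \<beta>)) = (1 / (\<beta> * (1 - \<beta>))) * (M * L powr (1 - \<beta>))" by simp
    also have "\<dots> \<le> c * (M * L powr (1 - \<beta>))" using f(4) by (intro mult_right_mono) (auto simp: c_def)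
    finally have 1: "M * L powr (1 - \<beta>) / (\<beta> * (1 - \<beta>)) \<le> c * (M * L powr (1 - \<beta>))" .
    have "L powr (\<beta>0 - \<beta>) * L powr (1 - \<beta>0) = L powr (1 - \<beta>)" by (simp flip: powr_add)
    then have "K * L powr (\<beta>0 - \<beta>) / (\<beta>0 - \<beta>) * (2 * (m powr \<beta>0 * L powr (1 - \<beta>0)))
       = (2 / (\<beta>0 - \<beta>)) * (K * m powr \<beta>0 * L powr (1 - \<beta>))"
      by (simp add: mult_ac)
    also have "\<dots> \<le> c * (K * m powr \<beta>0 * L powr (1 - \<beta>))"
      using K0 by (intro mult_right_mono) (auto simp: c_def)
    finally show "M * L powr (1 - \<beta>) / (\<beta> * (1 - \<beta>)) + K * L powr (\<beta>0 - \<beta>) / (\<beta>0 - \<beta>) * (2 * (m powr \<beta>0 * L powr (1 - \<beta>0)))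
      \<le> c * S * L powr (1 - \<beta>)"
      using 1 by (simp add: S_def K_def algebra_simps)
  qed
  finally have "enn2real (frac_energy \<beta> a b (\<lambda>t. indicator {a..b} t * f t)) \<le> c * S * L powr (1 - \<beta>)"
    by (rule enn2real_leI[rotated]) (use S0 c0 in \<open>auto intro!: mult_nonneg_nonneg\<close>)
  then have E: "\<beta> / Gamma (1 - \<beta>) * enn2real (frac_energy \<beta> a b (\<lambda>t. indicator {a..b} t * f t)) \<le> \<beta> / Gamma (1 - \<beta>) * (c * S * L powr (1 - \<beta>))"
    using \<beta> G by (intro mult_left_mono) auto
  have "(\<integral>\<^sup>+t\<in>{a..b}. inverse (ennreal (norm (y t) powr \<eta>)) \<partial>lborel) < \<infinity>"
    using power_type_moment[OF m] by (rule le_less_trans) simp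
  from power_type_frac_integrable(3)[OF this]
  have "\<bar>frac_integral a b f x\<bar> \<le> holder_const (1 - \<beta>) \<gamma> * H * L powr (\<gamma> - (1 - \<beta>)) * (\<beta> / Gamma (1 - \<beta>) * (c * S * L powr (1 - \<beta>)))"
    unfolding L_def[symmetric]
    by (rule order_trans) (intro mult_left_mono E mult_nonneg_nonneg hc x(2) powr_ge_zero)
  also have "\<dots> = holder_const (1 - \<beta>) \<gamma> * (\<beta> / Gamma (1 - \<beta>)) * c * H * S * (L powr (\<gamma> - (1 - \<beta>)) * L powr (1 - \<beta>))"
    by (simp add: mult_ac)
  also have "L powr (\<gamma> - (1 - \<beta>)) * L powr (1 - \<beta>) = L powr \<gamma>" by (simp flip: powr_add)
  finally show ?thesis
    unfolding C b c_def S_def L_def \<beta>_def \<beta>0_def by simp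
qed

end

section \<open>Paths in Hoelder spaces\<close>

lemma holder_seminorm_bound:
  assumes f: "f \<in> holder_space \<gamma> T" and "r \<in> {0..T}" "t \<in> {0..T}"
  shows "norm (f t - f r) \<le> holder_seminorm \<gamma> T f * \<bar>t - r\<bar> powr \<gamma>"
proof -
  have less: "norm (f t - f r) \<le> holder_seminorm \<gamma> T f * \<bar>t - r\<bar> powr \<gamma>" if "0 \<le> r" "r < t" "t \<le> T" for r t
  proof -
    have "norm (f t - f r) / \<bar>t - r\<bar> powr \<gamma> \<in> holder_quotients \<gamma> T f"
      using that unfolding holder_quotients_def by blast
    then have "norm (f t - f r) / \<bar>t - r\<bar> powr \<gamma> \<le> holder_seminorm \<gamma> T f"
      using f unfolding holder_seminorm_def holder_space_def by (intro cSup_upper) auto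
    then show ?thesis using that by (simp add: divide_le_eq)
  qed
  show ?thesis
    using less[of r t] less[of t r] assms
    by (cases r t rule: linorder_cases) (auto simp: norm_minus_commute abs_minus_commute)
qed

lemma holder_seminorm_nonneg:
  assumes "f \<in> holder_space \<gamma> T" "0 < T"
  shows "0 \<le> holder_seminorm \<gamma> T f"
proof -
  have "0 \<le> holder_seminorm \<gamma> T f * \<bar>T - 0\<bar> powr \<gamma>"
    by (rule order_trans[OF norm_ge_zero holder_seminorm_bound[OF assms(1)]]) (use assms(2) in auto)
  then show ?thesis using assms(2) by (simp add: zero_le_mult_iff)
qed

lemma holder_spaceI:
  assumes T: "0 < T" and le: "\<And>s t. 0 \<le> s \<Longrightarrow> s < t \<Longrightarrow> t \<le> T \<Longrightarrow> norm (f t - f s) \<le> C * (t - s) powr \<gamma>"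
  shows "f \<in> holder_space \<gamma> T" "holder_seminorm \<gamma> T f \<le> C"
proof -
  have q: "z \<le> C" if "z \<in> holder_quotients \<gamma> T f" for z
    using that le unfolding holder_quotients_def by (auto simp: divide_le_eq)
  show "f \<in> holder_space \<gamma> T" unfolding holder_space_def bdd_above_def using q by auto
  have "norm (f T - f 0) / \<bar>T - 0\<bar> powr \<gamma> \<in> holder_quotients \<gamma> T f"
    unfolding holder_quotients_def using T by blast
  then show "holder_seminorm \<gamma> T f \<le> C"
    unfolding holder_seminorm_def by (intro cSup_least q) auto
qed

lemma holder_space_continuous:
  assumes "f \<in> holder_space \<gamma> T" "0 < \<gamma>"
  shows "continuous_on {0..T} f"
  unfolding continuous_on_def
proof
  fix t assume t: "t \<in> {0..T}"
  have lim: "((\<lambda>r. holder_seminorm \<gamma> T f * \<bar>r - t\<bar> powr \<gamma>) \<longlongrightarrow> 0) (at t within {0..T})"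
    using assms(2) by (auto intro!: tendsto_eq_intros)
  have "((\<lambda>r. f r - f t) \<longlongrightarrow> 0) (at t within {0..T})"
    by (rule Lim_null_comparison[OF _ lim])
      (use t in \<open>auto simp: eventually_at_filter intro!: always_eventually holder_seminorm_bound[OF assms(1)]\<close>)
  then show "(f \<longlongrightarrow> f t) (at t within {0..T})" by (rule Lim_null[THEN iffD2])
qed

text \<open>If the two norms agree, the pair does not enter the supremum, but then the hypothesis on
  \<open>\<sigma>\<close> makes the increment vanish.\<close>

lemma power_modulus_bound:
  fixes \<sigma> :: "real ^ 'm \<Rightarrow> 'b::real_normed_vector"
  assumes \<sigma>: "power_type_coeff \<kappa> \<sigma>" and \<kappa>: "0 < \<kappa>"
  shows "norm (\<sigma> \<xi>2 - \<sigma> \<xi>1) \<le> power_modulus \<kappa> \<sigma> * \<bar>norm \<xi>2 powr \<kappa> - norm \<xi>1 powr \<kappa>\<bar>"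
    and "0 \<le> power_modulus \<kappa> \<sigma>"
proof -
  obtain C where C: "\<And>\<xi>1 \<xi>2. norm (\<sigma> \<xi>2 - \<sigma> \<xi>1) \<le> C * \<bar>norm \<xi>2 powr \<kappa> - norm \<xi>1 powr \<kappa>\<bar>"
    using \<sigma> unfolding power_type_coeff_def by blast
  have ne: "norm \<xi>2 powr \<kappa> \<noteq> norm \<xi>1 powr \<kappa>" if "norm \<xi>1 \<noteq> norm \<xi>2" for \<xi>1 \<xi>2 :: "real ^ 'm"
    using that \<kappa> powr_less_mono2[of \<kappa> "norm \<xi>1" "norm \<xi>2"] powr_less_mono2[of \<kappa> "norm \<xi>2" "norm \<xi>1"]
    by (cases "norm \<xi>1" "norm \<xi>2" rule: linorder_cases) auto
  let ?Q = "{norm (\<sigma> \<xi>2 - \<sigma> \<xi>1) / \<bar>norm \<xi>2 powr \<kappa> - norm \<xi>1 powr \<kappa>\<bar> | \<xi>1 \<xi>2. norm \<xi>1 \<noteq> norm \<xi>2}"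
  have bdd: "bdd_above ?Q"
    unfolding bdd_above_def using C ne by (auto simp: divide_le_eq intro!: exI[of _ C])
  have q: "norm (\<sigma> \<xi>2 - \<sigma> \<xi>1) / \<bar>norm \<xi>2 powr \<kappa> - norm \<xi>1 powr \<kappa>\<bar> \<le> power_modulus \<kappa> \<sigma>" if "norm \<xi>1 \<noteq> norm \<xi>2" for \<xi>1 \<xi>2
    unfolding power_modulus_def using that by (intro cSup_upper[OF _ bdd]) blast
  show "norm (\<sigma> \<xi>2 - \<sigma> \<xi>1) \<le> power_modulus \<kappa> \<sigma> * \<bar>norm \<xi>2 powr \<kappa> - norm \<xi>1 powr \<kappa>\<bar>"
  proof (cases "norm \<xi>1 = norm \<xi>2")
    case True then show ?thesis using C[of \<xi>2 \<xi>1] by simp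
  next
    case False then show ?thesis using q[OF False] ne[OF False] by (simp add: divide_le_eq)
  qed
  have "norm (0 :: real ^ 'm) \<noteq> norm (axis undefined 1 :: real ^ 'm)" by simp
  from q[OF this] show "0 \<le> power_modulus \<kappa> \<sigma>" by (rule order_trans[rotated]) simp
qed

lemma power_type_continuous:
  fixes \<sigma> :: "real ^ 'm \<Rightarrow> real ^ 'n"
  assumes \<sigma>: "power_type_coeff \<kappa> \<sigma>" and \<kappa>: "0 < \<kappa>" and y: "continuous_on S y"
  shows "continuous_on S (\<lambda>s. \<sigma> (y s))"
  unfolding continuous_on_def
proof
  fix t assume t: "t \<in> S"
  have "continuous_on S (\<lambda>s. power_modulus \<kappa> \<sigma> * \<bar>norm (y s) powr \<kappa> - norm (y t) powr \<kappa>\<bar>)"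
    using \<kappa> by (intro continuous_intros continuous_on_powr' y) auto
  then have lim: "((\<lambda>s. power_modulus \<kappa> \<sigma> * \<bar>norm (y s) powr \<kappa> - norm (y t) powr \<kappa>\<bar>) \<longlongrightarrow> 0) (at t within S)"
    using t unfolding continuous_on_def by force
  have "((\<lambda>s. \<sigma> (y s) - \<sigma> (y t)) \<longlongrightarrow> 0) (at t within S)"
    by (rule Lim_null_comparison[OF _ lim]) (auto intro!: always_eventually power_modulus_bound(1)[OF \<sigma> \<kappa>])
  then show "((\<lambda>s. \<sigma> (y s)) \<longlongrightarrow> \<sigma> (y t)) (at t within S)" by (rule Lim_null[THEN iffD2])
qed

text \<open>The integrand is nowhere \<open>0\<close>. The moment is used as the value \<open>m\<close> of
  \<open>nn_integral_powr_le\<close>, where it has to be positive.\<close>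

lemma neg_moment_pos:
  fixes y :: "real \<Rightarrow> 'a::real_normed_vector"
  assumes "0 < T" "continuous_on {0..T} y"
  shows "0 < neg_moment e T y"
proof (rule ccontr)
  note [measurable] = inverse_moment_measurable[OF assms(2), of e]
  assume "\<not> ?thesis"
  then have "(\<integral>\<^sup>+t\<in>{0..T}. inverse (ennreal (norm (y t) powr e)) \<partial>lborel) = 0"
    by (simp add: neg_moment_def nn_integral_completion)
  then have "AE t in lborel. inverse (ennreal (norm (y t) powr e)) * indicator {0..T} t = 0"
    by (subst (asm) nn_integral_0_iff_AE) auto
  then have "AE t in lborel. t \<notin> {0..T}"
    by eventually_elim (auto simp: ennreal_inverse_eq_0_iff split: split_indicator_asm)
  then have "emeasure lborel {0..T} = 0"
    by (subst (asm) AE_iff_measurable[of "{0..T}"]) auto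
  then show False using assms by simp
qed

lemma power_type_path:
  fixes \<sigma> :: "real ^ 'm \<Rightarrow> real ^ 'm" and y :: "real \<Rightarrow> real ^ 'm"
  assumes \<kappa>: "0 < \<kappa>" and \<sigma>: "power_type_coeff \<kappa> \<sigma>" and y: "continuous_on {0..T} y" and T: "0 < T"
  shows "continuous_on {0..T} (\<lambda>s. \<sigma> (y s) $ i)"
    and "0 \<le> power_modulus \<kappa> \<sigma>"
    and "\<And>r t. r \<in> {0..T} \<Longrightarrow> t \<in> {0..T} \<Longrightarrow>
      \<bar>\<sigma> (y t) $ i - \<sigma> (y r) $ i\<bar> \<le> power_modulus \<kappa> \<sigma> * \<bar>norm (y t) powr \<kappa> - norm (y r) powr \<kappa>\<bar>"
    and "0 \<le> (SUP s\<in>{0..T}. norm (\<sigma> (y s)))"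
    and "\<And>t. t \<in> {0..T} \<Longrightarrow> \<bar>\<sigma> (y t) $ i\<bar> \<le> (SUP s\<in>{0..T}. norm (\<sigma> (y s)))"
proof -
  have c: "continuous_on {0..T} (\<lambda>s. \<sigma> (y s))" by (rule power_type_continuous[OF \<sigma> \<kappa> y])
  then show "continuous_on {0..T} (\<lambda>s. \<sigma> (y s) $ i)" by (intro continuous_intros)
  show "0 \<le> power_modulus \<kappa> \<sigma>" by (rule power_modulus_bound(2)[OF \<sigma> \<kappa>])
  show "\<bar>\<sigma> (y t) $ i - \<sigma> (y r) $ i\<bar> \<le> power_modulus \<kappa> \<sigma> * \<bar>norm (y t) powr \<kappa> - norm (y r) powr \<kappa>\<bar>" for r t
    using component_le_norm_cart[of "\<sigma> (y t) - \<sigma> (y r)" i] power_modulus_bound(1)[OF \<sigma> \<kappa>, of "y t" "y r"] by simp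
  have bdd: "bdd_above ((\<lambda>s. norm (\<sigma> (y s))) ` {0..T})"
    by (intro bounded_imp_bdd_above compact_imp_bounded compact_continuous_image continuous_intros c) simp
  have le: "norm (\<sigma> (y t)) \<le> (SUP s\<in>{0..T}. norm (\<sigma> (y s)))" if "t \<in> {0..T}" for t
    using that by (intro cSUP_upper bdd)
  show "0 \<le> (SUP s\<in>{0..T}. norm (\<sigma> (y s)))" using T by (intro order_trans[OF norm_ge_zero le[of 0]]) simp
  show "\<bar>\<sigma> (y t) $ i\<bar> \<le> (SUP s\<in>{0..T}. norm (\<sigma> (y s)))" if "t \<in> {0..T}" for t
    using le[OF that] component_le_norm_cart[of "\<sigma> (y t)" i] by linarith
qed

lemma neg_moment_subinterval:
  assumes "0 \<le> a" "b \<le> T"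
  shows "(\<integral>\<^sup>+t\<in>{a..b}. inverse (ennreal (norm (y t) powr e)) \<partial>lborel) \<le> neg_moment e T y"
  unfolding neg_moment_def nn_integral_completion using assms
  by (intro nn_integral_mono) (auto split: split_indicator)

theorem proposition2p4:
  fixes T \<gamma> \<kappa> \<eta> :: real
  assumes "0 < T"
    and "1 / 2 < \<gamma>" and "\<gamma> < 1"
    and "0 < \<kappa>" and "\<kappa> < 1"
    and "\<gamma> * (\<kappa> + 1) < 1"
    and "(1 - \<gamma> * (1 + \<kappa>)) / \<gamma> < \<eta>" and "\<eta> < 1 - \<kappa>"
  shows "(\<forall>(x :: real \<Rightarrow> real) (\<sigma> :: real ^ 'm \<Rightarrow> real ^ 'm) (y :: real \<Rightarrow> real ^ 'm).
            x \<in> holder_space \<gamma> T \<longrightarrow> power_type_coeff \<kappa> \<sigma> \<longrightarrow>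
            y \<in> holder_space_neg \<gamma> \<eta> T \<longrightarrow>
            (\<forall>t\<in>{0..T}. frac_integrable_vec 0 t (\<lambda>s. \<sigma> (y s)) x))
       \<and> (\<exists>c>0. \<forall>(x :: real \<Rightarrow> real) (\<sigma> :: real ^ 'm \<Rightarrow> real ^ 'm) (y :: real \<Rightarrow> real ^ 'm).
            x \<in> holder_space \<gamma> T \<longrightarrow> power_type_coeff \<kappa> \<sigma> \<longrightarrow>
            y \<in> holder_space_neg \<gamma> (\<eta> / (\<gamma> * (\<kappa> + \<eta>))) T \<longrightarrow>
            Lambda_map \<sigma> x y \<in> holder_space \<gamma> T \<and>
            holder_seminorm \<gamma> T (Lambda_map \<sigma> x y)
              \<le> c * holder_seminorm \<gamma> T x *
                 ((SUP s\<in>{0..T}. norm (\<sigma> (y s)))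
                  + power_modulus \<kappa> \<sigma> * holder_seminorm \<gamma> T y powr (\<kappa> + \<eta>)
                    * enn2real (neg_moment (\<eta> / (\<gamma> * (\<kappa> + \<eta>))) T y) powr (\<gamma> * (\<kappa> + \<eta>))))"
proof -
  define \<beta>0 where "\<beta>0 = \<gamma> * (\<kappa> + \<eta>)"
  have \<gamma>: "0 < \<gamma>" "\<gamma> < 1" and \<kappa>: "0 < \<kappa>" "\<kappa> < 1" using assms by auto
  have "0 < (1 - \<gamma> * (1 + \<kappa>)) / \<gamma>" using assms(6) \<gamma> by (simp add: algebra_simps)
  then have \<eta>: "0 < \<eta>" "\<kappa> + \<eta> < 1" using assms(7,8) by auto
  have lower: "1 - \<gamma> < \<gamma> * (\<kappa> + \<eta>)"
    using assms(7) \<gamma> by (simp add: divide_less_eq algebra_simps)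
  have upper: "\<beta>0 < 1"
    using \<gamma> \<eta> \<kappa> mult_strict_mono[of \<gamma> 1 "\<kappa> + \<eta>" 1] by (simp add: \<beta>0_def)
  have \<beta>0: "0 < \<beta>0" using \<gamma> \<eta> \<kappa> by (simp add: \<beta>0_def)
  note par = \<gamma> \<kappa> \<eta> lower
  define b1 where "b1 = (1 - \<gamma> + \<gamma> * (\<kappa> + \<eta>)) / 2"
  have b1: "0 < b1" "b1 < 1" "1 - b1 < \<gamma>" "b1 < \<gamma> * (\<kappa> + \<eta>)"
  proof -
    have "b1 = (1 - \<gamma> + \<beta>0) / 2" "1 - \<gamma> < \<beta>0" using lower by (auto simp: b1_def \<beta>0_def)
    then have "0 < b1" "b1 < 1" "1 - b1 < \<gamma>" "b1 < \<beta>0" using upper \<gamma> by (auto simp: field_simps)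
    then show "0 < b1" "b1 < 1" "1 - b1 < \<gamma>" "b1 < \<gamma> * (\<kappa> + \<eta>)" by (auto simp: \<beta>0_def)
  qed
  define C where "C = holder_const (1 - b1) \<gamma> * (b1 / Gamma (1 - b1)) * max (1 / (b1 * (1 - b1))) (2 / (\<gamma> * (\<kappa> + \<eta>) - b1))"
  have C: "0 < C"
    unfolding C_def holder_const_def using b1
    by (intro mult_pos_pos divide_pos_pos add_pos_pos Gamma_real_pos) (auto simp: less_max_iff_disj)
  note x_cont = holder_space_continuous[OF _ \<gamma>(1)]
  have x_bound: "\<bar>x t - x r\<bar> \<le> holder_seminorm \<gamma> T x * \<bar>t - r\<bar> powr \<gamma>"
    if "x \<in> holder_space \<gamma> T" "r \<in> {0..T}" "t \<in> {0..T}" for x :: "real \<Rightarrow> real" and r t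
    using holder_seminorm_bound[OF that] by simp
  have moment: "(\<integral>\<^sup>+t\<in>{0..t}. inverse (ennreal (norm (y t) powr \<eta>)) \<partial>lborel) < \<infinity>"
    if "y \<in> holder_space_neg \<gamma> \<eta> T" "t \<in> {0..T}" for y :: "real \<Rightarrow> real ^ 'm" and t
    using that by (intro le_less_trans[OF neg_moment_subinterval[of 0 t T]]) (auto simp: holder_space_neg_def)
  \<comment> \<open>The factor \<open>CARD('m)\<close> comes from summing the bounds for the components.\<close>
  show ?thesis
  proof (intro conjI allI impI ballI exI[of _ "real CARD('m) * C"])
    fix x :: "real \<Rightarrow> real" and \<sigma> :: "real ^ 'm \<Rightarrow> real ^ 'm" and y :: "real \<Rightarrow> real ^ 'm" and t
    assume x: "x \<in> holder_space \<gamma> T" and \<sigma>: "power_type_coeff \<kappa> \<sigma>" and y: "y \<in> holder_space_neg \<gamma> \<eta> T" and t: "t \<in> {0..T}"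
    have y': "y \<in> holder_space \<gamma> T" using y by (simp add: holder_space_neg_def)
    show "frac_integrable_vec 0 t (\<lambda>s. \<sigma> (y s)) x"
      unfolding frac_integrable_vec_def
    proof
      fix i
      show "frac_integrable 0 t (\<lambda>s. \<sigma> (y s) $ i) x"
      proof (cases "t = 0")
        case True then show ?thesis by (simp add: frac_integrable_def)
      next
        case False
        then have "0 < t" "t \<le> T" using t by auto
        then show ?thesis
          by (intro power_type_frac_integrable(1)[OF par order_refl _ _ x_cont[OF x] holder_seminorm_nonneg[OF x assms(1)]
            x_bound[OF x] x_cont[OF y'] holder_seminorm_nonneg[OF y' assms(1)] holder_seminorm_bound[OF y']
            power_type_path[OF \<kappa>(1) \<sigma> x_cont[OF y'] assms(1)] moment[OF y t]])
      qed
    qed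
  next
    show "0 < real CARD('m) * C" using C by simp
  next
    fix x :: "real \<Rightarrow> real" and \<sigma> :: "real ^ 'm \<Rightarrow> real ^ 'm" and y :: "real \<Rightarrow> real ^ 'm"
    assume x: "x \<in> holder_space \<gamma> T" and \<sigma>: "power_type_coeff \<kappa> \<sigma>"
      and y: "y \<in> holder_space_neg \<gamma> (\<eta> / (\<gamma> * (\<kappa> + \<eta>))) T"
    have y': "y \<in> holder_space \<gamma> T" using y by (simp add: holder_space_neg_def)
    note yc = x_cont[OF y']
    define H where "H = holder_seminorm \<gamma> T x"
    define m where "m = enn2real (neg_moment (\<eta> / (\<gamma> * (\<kappa> + \<eta>))) T y)"
    define S where "S = (SUP s\<in>{0..T}. norm (\<sigma> (y s))) + power_modulus \<kappa> \<sigma> * holder_seminorm \<gamma> T y powr (\<kappa> + \<eta>) * m powr (\<gamma> * (\<kappa> + \<eta>))"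
    have fin: "neg_moment (\<eta> / (\<gamma> * (\<kappa> + \<eta>))) T y < \<infinity>" using y by (simp add: holder_space_neg_def)
    have m: "0 < m" using fin neg_moment_pos[OF assms(1) yc] by (simp add: m_def enn2real_positive_iff)
    have m_le: "(\<integral>\<^sup>+t\<in>{a..b}. inverse (ennreal (norm (y t) powr (\<eta> / (\<gamma> * (\<kappa> + \<eta>))))) \<partial>lborel) \<le> ennreal m"
      if "0 \<le> a" "b \<le> T" for a b
      using neg_moment_subinterval[OF that, of y "\<eta> / (\<gamma> * (\<kappa> + \<eta>))"] fin by (simp add: m_def)
    have limit: "(difference_quotient a b (\<lambda>s. \<sigma> (y s) $ i) x \<longlongrightarrow> frac_integral a b (\<lambda>s. \<sigma> (y s) $ i) x) (at_right 0)"
      and bound: "\<bar>frac_integral a b (\<lambda>s. \<sigma> (y s) $ i) x\<bar> \<le> C * H * S * (b - a) powr \<gamma>"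
      if ab: "0 \<le> a" "a < b" "b \<le> T" for a b i
    proof -
      note ctx = par ab x_cont[OF x] holder_seminorm_nonneg[OF x assms(1)] x_bound[OF x] yc
        holder_seminorm_nonneg[OF y' assms(1)] holder_seminorm_bound[OF y'] power_type_path[OF \<kappa>(1) \<sigma> yc assms(1)]
      note ml = m m_le[OF ab(1,3)]
      have "(\<integral>\<^sup>+t\<in>{a..b}. inverse (ennreal (norm (y t) powr \<eta>)) \<partial>lborel)
         \<le> ennreal (2 * (m powr (\<gamma> * (\<kappa> + \<eta>)) * (b - a) powr (1 - \<gamma> * (\<kappa> + \<eta>))))"
        by (rule power_type_moment[OF ctx ml])
      then have I: "(\<integral>\<^sup>+t\<in>{a..b}. inverse (ennreal (norm (y t) powr \<eta>)) \<partial>lborel) < \<infinity>"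
        by (rule le_less_trans) simp
      show "(difference_quotient a b (\<lambda>s. \<sigma> (y s) $ i) x \<longlongrightarrow> frac_integral a b (\<lambda>s. \<sigma> (y s) $ i) x) (at_right 0)"
        by (rule power_type_frac_integrable(2)[OF ctx I])
      show "\<bar>frac_integral a b (\<lambda>s. \<sigma> (y s) $ i) x\<bar> \<le> C * H * S * (b - a) powr \<gamma>"
        unfolding H_def S_def by (rule power_type_integral_bound[OF ctx ml b1_def C_def])
    qed
    have diff: "Lambda_map \<sigma> x y t $ i - Lambda_map \<sigma> x y s $ i = frac_integral s t (\<lambda>s. \<sigma> (y s) $ i) x"
      if st: "0 \<le> s" "s < t" "t \<le> T" for s t i
    proof (cases "s = 0")
      case True
      then show ?thesis by (simp add: Lambda_map_def frac_integral_vec_def frac_integral_def)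
    next
      case False
      have sub: "{0..t} \<subseteq> {0..T}" using st by auto
      have "frac_integral 0 t (\<lambda>s. \<sigma> (y s) $ i) x = frac_integral 0 s (\<lambda>s. \<sigma> (y s) $ i) x + frac_integral s t (\<lambda>s. \<sigma> (y s) $ i) x"
        by (rule difference_quotient_additive[OF _ st(2) \<gamma>(1)
            continuous_on_subset[OF power_type_path(1)[OF \<kappa>(1) \<sigma> yc assms(1)] sub]
            continuous_on_subset[OF x_cont[OF x] sub] holder_seminorm_nonneg[OF x assms(1)] x_bound[OF x]
            power_type_path(5)[OF \<kappa>(1) \<sigma> yc assms(1), of _ i] limit limit limit])
          (use st False in auto)
      then show ?thesis by (simp add: Lambda_map_def frac_integral_vec_def)
    qed
    have inc: "norm (Lambda_map \<sigma> x y t - Lambda_map \<sigma> x y s) \<le> (real CARD('m) * C * H * S) * (t - s) powr \<gamma>"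
      if st: "0 \<le> s" "s < t" "t \<le> T" for s t
    proof -
      have "norm (Lambda_map \<sigma> x y t - Lambda_map \<sigma> x y s) \<le> (\<Sum>i\<in>UNIV. \<bar>(Lambda_map \<sigma> x y t - Lambda_map \<sigma> x y s) $ i\<bar>)"
        by (rule norm_le_l1_cart)
      also have "\<dots> \<le> (\<Sum>i\<in>(UNIV :: 'm set). C * H * S * (t - s) powr \<gamma>)"
        by (intro sum_mono) (simp add: diff[OF st] bound[OF st])
      finally show ?thesis by (simp add: mult_ac)
    qed
    note res = holder_spaceI[OF assms(1) inc]
    show "Lambda_map \<sigma> x y \<in> holder_space \<gamma> T" by (rule res(1))
    show "holder_seminorm \<gamma> T (Lambda_map \<sigma> x y)
              \<le> real CARD('m) * C * holder_seminorm \<gamma> T x *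
                 ((SUP s\<in>{0..T}. norm (\<sigma> (y s)))
                  + power_modulus \<kappa> \<sigma> * holder_seminorm \<gamma> T y powr (\<kappa> + \<eta>)
                    * enn2real (neg_moment (\<eta> / (\<gamma> * (\<kappa> + \<eta>))) T y) powr (\<gamma> * (\<kappa> + \<eta>)))"
      using res(2) unfolding H_def S_def m_def .
  qed
qed

end
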